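(* Let $\psi:\mathfrak n^+_{\mathfrak W}\to\mathbb C$ be a Lie algebra homomorphism with $\psi(d_1)\neq0$ and $\psi(d_2)\neq0$, and let $V$ be a nonzero Whittaker module of type $\psi$ for the Witt algebra $\mathfrak W$. Then $V$ is simple. Moreover, $V\cong L_{\psi,0}$ as $\mathfrak W$-modules, when $L_{\psi,0}$ is viewed as a $\mathfrak W$-module.
   Context: The Virasoro algebra is the complex Lie algebra $\mathcal V$ with basis $\{z\}\cup\{d_k : k\in\mathbb Z\}$ and bracket $[d_k,d_j]=(j-k)d_{k+j}+\delta_{j,-k}\frac{k^3-k}{12}z$, $[z,d_k]=0$. The Witt algebra $\mathfrak W$ is the complex Lie algebra with basis $\{d_k:k\in\mathbb Z\}$ and bracket $[d_k,d_j]=(j-k)d_{k+j}$; there is a surjective Lie algebra homomorphism $\rho:\mathcal V\to\mathfrak W$, $d_k\mapsto d_k$, $z\mapsto0$, with kernel $\mathbb Cz$. Let $\mathfrak n^+\subseteq\mathcal V$ and $\mathfrak n^+_{\mathfrak W}\subseteq\mathfrak W$ be the subalgebras spanned by the $d_k$ with $k>0$; they are identified via $\rho$, so $\psi$ is regarded also as a homomorphism $\mathfrak n^+\to\mathbb C$. A $\mathfrak W$-module $V$ is a Whittaker module of type $\psi$ if there is $w\in V$ generating $V$ as a $\mathfrak W$-module with $xw=\psi(x)w$ for all $x\in\mathfrak n^+_{\mathfrak W}$. Let $\mathbb C_\psi$ be the one-dimensional $\mathfrak n^+$-module on which $x$ acts by $\psi(x)$, $M_\psi=U(\mathcal V)\otimes_{U(\mathfrak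 n^+)}\mathbb C_\psi$, and $L_{\psi,0}=M_\psi/zM_\psi$. Since $z$ acts by $0$ on $L_{\psi,0}$, it is a module for $\mathcal V/\mathbb Cz\cong\mathfrak W$. *)

theory Defs
  imports
    Complex_Main
    "HOL-Library.Poly_Mapping"
    "HOL-Algebra.Module"
    "HOL-Algebra.QuotRing"
    "HOL-Algebra.Free_Abelian_Groups"
begin

section \<open>Complex vector spaces, Lie algebras and their modules\<close>

text \<open>A complex vector space is a module, in the sense of \<open>HOL-Algebra\<close>, over the following ring.
  The \<^typ>\<open>('a, 'b) module\<close> record has two fields (ring multiplication and one) that play no role
  for modules; they are left undefined below.\<close>

definition complex_ring :: "complex ring" where
  "complex_ring = \<lparr>carrier = UNIV, monoid.mult = (*), one = 1, ring.zero = 0, add = (+)\<rparr>"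

lemma cring_complex_ring: "cring complex_ring"
proof (rule cringI)
  show "abelian_group complex_ring"
  proof (rule abelian_groupI)
    fix x :: complex
    show "\<exists>y\<in>carrier complex_ring. y \<oplus>\<^bsub>complex_ring\<^esub> x = \<zero>\<^bsub>complex_ring\<^esub>"
      by (rule bexI[of _ "- x"]) (auto simp: complex_ring_def)
  qed (auto simp: complex_ring_def)
  show "comm_monoid complex_ring"
    by (rule comm_monoidI) (auto simp: complex_ring_def)
qed (auto simp: complex_ring_def algebra_simps)

definition lin_span :: "(complex, 'v, 'm) module_scheme \<Rightarrow> 'v set \<Rightarrow> 'v set" where
  "lin_span V S = \<Inter>{H. submodule H complex_ring V \<and> S \<subseteq> H}"

record 'g lie = "(complex, 'g) module" +
  bracket :: "'g \<Rightarrow> 'g \<Rightarrow> 'g"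

locale lie_algebra = module complex_ring L for L :: "('g, 'm) lie_scheme" (structure) +
  assumes bracket_closed: "\<lbrakk>x \<in> carrier L; y \<in> carrier L\<rbrakk> \<Longrightarrow> bracket L x y \<in> carrier L"
    and bracket_add_left: "\<lbrakk>x \<in> carrier L; y \<in> carrier L; u \<in> carrier L\<rbrakk> \<Longrightarrow>
      bracket L (x \<oplus>\<^bsub>L\<^esub> y) u = bracket L x u \<oplus>\<^bsub>L\<^esub> bracket L y u"
    and bracket_add_right: "\<lbrakk>x \<in> carrier L; y \<in> carrier L; u \<in> carrier L\<rbrakk> \<Longrightarrow>
      bracket L u (x \<oplus>\<^bsub>L\<^esub> y) = bracket L u x \<oplus>\<^bsub>L\<^esub> bracket L u y"
    and bracket_smult_left: "\<lbrakk>x \<in> carrier L; y \<in> carrier L\<rbrakk> \<Longrightarrow>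
      bracket L (c \<odot>\<^bsub>L\<^esub> x) y = c \<odot>\<^bsub>L\<^esub> bracket L x y"
    and bracket_smult_right: "\<lbrakk>x \<in> carrier L; y \<in> carrier L\<rbrakk> \<Longrightarrow>
      bracket L x (c \<odot>\<^bsub>L\<^esub> y) = c \<odot>\<^bsub>L\<^esub> bracket L x y"
    and bracket_self: "x \<in> carrier L \<Longrightarrow> bracket L x x = \<zero>\<^bsub>L\<^esub>"
    and jacobi: "\<lbrakk>x \<in> carrier L; y \<in> carrier L; u \<in> carrier L\<rbrakk> \<Longrightarrow>
      bracket L x (bracket L y u) \<oplus>\<^bsub>L\<^esub> bracket L y (bracket L u x)
        \<oplus>\<^bsub>L\<^esub> bracket L u (bracket L x y) = \<zero>\<^bsub>L\<^esub>"

text \<open>A subalgebra \<open>H\<close> of \<open>L\<close> is used as the Lie algebra \<open>L\<lparr>carrier := H\<rparr>\<close>.\<close>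

definition lie_hom :: "('g, 'm) lie_scheme \<Rightarrow> ('h, 'n) lie_scheme \<Rightarrow> ('g \<Rightarrow> 'h) set" where
  "lie_hom L L' = {f. f \<in> carrier L \<rightarrow> carrier L'
     \<and> (\<forall>x\<in>carrier L. \<forall>y\<in>carrier L. f (x \<oplus>\<^bsub>L\<^esub> y) = f x \<oplus>\<^bsub>L'\<^esub> f y)
     \<and> (\<forall>c. \<forall>x\<in>carrier L. f (c \<odot>\<^bsub>L\<^esub> x) = c \<odot>\<^bsub>L'\<^esub> f x)
     \<and> (\<forall>x\<in>carrier L. \<forall>y\<in>carrier L. f (bracket L x y) = bracket L' (f x) (f y))}"

definition abelian_lie_complex :: "complex lie" where
  "abelian_lie_complex = \<lparr>carrier = UNIV, monoid.mult = undefined, one = undefined,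
     ring.zero = 0, add = (+), smult = (*), bracket = (\<lambda>x y. 0)\<rparr>"

record ('g, 'v) lie_rep = "(complex, 'v) module" +
  act :: "'g \<Rightarrow> 'v \<Rightarrow> 'v"

locale lie_module = L?: lie_algebra L + M?: module complex_ring M
  for L :: "('g, 'm) lie_scheme" and M :: "('g, 'v, 'n) lie_rep_scheme" +
  assumes act_closed: "\<lbrakk>x \<in> carrier L; v \<in> carrier M\<rbrakk> \<Longrightarrow> act M x v \<in> carrier M"
    and act_add_left: "\<lbrakk>x \<in> carrier L; y \<in> carrier L; v \<in> carrier M\<rbrakk> \<Longrightarrow>
      act M (x \<oplus>\<^bsub>L\<^esub> y) v = act M x v \<oplus>\<^bsub>M\<^esub> act M y v"
    and act_smult_left: "\<lbrakk>x \<in> carrier L; v \<in> carrier M\<rbrakk> \<Longrightarrow>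
      act M (c \<odot>\<^bsub>L\<^esub> x) v = c \<odot>\<^bsub>M\<^esub> act M x v"
    and act_add_right: "\<lbrakk>x \<in> carrier L; u \<in> carrier M; v \<in> carrier M\<rbrakk> \<Longrightarrow>
      act M x (u \<oplus>\<^bsub>M\<^esub> v) = act M x u \<oplus>\<^bsub>M\<^esub> act M x v"
    and act_smult_right: "\<lbrakk>x \<in> carrier L; v \<in> carrier M\<rbrakk> \<Longrightarrow>
      act M x (c \<odot>\<^bsub>M\<^esub> v) = c \<odot>\<^bsub>M\<^esub> act M x v"
    and act_bracket: "\<lbrakk>x \<in> carrier L; y \<in> carrier L; v \<in> carrier M\<rbrakk> \<Longrightarrow>
      act M (bracket L x y) v = act M x (act M y v) \<ominus>\<^bsub>M\<^esub> act M y (act M x v)"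

definition lie_submodule ::
    "'v set \<Rightarrow> ('g, 'm) lie_scheme \<Rightarrow> ('g, 'v, 'n) lie_rep_scheme \<Rightarrow> bool" where
  "lie_submodule N L M \<longleftrightarrow>
     submodule N complex_ring M \<and> (\<forall>x\<in>carrier L. \<forall>v\<in>N. act M x v \<in> N)"

definition generated_submodule ::
    "('g, 'm) lie_scheme \<Rightarrow> ('g, 'v, 'n) lie_rep_scheme \<Rightarrow> 'v set \<Rightarrow> 'v set" where
  "generated_submodule L M S = \<Inter>{N. lie_submodule N L M \<and> S \<subseteq> N}"

definition simple_lie_module ::
    "('g, 'm) lie_scheme \<Rightarrow> ('g, 'v, 'n) lie_rep_scheme \<Rightarrow> bool" where
  "simple_lie_module L M \<longleftrightarrow> lie_module L M \<and> carrier M \<noteq> {\<zero>\<^bsub>M\<^esub>}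
     \<and> (\<forall>N. lie_submodule N L M \<longrightarrow> N = {\<zero>\<^bsub>M\<^esub>} \<or> N = carrier M)"

definition lie_module_iso :: "('g, 'm) lie_scheme \<Rightarrow> ('g, 'v, 'n) lie_rep_scheme
    \<Rightarrow> ('g, 'w, 'k) lie_rep_scheme \<Rightarrow> ('v \<Rightarrow> 'w) set" where
  "lie_module_iso L M M' = {f. bij_betw f (carrier M) (carrier M')
     \<and> (\<forall>u\<in>carrier M. \<forall>v\<in>carrier M. f (u \<oplus>\<^bsub>M\<^esub> v) = f u \<oplus>\<^bsub>M'\<^esub> f v)
     \<and> (\<forall>c. \<forall>v\<in>carrier M. f (c \<odot>\<^bsub>M\<^esub> v) = c \<odot>\<^bsub>M'\<^esub> f v)
     \<and> (\<forall>x\<in>carrier L. \<forall>v\<in>carrier M. f (act M x v) = act M' x (f v))}"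

definition lie_modules_isomorphic :: "('g, 'm) lie_scheme \<Rightarrow> ('g, 'v, 'n) lie_rep_scheme
    \<Rightarrow> ('g, 'w, 'k) lie_rep_scheme \<Rightarrow> bool" where
  "lie_modules_isomorphic L M M' \<longleftrightarrow> lie_module_iso L M M' \<noteq> {}"

text \<open>As for \<^const>\<open>rcoset_mult\<close>, an operation on cosets is the union of the cosets of its values
  on representatives; for a submodule \<open>N\<close> all these cosets coincide.\<close>

definition quotient_rep :: "('g, 'v, 'n) lie_rep_scheme \<Rightarrow> 'v set \<Rightarrow> ('g, 'v set) lie_rep" where
  "quotient_rep M N = \<lparr>carrier = a_rcosets\<^bsub>M\<^esub> N, monoid.mult = undefined, one = undefined,
     ring.zero = N, add = set_add M,
     smult = (\<lambda>c X. \<Union>v\<in>X. N +>\<^bsub>M\<^esub> (c \<odot>\<^bsub>M\<^esub> v)),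
     act = (\<lambda>x X. \<Union>v\<in>X. N +>\<^bsub>M\<^esub> act M x v)\<rparr>"


section \<open>The universal enveloping algebra\<close>

text \<open>Words under concatenation are wrapped in a type of their own, so that
  \<open>'a free_word \<Rightarrow>\<^sub>0 complex\<close> with the convolution product of \<open>Poly_Mapping\<close> is the
  free associative unital complex algebra on \<^typ>\<open>'a\<close>.\<close>

datatype 'a free_word = Word (letters: "'a list")

instantiation free_word :: (type) monoid_add
begin

definition zero_free_word :: "'a free_word" where "0 = Word []"

definition plus_free_word :: "'a free_word \<Rightarrow> 'a free_word \<Rightarrow> 'a free_word" where
  "u + v = Word (letters u @ letters v)"

instance
  by standard (auto simp: zero_free_word_def plus_free_word_def)

end

definition free_algebra :: "'a set \<Rightarrow> ('a free_word \<Rightarrow>\<^sub>0 complex) ring" where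
  "free_algebra S = \<lparr>carrier = {p. \<forall>w\<in>Poly_Mapping.keys p. set (letters w) \<subseteq> S},
     monoid.mult = (*), one = 1, ring.zero = 0, add = (+)\<rparr>"

definition free_gen :: "'a \<Rightarrow> 'a free_word \<Rightarrow>\<^sub>0 complex" where
  "free_gen x = Poly_Mapping.single (Word [x]) 1"

definition free_scalar :: "complex \<Rightarrow> 'a free_word \<Rightarrow>\<^sub>0 complex" where
  "free_scalar c = Poly_Mapping.single 0 c"

text \<open>The first two families of relations turn the free algebra on the set \<open>L\<close> into the tensor
  algebra of the vector space \<open>L\<close>.\<close>

definition uea_rels :: "('g, 'm) lie_scheme \<Rightarrow> ('g free_word \<Rightarrow>\<^sub>0 complex) set" where
  "uea_rels L =
     {free_gen (x \<oplus>\<^bsub>L\<^esub> y) - free_gen x - free_gen y | x y. x \<in> carrier L \<and> y \<in> carrier L}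
   \<union> {free_gen (c \<odot>\<^bsub>L\<^esub> x) - free_scalar c * free_gen x | c x. x \<in> carrier L}
   \<union> {free_gen x * free_gen y - free_gen y * free_gen x - free_gen (bracket L x y) | x y.
        x \<in> carrier L \<and> y \<in> carrier L}"

definition uea_ideal :: "('g, 'm) lie_scheme \<Rightarrow> ('g free_word \<Rightarrow>\<^sub>0 complex) set" where
  "uea_ideal L = Idl\<^bsub>free_algebra (carrier L)\<^esub> (uea_rels L)"

definition UEA :: "('g, 'm) lie_scheme \<Rightarrow> ('g free_word \<Rightarrow>\<^sub>0 complex) set ring" where
  "UEA L = free_algebra (carrier L) Quot uea_ideal L"

definition uea_class ::
    "('g, 'm) lie_scheme \<Rightarrow> ('g free_word \<Rightarrow>\<^sub>0 complex) \<Rightarrow> ('g free_word \<Rightarrow>\<^sub>0 complex) set" where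
  "uea_class L p = uea_ideal L +>\<^bsub>free_algebra (carrier L)\<^esub> p"

text \<open>The homomorphism \<open>U(H) \<rightarrow> U(L)\<close> induced by the inclusion of a subalgebra \<open>H\<close> in \<open>L\<close>.\<close>

definition uea_incl ::
    "('g, 'm) lie_scheme \<Rightarrow> ('g free_word \<Rightarrow>\<^sub>0 complex) set \<Rightarrow> ('g free_word \<Rightarrow>\<^sub>0 complex) set" where
  "uea_incl L X = (\<Union>p\<in>X. uea_class L p)"

text \<open>The \<open>U(L)\<close>-module structure of an \<open>L\<close>-module \<open>M\<close>: the word \<open>x\<^sub>1 \<dots> x\<^sub>n\<close> acts as the composite
  of the actions of its letters. The value does not depend on the representative of the class.\<close>

definition free_act ::
    "('g, 'v, 'n) lie_rep_scheme \<Rightarrow> ('g free_word \<Rightarrow>\<^sub>0 complex) \<Rightarrow> 'v \<Rightarrow> 'v" where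
  "free_act M p v =
     (\<Oplus>\<^bsub>M\<^esub>w\<in>Poly_Mapping.keys p. Poly_Mapping.lookup p w \<odot>\<^bsub>M\<^esub> foldr (act M) (letters w) v)"

definition uea_act ::
    "('g, 'v, 'n) lie_rep_scheme \<Rightarrow> ('g free_word \<Rightarrow>\<^sub>0 complex) set \<Rightarrow> 'v \<Rightarrow> 'v" where
  "uea_act M X v = the_elem ((\<lambda>p. free_act M p v) ` X)"


section \<open>Tensor products over noncommutative rings and induced modules\<close>

text \<open>\<open>tensor_group R A ra B lb\<close> is \<open>A \<otimes>\<^sub>R B\<close> for a right \<open>R\<close>-module \<open>A\<close> with action \<open>ra\<close> and a left
  \<open>R\<close>-module \<open>B\<close> with action \<open>lb\<close>, as a multiplicatively written group.\<close>

definition tensor_rels :: "('r, 'k) ring_scheme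
    \<Rightarrow> ('a, 'm) ring_scheme \<Rightarrow> ('a \<Rightarrow> 'r \<Rightarrow> 'a)
    \<Rightarrow> ('b, 'n) ring_scheme \<Rightarrow> ('r \<Rightarrow> 'b \<Rightarrow> 'b) \<Rightarrow> ('a \<times> 'b \<Rightarrow>\<^sub>0 int) set" where
  "tensor_rels R A ra B lb =
     {frag_of (a \<oplus>\<^bsub>A\<^esub> a', b) - frag_of (a, b) - frag_of (a', b) | a a' b.
        a \<in> carrier A \<and> a' \<in> carrier A \<and> b \<in> carrier B}
   \<union> {frag_of (a, b \<oplus>\<^bsub>B\<^esub> b') - frag_of (a, b) - frag_of (a, b') | a b b'.
        a \<in> carrier A \<and> b \<in> carrier B \<and> b' \<in> carrier B}
   \<union> {frag_of (ra a r, b) - frag_of (a, lb r b) | a r b.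
        a \<in> carrier A \<and> r \<in> carrier R \<and> b \<in> carrier B}"

definition tensor_subgroup :: "('r, 'k) ring_scheme
    \<Rightarrow> ('a, 'm) ring_scheme \<Rightarrow> ('a \<Rightarrow> 'r \<Rightarrow> 'a)
    \<Rightarrow> ('b, 'n) ring_scheme \<Rightarrow> ('r \<Rightarrow> 'b \<Rightarrow> 'b) \<Rightarrow> ('a \<times> 'b \<Rightarrow>\<^sub>0 int) set" where
  "tensor_subgroup R A ra B lb =
     generate (free_Abelian_group (carrier A \<times> carrier B)) (tensor_rels R A ra B lb)"

definition tensor_group :: "('r, 'k) ring_scheme
    \<Rightarrow> ('a, 'm) ring_scheme \<Rightarrow> ('a \<Rightarrow> 'r \<Rightarrow> 'a)
    \<Rightarrow> ('b, 'n) ring_scheme \<Rightarrow> ('r \<Rightarrow> 'b \<Rightarrow> 'b) \<Rightarrow> ('a \<times> 'b \<Rightarrow>\<^sub>0 int) set monoid" where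
  "tensor_group R A ra B lb =
     free_Abelian_group (carrier A \<times> carrier B) Mod tensor_subgroup R A ra B lb"

text \<open>\<open>U(L) \<otimes>\<^bsub>U(H)\<^esub> N\<close> for a subalgebra \<open>H\<close> of \<open>L\<close> and an \<open>H\<close>-module \<open>N\<close>. An element \<open>u\<close> of \<open>U(L)\<close>
  acts by \<open>u (a \<otimes> n) = (u a) \<otimes> n\<close>; complex scalars and elements of \<open>L\<close> act through their images
  in \<open>U(L)\<close>.\<close>

definition induced_subgroup where
  "induced_subgroup L H N =
     tensor_subgroup (UEA (L\<lparr>carrier := H\<rparr>))
       (UEA L) (\<lambda>a r. a \<otimes>\<^bsub>UEA L\<^esub> uea_incl L r) N (uea_act N)"

definition induced_group where
  "induced_group L H N =
     tensor_group (UEA (L\<lparr>carrier := H\<rparr>))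
       (UEA L) (\<lambda>a r. a \<otimes>\<^bsub>UEA L\<^esub> uea_incl L r) N (uea_act N)"

definition induced_act where
  "induced_act L H N u X =
     (\<Union>f\<in>X. induced_subgroup L H N #>\<^bsub>free_Abelian_group (carrier (UEA L) \<times> carrier N)\<^esub>
        frag_extend (\<lambda>(a, n). frag_of (u \<otimes>\<^bsub>UEA L\<^esub> a, n)) f)"

definition induced_module :: "'g lie \<Rightarrow> 'g set \<Rightarrow> ('g, 'v) lie_rep
    \<Rightarrow> ('g, (('g free_word \<Rightarrow>\<^sub>0 complex) set \<times> 'v \<Rightarrow>\<^sub>0 int) set) lie_rep" where
  "induced_module L H N = \<lparr>carrier = carrier (induced_group L H N),
     monoid.mult = undefined, one = undefined,
     ring.zero = \<one>\<^bsub>induced_group L H N\<^esub>, add = monoid.mult (induced_group L H N),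
     smult = (\<lambda>c. induced_act L H N (uea_class L (free_scalar c))),
     act = (\<lambda>x. induced_act L H N (uea_class L (free_gen x)))\<rparr>"


section \<open>The Virasoro and Witt algebras\<close>

definition scale :: "complex \<Rightarrow> ('b \<Rightarrow>\<^sub>0 complex) \<Rightarrow> ('b \<Rightarrow>\<^sub>0 complex)" where
  "scale c f = Poly_Mapping.map (\<lambda>a. c * a) f"

lemma lookup_scale [simp]: "Poly_Mapping.lookup (scale c f) i = c * Poly_Mapping.lookup f i"
  by (simp add: scale_def Poly_Mapping.map.rep_eq when_def)

lemma scale_simps [simp]:
  "scale 0 f = 0" "scale c 0 = 0" "scale 1 f = f" "scale c (scale c' f) = scale (c * c') f"
  "scale c (f + g) = scale c f + scale c g" "scale c (- f) = - scale c f"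
  "scale (c + c') f = scale c f + scale c' f" "scale (- c) f = - scale c f"
  by (auto intro!: poly_mapping_eqI simp: lookup_add algebra_simps)

lemma scale_single [simp]: "scale c (Poly_Mapping.single i a) = Poly_Mapping.single i (c * a)"
  by (intro poly_mapping_eqI) (simp add: lookup_single when_def)

lemma scale_sum: "scale c (sum h A) = (\<Sum>i\<in>A. scale c (h i))"
  by (induction A rule: infinite_finite_induct) auto

definition lin_ext :: "('b \<Rightarrow> ('c \<Rightarrow>\<^sub>0 complex)) \<Rightarrow> ('b \<Rightarrow>\<^sub>0 complex) \<Rightarrow> ('c \<Rightarrow>\<^sub>0 complex)" where
  "lin_ext h f = (\<Sum>i\<in>Poly_Mapping.keys f. scale (Poly_Mapping.lookup f i) (h i))"

lemma lin_ext_eq: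
  assumes "finite A" "Poly_Mapping.keys f \<subseteq> A"
  shows "lin_ext h f = (\<Sum>i\<in>A. scale (Poly_Mapping.lookup f i) (h i))"
  unfolding lin_ext_def using assms by (intro sum.mono_neutral_left) (auto simp: in_keys_iff)

lemma lin_ext_0 [simp]: "lin_ext h 0 = 0" "lin_ext (\<lambda>_. 0) f = 0"
  by (auto simp: lin_ext_def)

lemma lin_ext_single [simp]: "lin_ext h (Poly_Mapping.single i c) = scale c (h i)"
  by (simp add: lin_ext_def)

lemma lin_ext_add [simp]: "lin_ext h (f + g) = lin_ext h f + lin_ext h g"
proof -
  let ?A = "Poly_Mapping.keys f \<union> Poly_Mapping.keys g"
  have "lin_ext h f' = (\<Sum>i\<in>?A. scale (Poly_Mapping.lookup f' i) (h i))" if "f' \<in> {f, g, f + g}" for f'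
    using that Poly_Mapping.keys_add[of f g] by (intro lin_ext_eq) auto
  then show ?thesis by (simp add: lookup_add sum.distrib)
qed

lemma lin_ext_scale [simp]: "lin_ext h (scale c f) = scale c (lin_ext h f)"
proof -
  have "lin_ext h (scale c f) =
      (\<Sum>i\<in>Poly_Mapping.keys f. scale (Poly_Mapping.lookup (scale c f) i) (h i))"
    by (rule lin_ext_eq) (auto simp: in_keys_iff)
  then show ?thesis by (simp add: lin_ext_def scale_sum)
qed

lemma lin_ext_uminus [simp]: "lin_ext h (- f) = - lin_ext h f"
  using lin_ext_scale[of h "-1" f] by simp

lemma lin_ext_fun [simp]:
  "lin_ext (\<lambda>i. h i + h' i) f = lin_ext h f + lin_ext h' f"
  "lin_ext (\<lambda>i. scale c (h i)) f = scale c (lin_ext h f)"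
  "lin_ext (\<lambda>i. - h i) f = - lin_ext h f"
  by (simp_all add: lin_ext_def sum.distrib scale_sum sum_negf mult.commute)

lemma basis_induct [case_names zero single add]:
  fixes f :: "'b \<Rightarrow>\<^sub>0 complex"
  assumes "P 0" "\<And>i c. P (Poly_Mapping.single i c)" "\<And>f g. P f \<Longrightarrow> P g \<Longrightarrow> P (f + g)"
  shows "P f"
proof -
  have "f = (\<Sum>i\<in>Poly_Mapping.keys f. Poly_Mapping.single i (Poly_Mapping.lookup f i))"
    by (intro poly_mapping_eqI) (simp add: lookup_sum lookup_single when_def in_keys_iff)
  moreover have "finite A \<Longrightarrow> P (\<Sum>i\<in>A. Poly_Mapping.single i (Poly_Mapping.lookup f i))" for A
    by (induction A rule: finite_induct) (auto intro: assms)
  ultimately show ?thesis by (metis finite_keys)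
qed

text \<open>The Lie algebra with basis \<^typ>\<open>'b\<close> and given brackets of basis elements.\<close>

definition basis_lie :: "('b \<Rightarrow> 'b \<Rightarrow> ('b \<Rightarrow>\<^sub>0 complex)) \<Rightarrow> ('b \<Rightarrow>\<^sub>0 complex) lie" where
  "basis_lie br = \<lparr>carrier = UNIV, monoid.mult = undefined, one = undefined,
     ring.zero = 0, add = (+), smult = scale,
     bracket = (\<lambda>f g. lin_ext (\<lambda>i. lin_ext (br i) g) f)\<rparr>"

lemma lie_algebra_basis_lie:
  fixes br :: "'b \<Rightarrow> 'b \<Rightarrow> ('b \<Rightarrow>\<^sub>0 complex)"
  assumes alt: "\<And>i. br i i = 0" and anti: "\<And>i j. br j i = - br i j"
    and jac: "\<And>i j k. lin_ext (br i) (br j k) + lin_ext (br j) (br k i) + lin_ext (br k) (br i j) = 0"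
  shows "lie_algebra (basis_lie br)"
proof -
  define B where "B f g = lin_ext (\<lambda>i. lin_ext (br i) g) f" for f g
  have B_add: "B (f + g) h = B f h + B g h" "B h (f + g) = B h f + B h g" for f g h
    by (auto simp: B_def)
  have B_scale: "B (scale c f) g = scale c (B f g)" "B f (scale c g) = scale c (B f g)" for c f g
    by (auto simp: B_def)
  have B_0: "B 0 g = 0" "B f 0 = 0" for f g by (auto simp: B_def)
  have B_single: "B (Poly_Mapping.single i c) (Poly_Mapping.single j c') = scale (c * c') (br i j)"
    for i j c c' by (simp add: B_def mult.commute)
  have B_anti: "B g f = - B f g" for f g
  proof (induction f rule: basis_induct)
    case (single i c)
    show ?case
    proof (induction g rule: basis_induct)
      case (single j c') show ?case by (simp add: B_single anti[of j i] mult.commute)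
    qed (auto simp: B_add B_0)
  qed (auto simp: B_add B_0)
  have B_self: "B f f = 0" for f
  proof (induction f rule: basis_induct)
    case (add f g) then show ?case using B_anti[of f g] by (simp add: B_add)
  qed (auto simp: B_single B_0 alt)
  have B_jac_single: "B (Poly_Mapping.single i a) (B (Poly_Mapping.single j b) (Poly_Mapping.single k c))
      = scale (a * b * c) (lin_ext (br i) (br j k))" for i j k a b c
    by (simp add: B_single B_scale) (simp add: B_def mult.commute mult.left_commute)
  define J where "J f g h = B f (B g h) + B g (B h f) + B h (B f g)" for f g h
  have J_add: "J (f + f') g h = J f g h + J f' g h" "J g (f + f') h = J g f h + J g f' h"
    "J g h (f + f') = J g h f + J g h f'" for f f' g h
    by (simp_all add: J_def B_add algebra_simps)
  have J_0: "J 0 g h = 0" "J g 0 h = 0" "J g h 0 = 0" for g h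
    by (simp_all add: J_def B_0)
  have J: "J f g h = 0" for f g h
  proof (induction f rule: basis_induct)
    case (single i a)
    show ?case
    proof (induction g rule: basis_induct)
      case (single j b)
      show ?case
      proof (induction h rule: basis_induct)
        case (single k c)
        have "scale (a * b * c) (lin_ext (br i) (br j k) + lin_ext (br j) (br k i) + lin_ext (br k) (br i j)) = 0"
          by (simp add: jac del: scale_simps(5))
        then show ?case by (simp add: J_def B_jac_single mult.commute mult.left_commute)
      next
        case add then show ?case by (auto simp: J_add)
      qed (auto simp: J_0)
    next
      case add then show ?case by (auto simp: J_add)
    qed (auto simp: J_0)
  next
    case add then show ?case by (auto simp: J_add)
  qed (auto simp: J_0)
  have "module complex_ring (basis_lie br)"
  proof (rule moduleI[OF cring_complex_ring])
    show "abelian_group (basis_lie br)"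
    proof (rule abelian_groupI)
      fix x
      show "\<exists>y\<in>carrier (basis_lie br). y \<oplus>\<^bsub>basis_lie br\<^esub> x = \<zero>\<^bsub>basis_lie br\<^esub>"
        by (rule bexI[of _ "- x"]) (auto simp: basis_lie_def)
    qed (auto simp: basis_lie_def algebra_simps)
  qed (auto simp: basis_lie_def complex_ring_def)
  then show ?thesis
    by (rule lie_algebra.intro, unfold_locales)
      (auto simp: basis_lie_def B_def[symmetric] B_add B_scale B_self J[unfolded J_def])
qed

datatype vir_basis = VirD int | VirZ

type_synonym vir = "vir_basis \<Rightarrow>\<^sub>0 complex"
type_synonym witt = "int \<Rightarrow>\<^sub>0 complex"

definition vir_d :: "int \<Rightarrow> vir" where
  "vir_d k = Poly_Mapping.single (VirD k) 1"

definition vir_z :: vir where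
  "vir_z = Poly_Mapping.single VirZ 1"

definition witt_d :: "int \<Rightarrow> witt" where
  "witt_d k = Poly_Mapping.single k 1"

fun vir_basis_bracket :: "vir_basis \<Rightarrow> vir_basis \<Rightarrow> vir" where
  "vir_basis_bracket (VirD k) (VirD j) =
     scale (of_int (j - k)) (vir_d (k + j))
     + (if j = - k then scale ((of_int k ^ 3 - of_int k) / 12) vir_z else 0)"
| "vir_basis_bracket VirZ _ = 0"
| "vir_basis_bracket _ VirZ = 0"

definition Virasoro :: "vir lie" where
  "Virasoro = basis_lie vir_basis_bracket"

definition Witt :: "witt lie" where
  "Witt = basis_lie (\<lambda>k j. scale (of_int (j - k)) (witt_d (k + j)))"

lemma lie_algebra_Witt: "lie_algebra Witt"
  unfolding Witt_def
proof (rule lie_algebra_basis_lie, goal_cases)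
  case (2 i j) then show ?case
    by (simp add: witt_d_def add.commute flip: single_uminus)
next
  case (3 i j k) then show ?case
    by (simp add: witt_d_def add.commute add.left_commute flip: single_add) (simp add: algebra_simps)
qed auto

lemma lie_algebra_Virasoro: "lie_algebra Virasoro"
  unfolding Virasoro_def
proof (rule lie_algebra_basis_lie, goal_cases)
  case (1 i) then show ?case by (cases i) auto
next
  case (2 i j) then show ?case
    by (cases i; cases j) (auto simp: vir_d_def vir_z_def add.commute diff_divide_distrib
      simp flip: single_uminus single_add)
next
  case (3 i j k)
  show ?case
  proof (cases "\<exists>a b c. i = VirD a \<and> j = VirD b \<and> k = VirD c")
    case True
    then obtain a b c where [simp]: "i = VirD a" "j = VirD b" "k = VirD c" by blast
    show ?thesis
    proof (cases "a + b + c = 0")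
      case True
      then have c: "c = - a - b" by simp
      show ?thesis
        by (simp add: vir_d_def vir_z_def c add.commute flip: single_add)
         (simp add: algebra_simps power3_eq_cube add_divide_distrib diff_divide_distrib flip: single_add single_diff single_uminus)
    next
      case False
      then show ?thesis
        by (auto simp: vir_d_def vir_z_def add.commute add.left_commute simp flip: single_add)
          (simp_all add: algebra_simps)
    qed
  next
    case False
    then show ?thesis
      by (cases i; cases j; cases k) (auto simp: vir_d_def vir_z_def)
  qed
qed

definition rho :: "vir \<Rightarrow> witt" where
  "rho = lin_ext (\<lambda>i. case i of VirD k \<Rightarrow> witt_d k | VirZ \<Rightarrow> 0)"

lemma rho_lie_hom: "rho \<in> lie_hom Virasoro Witt"
proof -
  have "rho (bracket Virasoro f g) = bracket Witt (rho f) (rho g)" for f g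
  proof (induction f rule: basis_induct)
    case (single i c)
    show ?case
    proof (induction g rule: basis_induct)
      case (single j c')
      show ?case
        by (cases i; cases j)
          (auto simp: rho_def Virasoro_def Witt_def basis_lie_def vir_d_def vir_z_def witt_d_def)
    qed (auto simp: rho_def Virasoro_def Witt_def basis_lie_def)
  qed (auto simp: rho_def Virasoro_def Witt_def basis_lie_def)
  then show ?thesis
    by (auto simp: lie_hom_def) (auto simp: rho_def Virasoro_def Witt_def basis_lie_def)
qed

lemma rho_surj: "rho ` carrier Virasoro = carrier Witt"
proof -
  have "g \<in> rho ` UNIV" for g
  proof (induction g rule: basis_induct)
    case zero show ?case by (rule image_eqI[of _ _ 0]) (auto simp: rho_def)
  next
    case (single k c)
    show ?case
      by (rule image_eqI[of _ _ "Poly_Mapping.single (VirD k) c"]) (auto simp: rho_def witt_d_def)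
  next
    case (add g h)
    then obtain g' h' where "g = rho g'" "h = rho h'" by auto
    then show ?case by (intro image_eqI[of _ _ "g' + h'"]) (auto simp: rho_def)
  qed
  then show ?thesis by (auto simp: Virasoro_def Witt_def basis_lie_def)
qed

definition n_plus :: "vir set" where
  "n_plus = lin_span Virasoro (vir_d ` {k. k > 0})"

definition n_plus_witt :: "witt set" where
  "n_plus_witt = lin_span Witt (witt_d ` {k. k > 0})"


section \<open>Whittaker modules\<close>

definition whittaker_module :: "(witt \<Rightarrow> complex) \<Rightarrow> (witt, 'v, 'n) lie_rep_scheme \<Rightarrow> bool" where
  "whittaker_module \<psi> V \<longleftrightarrow> lie_module Witt V
     \<and> (\<exists>w\<in>carrier V. generated_submodule Witt V {w} = carrier V
          \<and> (\<forall>x\<in>n_plus_witt. act V x w = \<psi> x \<odot>\<^bsub>V\<^esub> w))"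

definition one_dim_rep :: "('g \<Rightarrow> complex) \<Rightarrow> ('g, complex) lie_rep" where
  "one_dim_rep \<chi> = \<lparr>carrier = UNIV, monoid.mult = undefined, one = undefined,
     ring.zero = 0, add = (+), smult = (*), act = (\<lambda>x c. \<chi> x * c)\<rparr>"

text \<open>Here \<open>\<psi>\<close> is a function on \<open>n\<^sup>+ \<subseteq> Virasoro\<close>.\<close>

definition M_psi where
  "M_psi \<psi> = induced_module Virasoro n_plus (one_dim_rep \<psi>)"

definition L_psi_0 where
  "L_psi_0 \<psi> = quotient_rep (M_psi \<psi>) (act (M_psi \<psi>) vir_z ` carrier (M_psi \<psi>))"

text \<open>For a Virasoro module on which \<^const>\<open>vir_z\<close> acts by zero, the choice of the preimage under
  \<^const>\<open>rho\<close> is irrelevant.\<close>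

definition as_witt_module :: "(vir, 'v) lie_rep \<Rightarrow> (witt, 'v) lie_rep" where
  "as_witt_module M = \<lparr>carrier = carrier M, monoid.mult = undefined, one = undefined,
     ring.zero = \<zero>\<^bsub>M\<^esub>, add = add M, smult = smult M,
     act = (\<lambda>x. act M (inv_into (carrier Virasoro) rho x))\<rparr>"

end

theory Submission
  imports Defs "HOL-Computational_Algebra.Polynomial"
begin

text \<open>
Write $w$ for a Whittaker generator, so that $d_1$ and $d_2$ act on $w$ by $\psi(d_1)$ and
$\psi(d_2)$, and $d_k$ kills $w$ for $k \ge 3$ because $d_k$ is then a multiple of
$[d_1, d_{k-1}]$. Sorting lowering operators shows that every vector is a combination of normal
forms $d_{-x_1} \cdots d_{-x_r} f(d_0) w$ with $1 \le x_1 \le \dots \le x_r$ and $f$ a polynomial;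
call $x_1 + \dots + x_r$ the weight.

Let $m$ be the smallest part among the terms of maximal weight. Moving $d_{m+2}$ to the right
through such a term, a factor $d_{-m}$ turns into a multiple of $d_2$, which acts on $w$ by the
nonzero scalar $\psi(d_2)$; the term loses exactly the weight $m$, and everything else that arises
has smaller weight. Different terms stay different when a part $m$ is removed. So a nonzero formal
combination of positive weight is carried to a nonzero formal combination of smaller weight. In
weight zero, $d_2 - \psi(d_2)$ lowers the degree of $f(d_0)$ by one and keeps it nonzero. Hence
a submodule that contains the value of some nonzero formal combination contains $w$.

This is an argument about formal combinations, and different ones are allowed to have the same
value. Its outcome is a maximality statement about annihilators,
\<open>whittaker_presentation.maximal\<close>: in the free algebra on the Virasoro algebra, let $I$ be a left
ideal that contains the defining relations of the enveloping algebra, everything that starts with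
$z$, and $d_k - \psi(d_k)$ for $k > 0$. Then every left ideal $J \supseteq I$ with $1 \notin J$
equals $I$.

Take for $I$ the annihilator of the generator $1 \otimes 1$ of $L_{\psi,0}$
(\<open>presentation_L_psi_0\<close>). The tensor product has the universal property of an induced module
(\<open>frobenius_reciprocity\<close>), so $I$ annihilates the generator $w$ of $V$ as well. The
annihilator of $w$ is a proper left ideal because $V \ne 0$, hence it equals $I$, and $V$ and
$L_{\psi,0}$ are both the free algebra modulo $I$. If $N$ is a submodule of $V$, then
$\{p \mid p w \in N\}$ is a left ideal containing $I$; it contains $1$, and then $N = V$, or it
equals $I$, and then $N = 0$.
\<close>

section \<open>Normal forms and maximality of the Whittaker annihilator\<close>

text \<open>
The module is given as the quotient of a vector space by a stable subspace \<open>I\<close>: the relations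
hold modulo \<open>I\<close> only. In this way an arbitrary module on a carrier set can be studied inside a
vector space that is a whole type (the free algebra), where addition is the type class operation.
\<close>

locale whittaker_presentation = vector_space smul
  for smul :: "complex \<Rightarrow> 'a::ab_group_add \<Rightarrow> 'a" (infixr "*s" 75) +
  fixes D :: "int \<Rightarrow> 'a \<Rightarrow> 'a" and I :: "'a set" and w :: 'a and \<phi> :: "int \<Rightarrow> complex"
  assumes D_add: "D k (x + y) = D k x + D k y"
    and D_scale: "D k (c *s x) = c *s D k x"
    and I_subspace: "subspace I"
    and D_I: "x \<in> I \<Longrightarrow> D k x \<in> I"
    and D_comm: "D k (D j x) - D j (D k x) - of_int (j - k) *s D (k + j) x \<in> I"
    and D_w: "k > 0 \<Longrightarrow> D k w - \<phi> k *s w \<in> I"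
    and \<phi>_ge3: "k \<ge> 3 \<Longrightarrow> \<phi> k = 0"
    and \<phi>_2: "\<phi> 2 \<noteq> 0"
    and generating: "\<lbrakk>subspace X; I \<subseteq> X; w \<in> X; \<And>k x. x \<in> X \<Longrightarrow> D k x \<in> X\<rbrakk> \<Longrightarrow> X = UNIV"
begin

lemma D_0 [simp]: "D k 0 = 0"
  using D_scale[of k 0 0] by simp

lemma D_diff: "D k (x - y) = D k x - D k y"
  using D_add[of k "x - y" y] by simp

lemma D_span:
  assumes "x \<in> span B" "subspace X" "\<And>b. b \<in> B \<Longrightarrow> D k b \<in> X"
  shows "D k x \<in> X"
proof -
  have "subspace {x. D k x \<in> X}"
    using assms(2) by (auto simp: subspace_def D_add D_scale)
  from span_minimal[OF _ this, of B] show ?thesis using assms by auto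
qed

text \<open>The vector $f(d_0) w$, by Horner's rule.\<close>

definition cartan :: "complex poly \<Rightarrow> 'a" where
  "cartan f = fold_coeffs (\<lambda>a x. a *s w + D 0 x) f 0"

lemma cartan_0 [simp]: "cartan 0 = 0"
  by (simp add: cartan_def)

lemma cartan_pCons [simp]: "cartan (pCons a f) = a *s w + D 0 (cartan f)"
  by (cases "f = 0 \<and> a = 0") (auto simp: cartan_def)

lemma cartan_add: "cartan (f + g) = cartan f + cartan g"
  by (induction f g rule: poly_induct2) (simp_all add: D_add scale_left_distrib)

lemma cartan_smult: "cartan (Polynomial.smult c f) = c *s cartan f"
  by (induction f) (simp_all add: D_scale scale_right_distrib)

lemma cartan_diff: "cartan (f - g) = cartan f - cartan g"
  using cartan_add[of "f - g" g] by simp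

definition shift :: "int \<Rightarrow> complex poly \<Rightarrow> complex poly" where
  "shift k f = pcompose f [:- of_int k, 1:]"

text \<open>Since $d_k d_0 = (d_0 - k) d_k$, moving $d_k$ past $f(d_0)$ shifts the argument of $f$, and then
$d_k$ meets $w$.\<close>

lemma D_cartan:
  assumes "k > 0"
  shows "D k (cartan f) - \<phi> k *s cartan (shift k f) \<in> I"
proof (induction f)
  case 0
  show ?case by (simp add: shift_def subspace_0[OF I_subspace])
next
  case (pCons a f)
  define y where "y = D k (cartan f) - \<phi> k *s cartan (shift k f)"
  have *: "cartan (shift k (pCons a f)) = a *s w + D 0 (cartan (shift k f)) - of_int k *s cartan (shift k f)"
    by (simp add: shift_def pcompose_pCons cartan_add cartan_smult cartan_diff flip: diff_conv_add_uminus)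
  have "D k (cartan (pCons a f)) - \<phi> k *s cartan (shift k (pCons a f))
      = a *s (D k w - \<phi> k *s w) + (D k (D 0 (cartan f)) - D 0 (D k (cartan f)) - of_int (0 - k) *s D (k + 0) (cartan f))
       + D 0 y - of_int k *s y"
    unfolding y_def * by (simp add: D_add D_diff D_scale algebra_simps)
  also have "\<dots> \<in> I"
    using pCons(2) unfolding y_def[symmetric]
    by (intro subspace_diff[OF I_subspace subspace_add[OF I_subspace subspace_add[OF I_subspace]]]
      subspace_scale[OF I_subspace D_w[OF assms]] subspace_scale[OF I_subspace, of y] D_comm D_I)
  finally show ?case .
qed

text \<open>The parts are positive; the operator is $d_{-x_1} \cdots d_{-x_r}$.\<close>

definition lower :: "nat list \<Rightarrow> 'a \<Rightarrow> 'a" where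
  "lower xs x = foldr (\<lambda>i. D (- int i)) xs x"

lemma lower_simps [simp]: "lower [] x = x" "lower (i # xs) x = D (- int i) (lower xs x)"
  by (simp_all add: lower_def)

lemma lower_add: "lower xs (x + y) = lower xs x + lower xs y"
  by (induction xs) (auto simp: D_add)

lemma lower_scale: "lower xs (c *s x) = c *s lower xs x"
  by (induction xs) (auto simp: D_scale)

lemma lower_0 [simp]: "lower xs 0 = 0"
  by (induction xs) auto

definition partition :: "nat list \<Rightarrow> bool" where
  "partition xs \<longleftrightarrow> sorted xs \<and> 0 \<notin> set xs"

lemma partition_simps [simp]: "partition []" "partition (x # xs) \<longleftrightarrow> x > 0 \<and> (\<forall>y\<in>set xs. x \<le> y) \<and> partition xs"
  by (auto simp: partition_def)

lemma partition_insort: "partition xs \<Longrightarrow> i > 0 \<Longrightarrow> partition (insort i xs)"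
  by (auto simp: partition_def sorted_insort set_insort_key)

definition normal_forms :: "nat list set \<Rightarrow> 'a set" where
  "normal_forms S = span (I \<union> {lower xs (cartan f) | xs f. xs \<in> S \<and> partition xs})"

lemma normal_forms_subspace [simp]: "subspace (normal_forms S)"
  by (simp add: normal_forms_def)

lemmas normal_forms_0 [simp] = subspace_0[OF normal_forms_subspace]
  and normal_forms_add = subspace_add[OF normal_forms_subspace]
  and normal_forms_scale = subspace_scale[OF normal_forms_subspace]

lemma normal_forms_mono: "S \<subseteq> T \<Longrightarrow> normal_forms S \<subseteq> normal_forms T"
  unfolding normal_forms_def by (intro span_mono) auto

lemma I_normal_forms: "x \<in> I \<Longrightarrow> x \<in> normal_forms S"
  unfolding normal_forms_def by (intro span_base) auto

lemma lower_normal_forms: "xs \<in> S \<Longrightarrow> partition xs \<Longrightarrow> lower xs (cartan f) \<in> normal_forms S"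
  unfolding normal_forms_def by (intro span_base) auto

lemma D_normal_forms:
  assumes "x \<in> normal_forms S" "\<And>xs f. xs \<in> S \<Longrightarrow> partition xs \<Longrightarrow> D k (lower xs (cartan f)) \<in> normal_forms T"
  shows "D k x \<in> normal_forms T"
  using assms(1) unfolding normal_forms_def[of S]
  by (rule D_span) (auto intro: assms(2) I_normal_forms D_I)

lemma sum_list_insort [simp]: "sum_list (insort i xs) = i + sum_list (xs :: nat list)"
  by (induction xs) auto

text \<open>Bounding the number of factors as well as the weight is what makes the sorting argument below
an induction on the length.\<close>

abbreviation short_forms :: "nat \<Rightarrow> nat \<Rightarrow> 'a set" where
  "short_forms n r \<equiv> normal_forms {xs. sum_list xs = n \<and> length xs \<le> r}"

text \<open>A new factor $d_{-i}$ is moved to its place in the sorted product. Each exchange with a factor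
$d_{-x}$ leaves the commutator, a multiple of $d_{-i-x}$, which has the same weight but replaces two
factors by one. So the errors have fewer factors than the sorted product with $i$ inserted, and
they are sorted by the induction hypothesis.\<close>

lemma D_lower_insort:
  assumes "partition xs" "i > 0"
  shows "D (- int i) (lower xs (cartan f)) - lower (insort i xs) (cartan f) \<in> short_forms (i + sum_list xs) (length xs)"
  using assms
proof (induction xs arbitrary: i f rule: length_induct)
  case (1 xs)
  note IH = 1(1)[rule_format]
  show ?case
  proof (cases "\<exists>x xs'. xs = x # xs' \<and> x < i")
    case False
    then have "insort i xs = i # xs" by (cases xs) auto
    then show ?thesis by simp
  next
    case True
    then obtain x ys where xs: "xs = x # ys" and x: "x < i" by blast
    have ys: "partition ys" "x > 0" using 1 xs by auto
    define u where "u = lower ys (cartan f)"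
    define h where "h = D (- int i) u - lower (insort i ys) (cartan f)"
    define h' where "h' = D (- int (i + x)) u - lower (insort (i + x) ys) (cartan f)"
    define y where "y = D (- int i) (D (- int x) u) - D (- int x) (D (- int i) u) - of_int (- int x - (- int i)) *s D (- int i + (- int x)) u"
    have y: "y \<in> I" unfolding y_def by (rule D_comm)
    have h: "h \<in> short_forms (i + sum_list ys) (length ys)"
      unfolding h_def u_def by (rule IH) (use xs 1 ys in auto)
    have Dh: "D (- int x) h \<in> short_forms (i + sum_list xs) (length xs)"
      using h
    proof (rule D_normal_forms)
      fix zs g assume zs: "zs \<in> {xs. sum_list xs = i + sum_list ys \<and> length xs \<le> length ys}" "partition zs"
      have "D (- int x) (lower zs (cartan g)) - lower (insort x zs) (cartan g) \<in> short_forms (x + sum_list zs) (length zs)"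
        by (rule IH) (use xs zs ys in auto)
      moreover have "short_forms (x + sum_list zs) (length zs) \<subseteq> short_forms (i + sum_list xs) (length xs)"
        using zs xs by (intro normal_forms_mono) auto
      moreover have "lower (insort x zs) (cartan g) \<in> short_forms (i + sum_list xs) (length xs)"
        using zs xs ys by (intro lower_normal_forms partition_insort) auto
      ultimately show "D (- int x) (lower zs (cartan g)) \<in> short_forms (i + sum_list xs) (length xs)"
        using normal_forms_add by (metis (no_types, lifting) diff_add_cancel in_mono)
    qed
    have "h' \<in> short_forms (i + x + sum_list ys) (length ys)"
      unfolding h'_def u_def by (rule IH) (use xs 1 ys in auto)
    moreover have "short_forms (i + x + sum_list ys) (length ys) \<subseteq> short_forms (i + sum_list xs) (length xs)"
      using xs by (intro normal_forms_mono) auto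
    ultimately have h': "h' \<in> short_forms (i + sum_list xs) (length xs)" by blast
    have e: "lower (insort (i + x) ys) (cartan f) \<in> short_forms (i + sum_list xs) (length xs)"
      using xs ys by (intro lower_normal_forms partition_insort) auto
    \<comment> \<open>\<open>y\<close> is the commutator relation, \<open>h\<close> and \<open>h'\<close> are the errors of sorting \<open>i\<close> and \<open>i + x\<close> into the tail.\<close>
    have "D (- int i) (lower xs (cartan f)) - lower (insort i xs) (cartan f)
      = y + D (- int x) h + of_int (- int x - (- int i)) *s (h' + lower (insort (i + x) ys) (cartan f))"
      using xs x unfolding y_def h_def h'_def u_def by (simp add: D_diff)
    also have "\<dots> \<in> short_forms (i + sum_list xs) (length xs)"
      using y Dh h' e by (intro normal_forms_add normal_forms_scale) (auto intro: I_normal_forms)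
    finally show ?thesis .
  qed
qed

text \<open>The bound is a strict one on integers, so that \<open>weight_lt j\<close> is just \<open>I\<close> for \<open>j \<le> 0\<close> and lowering a
bound below zero needs no case distinction.\<close>

definition weight_lt :: "int \<Rightarrow> 'a set" where
  "weight_lt j = normal_forms {xs. int (sum_list xs) < j}"

lemma weight_lt_subspace [simp]: "subspace (weight_lt j)"
  by (simp add: weight_lt_def)

lemmas weight_lt_add = subspace_add[OF weight_lt_subspace]
  and weight_lt_diff = subspace_diff[OF weight_lt_subspace]
  and weight_lt_scale = subspace_scale[OF weight_lt_subspace]

lemma weight_lt_mono: "j \<le> j' \<Longrightarrow> x \<in> weight_lt j \<Longrightarrow> x \<in> weight_lt j'"
  using normal_forms_mono[of "{xs. int (sum_list xs) < j}" "{xs. int (sum_list xs) < j'}"] by (force simp: weight_lt_def)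

lemma I_weight_lt: "x \<in> I \<Longrightarrow> x \<in> weight_lt j"
  by (simp add: weight_lt_def I_normal_forms)

lemma lower_weight_lt: "partition xs \<Longrightarrow> int (sum_list xs) < j \<Longrightarrow> lower xs (cartan f) \<in> weight_lt j"
  unfolding weight_lt_def by (rule lower_normal_forms) auto

lemma D_weight_lt:
  assumes "x \<in> weight_lt j" "\<And>xs f. partition xs \<Longrightarrow> int (sum_list xs) < j \<Longrightarrow> D k (lower xs (cartan f)) \<in> weight_lt j'"
  shows "D k x \<in> weight_lt j'"
  using assms unfolding weight_lt_def by (intro D_normal_forms[OF assms(1)[unfolded weight_lt_def]]) auto

text \<open>$d_0$ acts on a product of lowering operators as the derivation with $[d_0, d_{-x}] = -x d_{-x}$.\<close>

lemma D_zero_lower: "D 0 (lower xs x) - lower xs (D 0 x) + of_nat (sum_list xs) *s lower xs x \<in> I"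
proof (induction xs)
  case Nil
  show ?case by (simp add: subspace_0[OF I_subspace])
next
  case (Cons i xs)
  have "D 0 (lower (i # xs) x) - lower (i # xs) (D 0 x) + of_nat (sum_list (i # xs)) *s lower (i # xs) x =
    (D 0 (D (- int i) (lower xs x)) - D (- int i) (D 0 (lower xs x)) - of_int (- int i - 0) *s D (0 + (- int i)) (lower xs x))
    + D (- int i) (D 0 (lower xs x) - lower xs (D 0 x) + of_nat (sum_list xs) *s lower xs x)"
    by (simp add: D_add D_diff D_scale scale_left_distrib)
  also have "\<dots> \<in> I"
    by (intro subspace_add[OF I_subspace] D_comm D_I Cons)
  finally show ?case .
qed

lemma D_nonpos_weight_lt:
  assumes "x \<in> weight_lt j" "k \<le> 0"
  shows "D k x \<in> weight_lt (j - k)"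
  using assms(1)
proof (rule D_weight_lt)
  fix xs f assume xs: "partition xs" "int (sum_list xs) < j"
  show "D k (lower xs (cartan f)) \<in> weight_lt (j - k)"
  proof (cases "k = 0")
    case True
    have "D 0 (lower xs (cartan f)) = (D 0 (lower xs (cartan f)) - lower xs (D 0 (cartan f)) + of_nat (sum_list xs) *s lower xs (cartan f))
        + lower xs (cartan (pCons 0 f)) - of_nat (sum_list xs) *s lower xs (cartan f)"
      by simp
    also have "\<dots> \<in> weight_lt (j - k)"
      using xs True by (intro weight_lt_diff weight_lt_add weight_lt_scale I_weight_lt[OF D_zero_lower] lower_weight_lt) auto
    finally show ?thesis using True by simp
  next
    case False
    define i where "i = nat (- k)"
    have i: "k = - int i" "i > 0" using False assms(2) by (auto simp: i_def)
    have "D (- int i) (lower xs (cartan f)) = (D (- int i) (lower xs (cartan f)) - lower (insort i xs) (cartan f)) + lower (insort i xs) (cartan f)"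
      by simp
    also have "\<dots> \<in> weight_lt (j - k)"
    proof (rule weight_lt_add)
      show "lower (insort i xs) (cartan f) \<in> weight_lt (j - k)"
        using xs i by (intro lower_weight_lt partition_insort) auto
      have "short_forms (i + sum_list xs) (length xs) \<subseteq> weight_lt (j - k)"
        unfolding weight_lt_def using xs i by (intro normal_forms_mono) auto
      then show "D (- int i) (lower xs (cartan f)) - lower (insort i xs) (cartan f) \<in> weight_lt (j - k)"
        using D_lower_insort[OF xs(1) i(2), of f] by blast
    qed
    finally show ?thesis using i by simp
  qed
qed

text \<open>How much $d_k$ can fall short of reducing the weight by $k$: when it is turned into $d_1$ or $d_2$
and disappears into $w$, that amount of weight survives.\<close>

definition absorption :: "int \<Rightarrow> int" where
  "absorption k = max 0 (min 2 k)"

lemma D_lower_Cons: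
  "D k (lower (i # xs) x) - D (- int i) (D k (lower xs x)) + of_int (k + int i) *s D (k - int i) (lower xs x) \<in> I"
  using D_comm[of k "- int i" "lower xs x"] by (simp add: scale_left_distrib scale_left_diff_distrib algebra_simps)

lemma D_weight_lt_drop:
  assumes "x \<in> weight_lt j"
  shows "D k x \<in> weight_lt (j - k + absorption k)"
proof -
  have lower: "D k (lower xs (cartan f)) \<in> weight_lt (int (sum_list xs) + 1 - k + absorption k)" if "partition xs" for xs f k
    using that
  proof (induction xs arbitrary: k)
    case Nil
    show ?case
    proof (cases "k \<le> 0")
      case True
      then show ?thesis using D_nonpos_weight_lt[OF lower_weight_lt[of "[]" 1 f], of k] by (simp add: absorption_def)
    next
      case False
      have "D k (cartan f) = (D k (cartan f) - \<phi> k *s cartan (shift k f)) + \<phi> k *s lower [] (cartan (shift k f))" by simp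
      also have "\<dots> \<in> weight_lt (1 - k + absorption k)"
      proof (cases "k \<ge> 3")
        case True
        then show ?thesis using I_weight_lt[OF D_cartan[of k f]] by (simp add: \<phi>_ge3)
      next
        case False
        with \<open>\<not> k \<le> 0\<close> show ?thesis
          by (intro weight_lt_add I_weight_lt D_cartan weight_lt_scale lower_weight_lt) (auto simp: absorption_def)
      qed
      finally show ?thesis by simp
    qed
  next
    case (Cons i xs)
    let ?n = "int (sum_list (i # xs)) + 1 - k + absorption k"
    have 1: "D (- int i) (D k (lower xs (cartan f))) \<in> weight_lt ?n"
      using D_nonpos_weight_lt[OF Cons.IH, of "- int i" k] Cons.prems by (simp add: algebra_simps)
    have "D (k - int i) (lower xs (cartan f)) \<in> weight_lt (int (sum_list xs) + 1 - (k - int i) + absorption (k - int i))"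
      using Cons.prems by (intro Cons.IH) auto
    then have 2: "D (k - int i) (lower xs (cartan f)) \<in> weight_lt ?n"
      by (rule weight_lt_mono[rotated]) (auto simp: absorption_def)
    have "D k (lower (i # xs) (cartan f)) = (D k (lower (i # xs) (cartan f)) - D (- int i) (D k (lower xs (cartan f))) + of_int (k + int i) *s D (k - int i) (lower xs (cartan f)))
        + D (- int i) (D k (lower xs (cartan f))) - of_int (k + int i) *s D (k - int i) (lower xs (cartan f))" by simp
    also have "\<dots> \<in> weight_lt ?n"
      by (intro weight_lt_diff weight_lt_add weight_lt_scale 1 2 I_weight_lt[OF D_lower_Cons])
    finally show ?case .
  qed
  show ?thesis
    using assms by (rule D_weight_lt) (rule weight_lt_mono[OF _ lower], auto)
qed

text \<open>A commutator of $d_2$ with some $d_{-x}$ only produces terms of smaller weight, so to leading order $d_2$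
passes through to $f(d_0) w$.\<close>

lemma D_2_lower:
  assumes "partition xs"
  shows "D 2 (lower xs (cartan f)) - \<phi> 2 *s lower xs (cartan (shift 2 f)) \<in> weight_lt (int (sum_list xs))"
  using assms
proof (induction xs)
  case Nil
  show ?case using D_cartan[of 2 f] by (simp add: I_weight_lt)
next
  case (Cons i xs)
  let ?h = "D 2 (lower xs (cartan f)) - \<phi> 2 *s lower xs (cartan (shift 2 f))"
  let ?n = "int (sum_list (i # xs))"
  have "D (- int i) ?h \<in> weight_lt (int (sum_list xs) - (- int i))"
    using Cons by (intro D_nonpos_weight_lt) auto
  then have 1: "D (- int i) ?h \<in> weight_lt ?n" by (simp add: algebra_simps)
  have "D (2 - int i) (lower xs (cartan f)) \<in> weight_lt (int (sum_list xs) + 1 - (2 - int i) + absorption (2 - int i))"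
    using Cons.prems by (intro D_weight_lt_drop lower_weight_lt) auto
  then have 2: "D (2 - int i) (lower xs (cartan f)) \<in> weight_lt ?n"
    by (rule weight_lt_mono[rotated]) (use Cons.prems in \<open>auto simp: absorption_def\<close>)
  have "D 2 (lower (i # xs) (cartan f)) - \<phi> 2 *s lower (i # xs) (cartan (shift 2 f)) =
     (D 2 (lower (i # xs) (cartan f)) - D (- int i) (D 2 (lower xs (cartan f))) + of_int (2 + int i) *s D (2 - int i) (lower xs (cartan f)))
     + D (- int i) ?h - of_int (2 + int i) *s D (2 - int i) (lower xs (cartan f))"
    by (simp add: D_diff D_scale)
  also have "\<dots> \<in> weight_lt ?n"
    by (intro weight_lt_diff weight_lt_add weight_lt_scale 1 2 I_weight_lt[OF D_lower_Cons])
  finally show ?case .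
qed

text \<open>The leading term. In $[d_{m+2}, d_{-x}] = -(x + m + 2) d_{m+2-x}$ the index $m + 2 - x$ is $2$ for
$x = m$, and at most $1$ for larger parts. Only $x = m$ lets the full weight \<open>n - m\<close> survive, with
coefficient $-(2m + 2)\psi(d_2)$ for each of the equal factors $d_{-m}$. Smaller parts would spoil this:
several of them, with sum $m$, could also turn $d_{m+2}$ into $d_2$.\<close>

lemma D_smallest_part:
  assumes "partition xs" "\<forall>x\<in>set xs. m \<le> x" "m > 0"
  shows "D (int m + 2) (lower xs (cartan f))
      - (- of_nat ((2 * m + 2) * count_list xs m) * \<phi> 2) *s lower (remove1 m xs) (cartan (shift 2 f))
    \<in> weight_lt (int (sum_list xs) - int m)"
  using assms
proof (induction xs)
  case Nil
  show ?case using D_cartan[of "int m + 2" f] assms(3) by (simp add: I_weight_lt \<phi>_ge3)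
next
  case (Cons i xs)
  let ?c = "\<lambda>xs. - of_nat ((2 * m + 2) * count_list xs m) * \<phi> 2"
  let ?h = "D (int m + 2) (lower xs (cartan f)) - ?c xs *s lower (remove1 m xs) (cartan (shift 2 f))"
  let ?n = "int (sum_list (i # xs)) - int m"
  let ?y = "D (int m + 2) (lower (i # xs) (cartan f)) - D (- int i) (D (int m + 2) (lower xs (cartan f)))
     + of_int (int m + 2 + int i) *s D (int m + 2 - int i) (lower xs (cartan f))"
  have "D (- int i) ?h \<in> weight_lt (int (sum_list xs) - int m - (- int i))"
    using Cons by (intro D_nonpos_weight_lt) auto
  then have 1: "D (- int i) ?h \<in> weight_lt ?n" by (simp add: algebra_simps)
  have y: "?y \<in> weight_lt ?n" by (intro I_weight_lt[OF D_lower_Cons])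
  show ?case
  proof (cases "i = m")
    case False
    have "D (int m + 2 - int i) (lower xs (cartan f)) \<in> weight_lt (int (sum_list xs) + 1 - (int m + 2 - int i) + absorption (int m + 2 - int i))"
      using Cons.prems by (intro D_weight_lt_drop lower_weight_lt) auto
    then have 2: "D (int m + 2 - int i) (lower xs (cartan f)) \<in> weight_lt ?n"
      by (rule weight_lt_mono[rotated]) (use Cons.prems False in \<open>auto simp: absorption_def\<close>)
    have "D (int m + 2) (lower (i # xs) (cartan f)) - ?c (i # xs) *s lower (remove1 m (i # xs)) (cartan (shift 2 f)) =
       ?y + D (- int i) ?h - of_int (int m + 2 + int i) *s D (int m + 2 - int i) (lower xs (cartan f))"
      using False by (simp add: D_diff D_scale)
    also have "\<dots> \<in> weight_lt ?n"
      by (intro weight_lt_diff weight_lt_add weight_lt_scale 1 2 y)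
    finally show ?thesis .
  next
    case True
    have rem: "?c xs *s lower (m # remove1 m xs) (cartan (shift 2 f)) = ?c xs *s lower xs (cartan (shift 2 f))"
    proof (cases "m \<in> set xs")
      case True
      with Cons.prems obtain ys where "xs = m # ys"
        by (cases xs) (auto simp: Ball_def intro: antisym)
      then show ?thesis by simp
    qed (simp add: count_list_0_iff)
    have 2: "D 2 (lower xs (cartan f)) - \<phi> 2 *s lower xs (cartan (shift 2 f)) \<in> weight_lt ?n"
      using D_2_lower[of xs f] Cons.prems True by simp
    have h: "D (- int i) ?h = D (- int i) (D (int m + 2) (lower xs (cartan f))) - ?c xs *s lower xs (cartan (shift 2 f))"
      using rem True by (simp only: D_diff D_scale lower_simps)
    have "D (int m + 2) (lower (i # xs) (cartan f)) - ?c (i # xs) *s lower (remove1 m (i # xs)) (cartan (shift 2 f)) =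
       ?y + D (- int i) ?h - of_nat (2 * m + 2) *s (D 2 (lower xs (cartan f)) - \<phi> 2 *s lower xs (cartan (shift 2 f)))"
      unfolding h using True by (simp add: scale_right_diff_distrib algebra_simps)
    also have "\<dots> \<in> weight_lt ?n"
      by (intro weight_lt_diff weight_lt_add weight_lt_scale 1 2 y)
    finally show ?thesis .
  qed
qed

text \<open>A formal combination of normal forms is a finitely supported family of polynomials, indexed by
partitions. Distinct families may have the same value; the argument below is about the families.\<close>

definition expand :: "(nat list \<Rightarrow>\<^sub>0 complex poly) \<Rightarrow> 'a" where
  "expand p = (\<Sum>xs\<in>Poly_Mapping.keys p. lower xs (cartan (Poly_Mapping.lookup p xs)))"

lemma expand_eq:
  assumes "finite A" "Poly_Mapping.keys p \<subseteq> A"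
  shows "expand p = (\<Sum>xs\<in>A. lower xs (cartan (Poly_Mapping.lookup p xs)))"
  unfolding expand_def using assms by (intro sum.mono_neutral_left) (auto simp: in_keys_iff)

lemma expand_0 [simp]: "expand 0 = 0"
  by (simp add: expand_def)

lemma expand_single: "expand (Poly_Mapping.single xs f) = lower xs (cartan f)"
  by (simp add: expand_def)

lemma expand_add: "expand (p + q) = expand p + expand q"
proof -
  let ?A = "Poly_Mapping.keys p \<union> Poly_Mapping.keys q"
  have "expand r = (\<Sum>xs\<in>?A. lower xs (cartan (Poly_Mapping.lookup r xs)))" if "r \<in> {p, q, p + q}" for r
    using that Poly_Mapping.keys_add[of p q] by (intro expand_eq) auto
  then show ?thesis by (simp add: lookup_add cartan_add lower_add sum.distrib)
qed

lemma expand_sum: "expand (sum h A) = (\<Sum>i\<in>A. expand (h i))"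
  by (induction A rule: infinite_finite_induct) (auto simp: expand_add)

lemma expand_scale: "expand (Poly_Mapping.map (Polynomial.smult c) p) = c *s expand p"
proof -
  have "expand (Poly_Mapping.map (Polynomial.smult c) p)
      = (\<Sum>xs\<in>Poly_Mapping.keys p. lower xs (cartan (Poly_Mapping.lookup (Poly_Mapping.map (Polynomial.smult c) p) xs)))"
    by (rule expand_eq) (auto simp: in_keys_iff Poly_Mapping.map.rep_eq when_def)
  then show ?thesis
    by (simp add: expand_def Poly_Mapping.map.rep_eq in_keys_iff cartan_smult lower_scale scale_sum_right)
qed

lemma normal_forms_expand:
  assumes "x \<in> normal_forms S"
  obtains y p where "x = y + expand p" "y \<in> I" "Poly_Mapping.keys p \<subseteq> {xs \<in> S. partition xs}"
proof -
  let ?X = "{y + expand p | y p. y \<in> I \<and> Poly_Mapping.keys p \<subseteq> {xs \<in> S. partition xs}}"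
  have "subspace ?X"
    unfolding subspace_def
  proof (intro conjI ballI allI)
    show "0 \<in> ?X" by (rule CollectI, rule exI[of _ 0], rule exI[of _ 0]) (simp add: subspace_0[OF I_subspace])
  next
    fix u v assume "u \<in> ?X" "v \<in> ?X"
    then obtain y p y' p' where "u = y + expand p" "v = y' + expand p'" "y \<in> I" "y' \<in> I"
      "Poly_Mapping.keys p \<subseteq> {xs \<in> S. partition xs}" "Poly_Mapping.keys p' \<subseteq> {xs \<in> S. partition xs}" by blast
    then show "u + v \<in> ?X"
      using Poly_Mapping.keys_add[of p p'] subspace_add[OF I_subspace]
      by (intro CollectI exI[of _ "y + y'"] exI[of _ "p + p'"]) (auto simp: expand_add)
  next
    fix c u assume "u \<in> ?X"
    then obtain y p where "u = y + expand p" "y \<in> I" "Poly_Mapping.keys p \<subseteq> {xs \<in> S. partition xs}" by blast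
    then show "c *s u \<in> ?X"
      using subspace_scale[OF I_subspace]
      by (intro CollectI exI[of _ "c *s y"] exI[of _ "Poly_Mapping.map (Polynomial.smult c) p"])
        (auto simp: expand_scale scale_right_distrib in_keys_iff Poly_Mapping.map.rep_eq when_def
          subset_iff split: if_splits)
  qed
  moreover have "I \<union> {lower xs (cartan f) | xs f. xs \<in> S \<and> partition xs} \<subseteq> ?X"
  proof
    fix u assume "u \<in> I \<union> {lower xs (cartan f) | xs f. xs \<in> S \<and> partition xs}"
    then consider "u \<in> I" | xs f where "u = lower xs (cartan f)" "xs \<in> S" "partition xs" by blast
    then show "u \<in> ?X"
    proof cases
      case 1
      then show ?thesis by (intro CollectI exI[of _ u] exI[of _ 0]) auto
    next
      case 2
      then show ?thesis
        by (intro CollectI exI[of _ 0] exI[of _ "Poly_Mapping.single xs f"])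
          (auto simp: expand_single subspace_0[OF I_subspace])
    qed
  qed
  ultimately have "normal_forms S \<subseteq> ?X"
    unfolding normal_forms_def by (intro span_minimal) auto
  with assms that show ?thesis by blast
qed

lemma normal_forms_UNIV: "normal_forms UNIV = UNIV"
proof (rule generating)
  show "w \<in> normal_forms UNIV"
    using lower_normal_forms[of "[]" UNIV 1] by (simp add: one_pCons)
next
  fix k x assume "x \<in> normal_forms UNIV"
  then show "D k x \<in> normal_forms UNIV"
  proof (rule D_normal_forms)
    fix xs f assume "partition xs"
    then have "D k (lower xs (cartan f)) \<in> weight_lt (int (sum_list xs) + 1 - k + absorption k)"
      by (intro D_weight_lt_drop lower_weight_lt) auto
    then show "D k (lower xs (cartan f)) \<in> normal_forms UNIV"
      unfolding weight_lt_def using normal_forms_mono[of _ UNIV] by blast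
  qed
qed (auto intro: I_normal_forms)

text \<open>Shifting keeps the leading term, so the difference has smaller degree; it is not zero because a
polynomial with a nonzero period is constant.\<close>

lemma degree_shift_diff:
  assumes "degree f > 0" "k \<noteq> 0"
  shows "degree (shift k f - f) < degree f" "shift k f - f \<noteq> 0"
proof -
  have d: "degree (shift k f) = degree f"
    by (simp add: shift_def degree_pcompose)
  have l: "lead_coeff (shift k f) = lead_coeff f"
    unfolding shift_def by (subst lead_coeff_comp) auto
  show "degree (shift k f - f) < degree f"
    using d l assms(1) degree_diff_le[of "shift k f" "degree f" f]
    by (metis coeff_diff eq_iff_diff_eq_0 leading_coeff_0_iff degree_0 le_neq_implies_less order_refl)
  show "shift k f - f \<noteq> 0"
  proof
    assume "shift k f - f = 0"
    then have per: "poly f (x - of_int k) = poly f x" for x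
      by (metis (no_types) shift_def poly_pcompose right_minus_eq poly_pCons poly_0 mult.right_neutral
        mult_zero_right add_0_right add.commute diff_conv_add_uminus)
    have *: "poly f (- of_nat n * of_int k) = poly f 0" for n
    proof (induction n)
      case (Suc n)
      have "- of_nat (Suc n) * of_int k = - of_nat n * of_int k - (of_int k :: complex)"
        by (simp add: algebra_simps)
      with per[of "- of_nat n * of_int k"] Suc show ?case by simp
    qed simp
    \<comment> \<open>\<open>f\<close> takes the value \<open>f(0)\<close> at infinitely many points.\<close>
    have "range (\<lambda>n. - of_nat n * of_int k :: complex) \<subseteq> {x. poly (f - [:poly f 0:]) x = 0}"
      using * by auto
    moreover have "inj (\<lambda>n::nat. - of_nat n * of_int k :: complex)"
      using assms(2) by (auto simp: inj_def)
    ultimately have "infinite {x. poly (f - [:poly f 0:]) x = 0}"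
      using finite_subset finite_imageD by blast
    then have "f - [:poly f 0:] = 0"
      using poly_roots_finite by blast
    then have "f = [:poly f 0:]" by simp
    then show False using assms(1) by (metis degree_pCons_0 less_numeral_extra(3))
  qed
qed

context
  fixes J :: "'a set"
  assumes J_subspace: "subspace J" and I_J: "I \<subseteq> J"
    and D_J: "\<And>k x. k > 0 \<Longrightarrow> x \<in> J \<Longrightarrow> D k x \<in> J"
    and w_J: "w \<notin> J"
begin

text \<open>The case of weight zero: $d_2 - \psi(d_2)$ replaces $f$ by a multiple of the difference of its shift
and itself. Repeating this ends at a nonzero multiple of $w$.\<close>

lemma cartan_mem_imp_0:
  assumes "cartan f \<in> J"
  shows "f = 0"
  using assms
proof (induction "degree f" arbitrary: f rule: less_induct)
  case less
  show ?case
  proof (cases "degree f = 0")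
    case True
    then obtain c where f: "f = [:c:]" by (metis degree_eq_zeroE)
    show ?thesis
    proof (rule ccontr)
      assume "f \<noteq> 0"
      then have "w = inverse c *s cartan f" using f by simp
      then show False using less.prems w_J subspace_scale[OF J_subspace] by metis
    qed
  next
    case False
    let ?g = "shift 2 f - f"
    have g: "degree ?g < degree f" "?g \<noteq> 0"
      using degree_shift_diff[of f 2] False by auto
    have "D 2 (cartan f) \<in> J" "D 2 (cartan f) - \<phi> 2 *s cartan (shift 2 f) \<in> J"
      using less.prems D_cartan[of 2 f] I_J D_J by auto
    from subspace_diff[OF J_subspace this] have "\<phi> 2 *s cartan (shift 2 f) \<in> J" by simp
    from subspace_scale[OF J_subspace this, of "inverse (\<phi> 2)"] have "cartan (shift 2 f) \<in> J"
      using \<phi>_2 by simp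
    with less.prems have "cartan ?g \<in> J" by (simp add: cartan_diff subspace_diff[OF J_subspace])
    then have "?g = 0" using less.hyps[OF g(1)] by blast
    with g(2) show ?thesis by blast
  qed
qed

text \<open>A counterexample of maximal weight \<open>n\<close> is turned by $d_{m+2}$ into one of weight at most \<open>n - m\<close>, where
\<open>m\<close> is the smallest part that occurs in weight \<open>n\<close>.\<close>

lemma expand_mem_imp_0:
  assumes "Poly_Mapping.keys p \<subseteq> {xs. partition xs \<and> sum_list xs \<le> n}" "expand p \<in> J"
  shows "p = 0"
  using assms
proof (induction n arbitrary: p rule: less_induct)
  case (less n)
  show ?case
  proof (rule ccontr)
    assume "p \<noteq> 0"
    define T where "T = {xs \<in> Poly_Mapping.keys p. sum_list xs = n}"
    have T: "finite T" "\<And>xs. xs \<in> T \<Longrightarrow> partition xs \<and> sum_list xs = n \<and> Poly_Mapping.lookup p xs \<noteq> 0"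
      using less.prems(1) by (auto simp: T_def in_keys_iff)
    have keys_less: "partition xs \<and> sum_list xs < n" if "xs \<in> Poly_Mapping.keys p - T" for xs
      using that less.prems(1) by (auto simp: T_def)
    show False
    proof (cases "n = 0")
      case True
      have "xs = []" if "xs \<in> Poly_Mapping.keys p" for xs
        using less.prems(1) that True by (cases xs) auto
      then have "p = Poly_Mapping.single [] (Poly_Mapping.lookup p [])"
        by (intro poly_mapping_eqI) (auto simp: lookup_single when_def in_keys_iff)
      then show False
        using cartan_mem_imp_0[of "Poly_Mapping.lookup p []"] less.prems(2) \<open>p \<noteq> 0\<close>
        by (metis lower_simps(1) expand_single single_zero)
    next
      case False
      show False
      proof (cases "T = {}")
        case True
        then have "Poly_Mapping.keys p \<subseteq> {xs. partition xs \<and> sum_list xs \<le> n - 1}"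
          using keys_less by fastforce
        then show False using less.IH[of "n - 1" p] False less.prems(2) \<open>p \<noteq> 0\<close> by simp
      next
        case T_ne: False
        \<comment> \<open>The parts of the terms of maximal weight; \<open>m\<close> has to be minimal for all of these terms at once.\<close>
        define U where "U = \<Union>(set ` T)"
        define m where "m = Min U"
        obtain xs0 where xs0: "xs0 \<in> T" using T_ne by blast
        with T(2) False have "xs0 \<noteq> []" by force
        then have U: "finite U" "U \<noteq> {}" using T(1) xs0 by (auto simp: U_def)
        have m: "m \<in> U" "\<And>xs x. xs \<in> T \<Longrightarrow> x \<in> set xs \<Longrightarrow> m \<le> x"
          using Min_in[OF U] Min_le[OF U(1)] unfolding m_def by (auto simp: U_def)
        then obtain xs1 where xs1: "xs1 \<in> T" "m \<in> set xs1" by (auto simp: U_def)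
        have m0: "m > 0" using xs1 T(2) by (metis partition_def gr0I)
        have mn: "m \<le> n" using T(2)[OF xs1(1)] member_le_sum_list[OF xs1(2)] by simp
        define T1 where "T1 = {xs \<in> T. m \<in> set xs}"
        have T1: "xs = m # remove1 m xs" if "xs \<in> T1" for xs
        proof -
          have "partition xs" "m \<in> set xs" "\<forall>x\<in>set xs. m \<le> x" using that T(2) m(2) by (auto simp: T1_def)
          then show ?thesis by (cases xs) (auto intro: antisym)
        qed
        define c where "c xs = - of_nat ((2 * m + 2) * count_list xs m) * \<phi> 2" for xs
        have c: "c xs \<noteq> 0 \<longleftrightarrow> m \<in> set xs" for xs
        proof -
          have "(of_nat ((2 * m + 2) * count_list xs m) :: complex) = 0 \<longleftrightarrow> m \<notin> set xs"
            by (simp only: of_nat_eq_0_iff) (auto simp: count_list_0_iff)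
          then show ?thesis using \<phi>_2 unfolding c_def mult_eq_0_iff neg_equal_0_iff_equal by blast
        qed
        \<comment> \<open>The leading part of the image: its terms have weight exactly \<open>n - m\<close>, those of \<open>r\<close> below have less.\<close>
        define q where "q = (\<Sum>xs\<in>T1. Poly_Mapping.single (remove1 m xs)
            (Polynomial.smult (c xs) (shift 2 (Poly_Mapping.lookup p xs))))"
        have fin: "finite T1" using T(1) by (simp add: T1_def)
        let ?L = "\<lambda>xs. D (int m + 2) (lower xs (cartan (Poly_Mapping.lookup p xs)))"
        let ?R = "\<lambda>xs. c xs *s lower (remove1 m xs) (cartan (shift 2 (Poly_Mapping.lookup p xs)))"
        have D_sum: "D k (sum h A) = (\<Sum>i\<in>A. D k (h i))" for k and h :: "nat list \<Rightarrow> 'a" and A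
          by (induction A rule: infinite_finite_induct) (auto simp: D_add)
        have "D (int m + 2) (expand p) = sum ?L (Poly_Mapping.keys p)"
          unfolding expand_def D_sum ..
        also have "\<dots> = sum ?L T + sum ?L (Poly_Mapping.keys p - T)"
          by (subst sum.subset_diff[of T]) (auto simp: T_def)
        finally have D1: "D (int m + 2) (expand p) = sum ?L T + sum ?L (Poly_Mapping.keys p - T)" .
        have "sum ?R T = sum ?R T1"
          using T(1) c by (intro sum.mono_neutral_right) (auto simp: T1_def)
        also have "\<dots> = expand q"
          by (simp add: q_def expand_sum expand_single cartan_smult lower_scale)
        finally have D2: "sum ?R T = expand q" .
        have "D (int m + 2) (expand p) - expand q = (\<Sum>xs\<in>T. ?L xs - ?R xs) + sum ?L (Poly_Mapping.keys p - T)"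
          unfolding D1 D2[symmetric] by (simp add: sum_subtractf)
        also have "\<dots> \<in> weight_lt (int n - int m)"
        proof (rule weight_lt_add; rule subspace_sum[OF weight_lt_subspace])
          fix xs assume xs: "xs \<in> T"
          then have xs': "partition xs" "\<forall>x\<in>set xs. m \<le> x" "sum_list xs = n"
            using T(2) m(2) by auto
          show "?L xs - ?R xs \<in> weight_lt (int n - int m)"
            using D_smallest_part[OF xs'(1,2) m0, of "Poly_Mapping.lookup p xs"] xs'(3)
            by (simp only: c_def)
        next
          fix xs assume "xs \<in> Poly_Mapping.keys p - T"
          from keys_less[OF this] have xs: "partition xs" "sum_list xs < n" by auto
          then have "?L xs \<in> weight_lt (int n - (int m + 2) + absorption (int m + 2))"
            by (intro D_weight_lt_drop lower_weight_lt) auto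
          then show "?L xs \<in> weight_lt (int n - int m)"
            by (rule weight_lt_mono[rotated]) (simp add: absorption_def)
        qed
        finally obtain y r where yr: "D (int m + 2) (expand p) - expand q = y + expand r" "y \<in> I"
          "Poly_Mapping.keys r \<subseteq> {xs. int (sum_list xs) < int n - int m \<and> partition xs}"
          unfolding weight_lt_def by (rule normal_forms_expand) auto
        have "expand (q + r) = D (int m + 2) (expand p) - y"
          using yr(1) by (simp add: expand_add algebra_simps)
        also have "\<dots> \<in> J"
          using less.prems(2) yr(2) I_J by (intro subspace_diff[OF J_subspace] D_J) auto
        finally have 1: "expand (q + r) \<in> J" .
        have keys_q: "Poly_Mapping.keys q \<subseteq> {xs. partition xs \<and> sum_list xs = n - m}"
        proof -
          have "partition (remove1 m xs) \<and> sum_list (remove1 m xs) = n - m" if "xs \<in> T1" for xs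
            using T1[OF that] T(2)[of xs] that
            by (metis (no_types, lifting) T1_def add_diff_cancel_left' mem_Collect_eq partition_simps(2) sum_list.Cons)
          then show ?thesis
            unfolding q_def using Poly_Mapping.keys_sum[of _ T1] by (fastforce split: if_splits)
        qed
        have 2: "Poly_Mapping.keys (q + r) \<subseteq> {xs. partition xs \<and> sum_list xs \<le> n - m}"
          using Poly_Mapping.keys_add[of q r] keys_q yr(3) by fastforce
        have qr: "q + r = 0"
          using less.IH[OF _ 2 1] m0 False by simp
        have xs1': "xs1 \<in> T1" using xs1 by (simp add: T1_def)
        \<comment> \<open>The contradiction: at this partition the coefficient of \<open>q + r\<close> comes from \<open>xs1\<close> alone.\<close>
        let ?ys = "remove1 m xs1"
        have sum_ys: "sum_list ?ys = n - m"
          using T1[OF xs1'] T(2)[OF xs1(1)] by (metis add_diff_cancel_left' sum_list.Cons)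
        have r_ys: "Poly_Mapping.lookup r ?ys = 0"
          using yr(3) sum_ys mn by (auto simp: in_keys_iff subset_iff)
        have remove_eq: "remove1 m xs = ?ys \<longleftrightarrow> xs = xs1" if "xs \<in> T1" for xs
          using T1[OF that] T1[OF xs1'] by metis
        have "Poly_Mapping.lookup q ?ys
            = (\<Sum>xs\<in>T1. if xs = xs1 then Polynomial.smult (c xs) (shift 2 (Poly_Mapping.lookup p xs)) else 0)"
          unfolding q_def lookup_sum
          using remove_eq by (intro sum.cong refl) (simp add: lookup_single when_def)
        also have "\<dots> = Polynomial.smult (c xs1) (shift 2 (Poly_Mapping.lookup p xs1))"
          using xs1' fin by simp
        also have "Poly_Mapping.lookup q ?ys = Poly_Mapping.lookup (q + r) ?ys"
          using r_ys by (simp add: lookup_add)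
        finally have "Polynomial.smult (c xs1) (shift 2 (Poly_Mapping.lookup p xs1)) = 0"
          using qr by simp
        then have "shift 2 (Poly_Mapping.lookup p xs1) = 0"
          using c[of xs1] xs1(2) unfolding smult_eq_0_iff by blast
        then have "Poly_Mapping.lookup p xs1 = 0"
          unfolding shift_def by (simp add: pcompose_eq_0_iff)
        then show False using T(2)[OF xs1(1)] by simp
      qed
    qed
  qed
qed

text \<open>Every vector is a normal form modulo \<open>I\<close>, and a normal form in \<open>J\<close> has zero coefficients.\<close>

lemma maximal: "J \<subseteq> I"
proof
  fix x assume x: "x \<in> J"
  have "x \<in> normal_forms UNIV" using normal_forms_UNIV by simp
  then obtain y p where p: "x = y + expand p" "y \<in> I" "Poly_Mapping.keys p \<subseteq> {xs \<in> UNIV. partition xs}"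
    by (rule normal_forms_expand)
  define n where "n = sum sum_list (Poly_Mapping.keys p)"
  have "Poly_Mapping.keys p \<subseteq> {xs. partition xs \<and> sum_list xs \<le> n}"
    using p(3) unfolding n_def by (auto intro!: member_le_sum)
  moreover have "expand p = x - y" using p(1) by simp
  then have "expand p \<in> J" using x p(2) I_J subspace_diff[OF J_subspace] by auto
  ultimately have "p = 0" by (rule expand_mem_imp_0)
  then show "x \<in> I" using p by simp
qed

end

end

section \<open>Enveloping algebras and their action on modules\<close>

lemma complex_ring_simps [simp]:
  "carrier complex_ring = UNIV" "a \<otimes>\<^bsub>complex_ring\<^esub> b = a * b" "\<one>\<^bsub>complex_ring\<^esub> = 1"
  "\<zero>\<^bsub>complex_ring\<^esub> = 0" "a \<oplus>\<^bsub>complex_ring\<^esub> b = a + b"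
  by (simp_all add: complex_ring_def)

lemma letters_simps [simp]: "letters 0 = []" "letters (u + v) = letters u @ letters v"
  by (simp_all add: zero_free_word_def plus_free_word_def)

lemma free_algebra_simps [simp]:
  "p \<in> carrier (free_algebra S) \<longleftrightarrow> (\<forall>w\<in>Poly_Mapping.keys p. set (letters w) \<subseteq> S)"
  "p \<otimes>\<^bsub>free_algebra S\<^esub> q = p * q" "\<one>\<^bsub>free_algebra S\<^esub> = 1"
  "\<zero>\<^bsub>free_algebra S\<^esub> = 0" "p \<oplus>\<^bsub>free_algebra S\<^esub> q = p + q"
  by (simp_all add: free_algebra_def)

lemma ring_free_algebra: "ring (free_algebra S)"
proof (rule ringI)
  show "abelian_group (free_algebra S)"
  proof (rule abelian_groupI)
    fix p assume "p \<in> carrier (free_algebra S)"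
    then show "\<exists>q\<in>carrier (free_algebra S). q \<oplus>\<^bsub>free_algebra S\<^esub> p = \<zero>\<^bsub>free_algebra S\<^esub>"
      by (intro bexI[of _ "- p"]) auto
  next
    fix p q assume "p \<in> carrier (free_algebra S)" "q \<in> carrier (free_algebra S)"
    then show "p \<oplus>\<^bsub>free_algebra S\<^esub> q \<in> carrier (free_algebra S)"
      using Poly_Mapping.keys_add[of p q] by auto
  qed (auto simp: add.assoc add.commute)
  show "Group.monoid (free_algebra S)"
  proof (rule monoidI)
    fix p q assume "p \<in> carrier (free_algebra S)" "q \<in> carrier (free_algebra S)"
    then show "p \<otimes>\<^bsub>free_algebra S\<^esub> q \<in> carrier (free_algebra S)"
      using Poly_Mapping.keys_mult[of p q] by fastforce
  qed (auto simp: mult.assoc)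
qed (auto simp: algebra_simps)

lemma free_algebra_induct [consumes 1, case_names zero single add]:
  fixes p :: "'a free_word \<Rightarrow>\<^sub>0 complex"
  assumes "p \<in> carrier (free_algebra S)" "P 0"
    "\<And>w c. set (letters w) \<subseteq> S \<Longrightarrow> P (Poly_Mapping.single w c)"
    "\<And>p q. \<lbrakk>p \<in> carrier (free_algebra S); q \<in> carrier (free_algebra S); P p; P q\<rbrakk> \<Longrightarrow> P (p + q)"
  shows "P p"
proof -
  interpret ring "free_algebra S" by (rule ring_free_algebra)
  have p: "p = (\<Sum>w\<in>Poly_Mapping.keys p. Poly_Mapping.single w (Poly_Mapping.lookup p w))"
    by (intro poly_mapping_eqI) (simp add: lookup_sum lookup_single when_def in_keys_iff)
  have "finite A \<Longrightarrow> A \<subseteq> Poly_Mapping.keys p \<Longrightarrow>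
      (\<Sum>w\<in>A. Poly_Mapping.single w (Poly_Mapping.lookup p w)) \<in> carrier (free_algebra S) \<and>
      P (\<Sum>w\<in>A. Poly_Mapping.single w (Poly_Mapping.lookup p w))" for A
  proof (induction A rule: finite_induct)
    case (insert w A)
    have "Poly_Mapping.single w (Poly_Mapping.lookup p w) \<in> carrier (free_algebra S)"
      using assms(1) insert.prems by auto
    moreover have "P (Poly_Mapping.single w (Poly_Mapping.lookup p w))"
      using assms(1) insert.prems by (intro assms(3)) auto
    ultimately show ?case
      using insert a_closed assms(4) by (metis (no_types, lifting) free_algebra_simps(5) insert_subset sum.insert)
  qed (use assms(2) in auto)
  from this[OF finite_keys order_refl] show ?thesis unfolding p[symmetric] by blast
qed

lemma uea_rels_carrier:
  assumes "lie_algebra L"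
  shows "uea_rels L \<subseteq> carrier (free_algebra (carrier L))"
proof -
  interpret lie_algebra L by fact
  interpret F: ring "free_algebra (carrier L)" by (rule ring_free_algebra)
  have g: "free_gen x \<in> carrier (free_algebra (carrier L))" if "x \<in> carrier L" for x
    using that by (auto simp: free_gen_def)
  have s: "free_scalar c \<in> carrier (free_algebra (carrier L))" for c
    by (auto simp: free_scalar_def)
  have m: "p * q \<in> carrier (free_algebra (carrier L))"
    if "p \<in> carrier (free_algebra (carrier L))" "q \<in> carrier (free_algebra (carrier L))" for p q
    using F.m_closed[OF that] by simp
  have d: "p - q \<in> carrier (free_algebra (carrier L))"
    if "p \<in> carrier (free_algebra (carrier L))" "q \<in> carrier (free_algebra (carrier L))" for p q
    using that Poly_Mapping.keys_diff[of p q] by auto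
  show ?thesis
    unfolding uea_rels_def using bracket_closed smult_closed
    by (auto intro!: g s m d simp del: free_algebra_simps(1))
qed

lemma ideal_uea_ideal:
  assumes "lie_algebra L"
  shows "ideal (uea_ideal L) (free_algebra (carrier L))"
  unfolding uea_ideal_def
  by (rule ring.genideal_ideal[OF ring_free_algebra uea_rels_carrier[OF assms]])

lemma uea_ideal_rels:
  assumes "lie_algebra L"
  shows "uea_rels L \<subseteq> uea_ideal L"
  unfolding uea_ideal_def
  by (rule ring.genideal_self[OF ring_free_algebra uea_rels_carrier[OF assms]])

lemma uea_ideal_0:
  assumes "lie_algebra L"
  shows "0 \<in> uea_ideal L"
  using additive_subgroup.zero_closed[OF ideal.axioms(1)[OF ideal_uea_ideal[OF assms]]] by simp

lemma a_inv_free_algebra: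
  assumes "p \<in> carrier (free_algebra S)"
  shows "\<ominus>\<^bsub>free_algebra S\<^esub> p = - p"
proof -
  interpret ring "free_algebra S" by (rule ring_free_algebra)
  show ?thesis by (rule minus_equality) (use assms in auto)
qed

lemma a_minus_free_algebra:
  assumes "q \<in> carrier (free_algebra S)"
  shows "p \<ominus>\<^bsub>free_algebra S\<^esub> q = p - q"
  using a_inv_free_algebra[OF assms] by (simp add: a_minus_def)

lemma uea_class_eq_iff:
  assumes "lie_algebra L" "p \<in> carrier (free_algebra (carrier L))" "q \<in> carrier (free_algebra (carrier L))"
  shows "uea_class L p = uea_class L q \<longleftrightarrow> p - q \<in> uea_ideal L"
proof -
  interpret ideal "uea_ideal L" "free_algebra (carrier L)" by (rule ideal_uea_ideal[OF assms(1)])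
  show ?thesis
    using quotient_eq_iff_same_a_r_cos[OF is_ideal assms(2,3)] a_minus_free_algebra[OF assms(3)]
    by (simp add: uea_class_def)
qed

lemma UEA_simps:
  assumes "lie_algebra L"
  shows "carrier (UEA L) = uea_class L ` carrier (free_algebra (carrier L))"
    "\<lbrakk>p \<in> carrier (free_algebra (carrier L)); q \<in> carrier (free_algebra (carrier L))\<rbrakk> \<Longrightarrow>
      uea_class L p \<oplus>\<^bsub>UEA L\<^esub> uea_class L q = uea_class L (p + q)"
    "\<lbrakk>p \<in> carrier (free_algebra (carrier L)); q \<in> carrier (free_algebra (carrier L))\<rbrakk> \<Longrightarrow>
      uea_class L p \<otimes>\<^bsub>UEA L\<^esub> uea_class L q = uea_class L (p * q)"
proof -
  interpret ideal "uea_ideal L" "free_algebra (carrier L)" by (rule ideal_uea_ideal[OF assms(1)])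
  show "carrier (UEA L) = uea_class L ` carrier (free_algebra (carrier L))"
    by (auto simp: UEA_def uea_class_def FactRing_def A_RCOSETS_def' a_r_coset_def r_coset_def
      simp del: free_algebra_simps(1))
  show "uea_class L p \<oplus>\<^bsub>UEA L\<^esub> uea_class L q = uea_class L (p + q)"
    if "p \<in> carrier (free_algebra (carrier L))" "q \<in> carrier (free_algebra (carrier L))"
    using a_rcos_sum[OF that] by (simp add: UEA_def uea_class_def FactRing_def)
  show "uea_class L p \<otimes>\<^bsub>UEA L\<^esub> uea_class L q = uea_class L (p * q)"
    if "p \<in> carrier (free_algebra (carrier L))" "q \<in> carrier (free_algebra (carrier L))"
    using rcoset_mult_add[OF that] by (simp add: UEA_def uea_class_def FactRing_def)
qed

lemma mem_uea_class_iff: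
  assumes "lie_algebra L" "p \<in> carrier (free_algebra (carrier L))"
  shows "q \<in> uea_class L p \<longleftrightarrow> q - p \<in> uea_ideal L \<and> q \<in> carrier (free_algebra (carrier L))"
proof -
  interpret I: ideal "uea_ideal L" "free_algebra (carrier L)" by (rule ideal_uea_ideal[OF assms(1)])
  have "q \<in> carrier (free_algebra (carrier L))" if "q - p \<in> uea_ideal L"
    using I.add.m_closed[OF I.a_Hcarr[OF that] assms(2)] by simp
  moreover have "(\<exists>h\<in>uea_ideal L. q = h + p) \<longleftrightarrow> q - p \<in> uea_ideal L"
    by (auto intro!: bexI[of _ "q - p"])
  moreover have "q \<in> uea_class L p \<longleftrightarrow> (\<exists>h\<in>uea_ideal L. q = h + p)"
    by (auto simp: uea_class_def a_r_coset_def r_coset_def)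
  ultimately show ?thesis by blast
qed

text \<open>This is what makes the map $U(H) \to U(L)$ well defined on classes.\<close>

lemma uea_ideal_mono:
  assumes "lie_algebra L" "lie_algebra (L\<lparr>carrier := H\<rparr>)" "H \<subseteq> carrier L"
  shows "uea_ideal (L\<lparr>carrier := H\<rparr>) \<subseteq> uea_ideal L"
proof -
  let ?FH = "free_algebra H"
  interpret F: ring ?FH by (rule ring_free_algebra)
  interpret I: ideal "uea_ideal L" "free_algebra (carrier L)" by (rule ideal_uea_ideal[OF assms(1)])
  have sub: "p \<in> carrier (free_algebra (carrier L))" if "p \<in> carrier ?FH" for p
    using that assms(3) by fastforce
  have "ideal (uea_ideal L \<inter> carrier ?FH) ?FH"
  proof (rule idealI[OF ring_free_algebra])
    show "subgroup (uea_ideal L \<inter> carrier ?FH) (add_monoid ?FH)"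
    proof (rule group.subgroupI[OF F.a_group])
      show "uea_ideal L \<inter> carrier ?FH \<noteq> {}"
        using uea_ideal_0[OF assms(1)] by (intro ex_in_conv[THEN iffD1] exI[of _ 0]) auto
    next
      fix a assume a: "a \<in> uea_ideal L \<inter> carrier ?FH"
      have "\<ominus>\<^bsub>free_algebra (carrier L)\<^esub> a \<in> uea_ideal L"
        using subgroup.m_inv_closed[OF I.a_subgroup, of a] a unfolding a_inv_def by blast
      then have "- a \<in> uea_ideal L"
        using a_inv_free_algebra[of a "carrier L"] sub[of a] a by (simp del: free_algebra_simps(1))
      moreover have "- a \<in> carrier ?FH" using a by auto
      ultimately show "inv\<^bsub>add_monoid ?FH\<^esub> a \<in> uea_ideal L \<inter> carrier ?FH"
        using a_inv_free_algebra[of a H] a unfolding a_inv_def by auto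
    next
      fix a b assume "a \<in> uea_ideal L \<inter> carrier ?FH" "b \<in> uea_ideal L \<inter> carrier ?FH"
      then show "a \<otimes>\<^bsub>add_monoid ?FH\<^esub> b \<in> uea_ideal L \<inter> carrier ?FH"
        using additive_subgroup.a_closed[OF I.additive_subgroup_axioms, of a b] F.a_closed[of a b] by auto
    qed auto
  next
    fix a x assume *: "a \<in> uea_ideal L \<inter> carrier ?FH" "x \<in> carrier ?FH"
    show "x \<otimes>\<^bsub>?FH\<^esub> a \<in> uea_ideal L \<inter> carrier ?FH"
      using * I.I_l_closed[of a x] sub F.m_closed[of x a] by simp
    show "a \<otimes>\<^bsub>?FH\<^esub> x \<in> uea_ideal L \<inter> carrier ?FH"
      using * I.I_r_closed[of a x] sub F.m_closed[of a x] by simp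
  qed
  moreover have "uea_rels (L\<lparr>carrier := H\<rparr>) \<subseteq> uea_rels L"
    unfolding uea_rels_def by (intro Un_mono) (use assms(3) in \<open>simp, blast\<close>)+
  then have "uea_rels (L\<lparr>carrier := H\<rparr>) \<subseteq> uea_ideal L"
    using uea_ideal_rels[OF assms(1)] by blast
  moreover have "uea_rels (L\<lparr>carrier := H\<rparr>) \<subseteq> carrier ?FH"
    using uea_rels_carrier[OF assms(2)] by simp
  ultimately show ?thesis
    unfolding uea_ideal_def[of "L\<lparr>carrier := H\<rparr>"]
    using F.genideal_minimal[of "uea_ideal L \<inter> carrier ?FH" "uea_rels (L\<lparr>carrier := H\<rparr>)"] by auto
qed

lemma uea_incl_class:
  assumes "lie_algebra L" "lie_algebra (L\<lparr>carrier := H\<rparr>)" "H \<subseteq> carrier L" "p \<in> carrier (free_algebra H)"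
  shows "uea_incl L (uea_class (L\<lparr>carrier := H\<rparr>) p) = uea_class L p"
proof -
  have sub: "q \<in> carrier (free_algebra (carrier L))" if "q \<in> carrier (free_algebra H)" for q
    using that assms(3) by fastforce
  interpret ideal "uea_ideal (L\<lparr>carrier := H\<rparr>)" "free_algebra H"
    using ideal_uea_ideal[OF assms(2)] by simp
  have mem: "q \<in> uea_class (L\<lparr>carrier := H\<rparr>) p \<longleftrightarrow> q - p \<in> uea_ideal (L\<lparr>carrier := H\<rparr>) \<and> q \<in> carrier (free_algebra H)" for q
    using mem_uea_class_iff[OF assms(2), of p q] assms(4) by simp
  have "uea_class L q = uea_class L p" if "q \<in> uea_class (L\<lparr>carrier := H\<rparr>) p" for q
    using that mem[of q] uea_class_eq_iff[OF assms(1), of q p] sub assms(4)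
      uea_ideal_mono[OF assms(1-3)] by blast
  moreover have "p \<in> uea_class (L\<lparr>carrier := H\<rparr>) p"
    using mem assms(4) uea_ideal_0[OF assms(2)] by simp
  ultimately show ?thesis unfolding uea_incl_def by blast
qed

context lie_module
begin

lemma foldr_act_closed:
  "\<lbrakk>set xs \<subseteq> carrier L; v \<in> carrier M\<rbrakk> \<Longrightarrow> foldr (act M) xs v \<in> carrier M"
  by (induction xs) (auto intro: act_closed)

lemma foldr_act_add:
  "\<lbrakk>set xs \<subseteq> carrier L; u \<in> carrier M; v \<in> carrier M\<rbrakk> \<Longrightarrow>
    foldr (act M) xs (u \<oplus>\<^bsub>M\<^esub> v) = foldr (act M) xs u \<oplus>\<^bsub>M\<^esub> foldr (act M) xs v"
  by (induction xs) (auto intro: act_add_right foldr_act_closed)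

lemma foldr_act_smult:
  "\<lbrakk>set xs \<subseteq> carrier L; v \<in> carrier M\<rbrakk> \<Longrightarrow>
    foldr (act M) xs (c \<odot>\<^bsub>M\<^esub> v) = c \<odot>\<^bsub>M\<^esub> foldr (act M) xs v"
  by (induction xs) (auto intro: act_smult_right foldr_act_closed)

abbreviation "free_carrier \<equiv> carrier (free_algebra (carrier L))"

lemma free_act_eq:
  assumes "finite A" "Poly_Mapping.keys p \<subseteq> A" "\<forall>w\<in>A. set (letters w) \<subseteq> carrier L" "v \<in> carrier M"
  shows "free_act M p v = (\<Oplus>\<^bsub>M\<^esub>w\<in>A. Poly_Mapping.lookup p w \<odot>\<^bsub>M\<^esub> foldr (act M) (letters w) v)"
  unfolding free_act_def using assms
  by (intro M.add.finprod_mono_neutral_cong_left) (auto simp: in_keys_iff foldr_act_closed M.smult_l_null[simplified])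

lemma free_act_closed [intro]:
  assumes "p \<in> free_carrier" "v \<in> carrier M"
  shows "free_act M p v \<in> carrier M"
  unfolding free_act_def using assms by (intro M.finsum_closed) (auto intro!: M.smult_closed foldr_act_closed)

lemma free_act_single:
  assumes "set (letters w) \<subseteq> carrier L" "v \<in> carrier M"
  shows "free_act M (Poly_Mapping.single w c) v = c \<odot>\<^bsub>M\<^esub> foldr (act M) (letters w) v"
  using free_act_eq[of "{w}" "Poly_Mapping.single w c" v] assms
  by (simp add: foldr_act_closed Pi_def)

lemma free_act_0 [simp]: "free_act M 0 v = \<zero>\<^bsub>M\<^esub>"
  by (simp add: free_act_def)

lemma free_act_add:
  assumes "p \<in> free_carrier" "q \<in> free_carrier" "v \<in> carrier M"
  shows "free_act M (p + q) v = free_act M p v \<oplus>\<^bsub>M\<^esub> free_act M q v"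
proof -
  let ?A = "Poly_Mapping.keys p \<union> Poly_Mapping.keys q"
  have eq: "free_act M r v = (\<Oplus>\<^bsub>M\<^esub>w\<in>?A. Poly_Mapping.lookup r w \<odot>\<^bsub>M\<^esub> foldr (act M) (letters w) v)"
    if "r \<in> {p, q, p + q}" for r
    using that assms Poly_Mapping.keys_add[of p q] by (intro free_act_eq) auto
  have "free_act M (p + q) v = (\<Oplus>\<^bsub>M\<^esub>w\<in>?A. Poly_Mapping.lookup p w \<odot>\<^bsub>M\<^esub> foldr (act M) (letters w) v \<oplus>\<^bsub>M\<^esub>
      Poly_Mapping.lookup q w \<odot>\<^bsub>M\<^esub> foldr (act M) (letters w) v)"
    unfolding eq[of "p + q", simplified] using assms
    by (intro M.finsum_cong' refl) (auto simp: lookup_add M.smult_l_distr[simplified] foldr_act_closed Pi_def intro!: M.smult_closed)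
  also have "\<dots> = free_act M p v \<oplus>\<^bsub>M\<^esub> free_act M q v"
    unfolding eq[of p, simplified] eq[of q, simplified] using assms
    by (intro M.finsum_addf) (auto intro!: M.smult_closed foldr_act_closed)
  finally show ?thesis .
qed

lemma free_act_single_mult:
  assumes "set (letters w) \<subseteq> carrier L" "q \<in> free_carrier" "v \<in> carrier M"
  shows "free_act M (Poly_Mapping.single w c * q) v = c \<odot>\<^bsub>M\<^esub> foldr (act M) (letters w) (free_act M q v)"
  using assms(2)
proof (induction q rule: free_algebra_induct)
  case zero
  have "foldr (act M) (letters w) (0 \<odot>\<^bsub>M\<^esub> \<zero>\<^bsub>M\<^esub>) = 0 \<odot>\<^bsub>M\<^esub> foldr (act M) (letters w) \<zero>\<^bsub>M\<^esub>"
    using assms by (intro foldr_act_smult) auto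
  then show ?case
    using M.smult_l_null[simplified] M.smult_r_null[simplified] foldr_act_closed[OF assms(1)] by simp
next
  case (single u c')
  then show ?case
    using assms foldr_act_closed[of "letters u" v] foldr_act_closed[of "letters w" "foldr (act M) (letters u) v"]
    by (simp add: mult_single free_act_single foldr_act_smult M.smult_assoc1[simplified])
next
  case (add p q)
  interpret A: ring "free_algebra (carrier L)" by (rule ring_free_algebra)
  have s: "Poly_Mapping.single w c \<in> free_carrier" using assms by auto
  have m: "Poly_Mapping.single w c * p \<in> free_carrier" "Poly_Mapping.single w c * q \<in> free_carrier"
    using A.m_closed[OF s add(1)] A.m_closed[OF s add(2)] unfolding free_algebra_simps(2) .
  have "free_act M (Poly_Mapping.single w c * p + Poly_Mapping.single w c * q) v
    = c \<odot>\<^bsub>M\<^esub> foldr (act M) (letters w) (free_act M p v) \<oplus>\<^bsub>M\<^esub> c \<odot>\<^bsub>M\<^esub> foldr (act M) (letters w) (free_act M q v)"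
    using free_act_add[OF m assms(3)] add by simp
  also have "\<dots> = c \<odot>\<^bsub>M\<^esub> foldr (act M) (letters w) (free_act M p v \<oplus>\<^bsub>M\<^esub> free_act M q v)"
    using free_act_closed[OF add(1) assms(3)] free_act_closed[OF add(2) assms(3)] assms
    by (simp add: foldr_act_add M.smult_r_distr[simplified] foldr_act_closed)
  finally show ?case using free_act_add[OF add(1,2) assms(3)] by (simp add: distrib_left)
qed

lemma free_act_mult:
  assumes "p \<in> free_carrier" "q \<in> free_carrier" "v \<in> carrier M"
  shows "free_act M (p * q) v = free_act M p (free_act M q v)"
  using assms(1)
proof (induction p rule: free_algebra_induct)
  case zero
  then show ?case by simp
next
  case (single w c)
  then show ?case
    using assms free_act_closed[OF assms(2,3)] by (simp add: free_act_single_mult free_act_single)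
next
  case (add p p')
  interpret A: ring "free_algebra (carrier L)" by (rule ring_free_algebra)
  have m: "p * q \<in> free_carrier" "p' * q \<in> free_carrier"
    using A.m_closed[OF add(1) assms(2)] A.m_closed[OF add(2) assms(2)] unfolding free_algebra_simps(2) .
  then show ?case
    using add free_act_add[OF m assms(3)] free_act_add[OF add(1,2) free_act_closed[OF assms(2,3)]]
    by (simp add: distrib_right)
qed

lemma free_act_gen [simp]:
  "x \<in> carrier L \<Longrightarrow> v \<in> carrier M \<Longrightarrow> free_act M (free_gen x) v = act M x v"
  using act_closed by (simp add: free_gen_def free_act_single M.smult_one[simplified])

lemma free_act_scalar [simp]:
  "v \<in> carrier M \<Longrightarrow> free_act M (free_scalar c) v = c \<odot>\<^bsub>M\<^esub> v"
  by (simp add: free_scalar_def free_act_single)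

lemma free_act_diff:
  assumes "p \<in> free_carrier" "q \<in> free_carrier" "v \<in> carrier M"
  shows "free_act M (p - q) v = free_act M p v \<ominus>\<^bsub>M\<^esub> free_act M q v"
proof -
  have "p - q \<in> free_carrier" using assms Poly_Mapping.keys_diff[of p q] by auto
  then have "free_act M (p - q) v \<in> carrier M" "free_act M p v = free_act M (p - q) v \<oplus>\<^bsub>M\<^esub> free_act M q v"
    using free_act_add[of "p - q" q v] assms by auto
  then show ?thesis
    using free_act_closed[OF assms(2,3)] by (simp add: M.minus_eq M.a_assoc M.r_neg)
qed

text \<open>The elements of the free algebra that act by zero on the whole module form a two-sided ideal, and the
axioms that govern the Lie algebra argument of the action say that this ideal contains the relations.\<close>

lemma free_act_uea_ideal:
  assumes "p \<in> uea_ideal L" "v \<in> carrier M"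
  shows "free_act M p v = \<zero>\<^bsub>M\<^esub>"
proof -
  interpret A: ring "free_algebra (carrier L)" by (rule ring_free_algebra)
  let ?K = "{p \<in> free_carrier. \<forall>v\<in>carrier M. free_act M p v = \<zero>\<^bsub>M\<^esub>}"
  have act_0: "free_act M p \<zero>\<^bsub>M\<^esub> = \<zero>\<^bsub>M\<^esub>" if "p \<in> free_carrier" for p
    using free_act_mult[OF that, of 0 "\<zero>\<^bsub>M\<^esub>"] by simp
  have gen: "free_gen x \<in> free_carrier" if "x \<in> carrier L" for x
    using that by (auto simp: free_gen_def)
  have scal: "free_scalar c \<in> free_carrier" for c
    by (auto simp: free_scalar_def)
  note m = A.m_closed[unfolded free_algebra_simps(2)]
  have d: "p - q \<in> free_carrier" if "p \<in> free_carrier" "q \<in> free_carrier" for p q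
    using that Poly_Mapping.keys_diff[of p q] by auto
  have "ideal ?K (free_algebra (carrier L))"
  proof (rule idealI[OF ring_free_algebra])
    show "subgroup ?K (add_monoid (free_algebra (carrier L)))"
    proof (rule group.subgroupI[OF A.a_group])
      show "?K \<noteq> {}" by (rule ex_in_conv[THEN iffD1], rule exI[of _ 0]) simp
    next
      fix p assume p: "p \<in> ?K"
      have "inv\<^bsub>add_monoid (free_algebra (carrier L))\<^esub> p = 0 - p"
        using a_minus_free_algebra[of p "carrier L" 0] p A.a_inv_closed[of p]
        unfolding a_inv_def[symmetric] a_minus_def by simp
      moreover have "0 - p \<in> free_carrier" using p d[of 0 p] by simp
      moreover have "free_act M (0 - p) v = \<zero>\<^bsub>M\<^esub>" if "v \<in> carrier M" for v
        using p that free_act_diff[of 0 p v] by (simp add: M.minus_eq)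
      ultimately show "inv\<^bsub>add_monoid (free_algebra (carrier L))\<^esub> p \<in> ?K" by simp
    next
      fix p q assume pq: "p \<in> ?K" "q \<in> ?K"
      then have "p + q \<in> free_carrier" using A.a_closed[of p q] by simp
      with pq show "p \<otimes>\<^bsub>add_monoid (free_algebra (carrier L))\<^esub> q \<in> ?K"
        using free_act_add[of p q] by simp
    qed auto
  next
    fix p q assume *: "p \<in> ?K" "q \<in> free_carrier"
    then show "q \<otimes>\<^bsub>free_algebra (carrier L)\<^esub> p \<in> ?K" "p \<otimes>\<^bsub>free_algebra (carrier L)\<^esub> q \<in> ?K"
      using m[of q p] m[of p q] free_act_mult[of q p] free_act_mult[of p q] act_0 free_act_closed[of q]
      by (auto simp del: free_algebra_simps(1))
  qed
  moreover have "uea_rels L \<subseteq> ?K"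
  proof
    have cancel: "a \<ominus>\<^bsub>M\<^esub> a = \<zero>\<^bsub>M\<^esub>" if "a \<in> carrier M" for a
      using that by (simp add: M.minus_eq M.r_neg)
    have cancel_add: "(a \<oplus>\<^bsub>M\<^esub> b) \<ominus>\<^bsub>M\<^esub> a \<ominus>\<^bsub>M\<^esub> b = \<zero>\<^bsub>M\<^esub>"
      if "a \<in> carrier M" "b \<in> carrier M" for a b
    proof -
      have "(a \<oplus>\<^bsub>M\<^esub> b) \<ominus>\<^bsub>M\<^esub> a \<ominus>\<^bsub>M\<^esub> b = (a \<oplus>\<^bsub>M\<^esub> b) \<ominus>\<^bsub>M\<^esub> (a \<oplus>\<^bsub>M\<^esub> b)"
        using that by (simp add: M.minus_eq M.minus_add M.a_assoc)
      then show ?thesis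
        using cancel that by simp
    qed
    fix p assume p: "p \<in> uea_rels L"
    moreover have "p \<in> free_carrier"
      using p uea_rels_carrier[OF L.lie_algebra_axioms] by blast
    moreover have "free_act M p v = \<zero>\<^bsub>M\<^esub>" if v: "v \<in> carrier M" for v
    proof -
      from p consider (add) x y where "x \<in> carrier L" "y \<in> carrier L"
          "p = free_gen (x \<oplus>\<^bsub>L\<^esub> y) - free_gen x - free_gen y"
        | (smult) c x where "x \<in> carrier L" "p = free_gen (c \<odot>\<^bsub>L\<^esub> x) - free_scalar c * free_gen x"
        | (bracket) x y where "x \<in> carrier L" "y \<in> carrier L"
          "p = free_gen x * free_gen y - free_gen y * free_gen x - free_gen (bracket L x y)"
        unfolding uea_rels_def by blast
      then show ?thesis
      proof cases
        case add
        have xy: "x \<oplus>\<^bsub>L\<^esub> y \<in> carrier L" using add(1,2) by blast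
        note g = gen[OF add(1)] gen[OF add(2)] gen[OF xy]
        show ?thesis
          unfolding add(3) free_act_diff[OF d[OF g(3) g(1)] g(2) v] free_act_diff[OF g(3) g(1) v]
            free_act_gen[OF add(1) v] free_act_gen[OF add(2) v] free_act_gen[OF xy v]
            act_add_left[OF add(1,2) v]
          by (rule cancel_add[OF act_closed[OF add(1) v] act_closed[OF add(2) v]])
      next
        case smult
        have cx: "c \<odot>\<^bsub>L\<^esub> x \<in> carrier L" using smult(1) L.smult_closed by simp
        note g = gen[OF smult(1)] gen[OF cx]
        show ?thesis
          unfolding smult(2) free_act_diff[OF g(2) m[OF scal g(1)] v] free_act_mult[OF scal g(1) v]
            free_act_gen[OF smult(1) v] free_act_gen[OF cx v] act_smult_left[OF smult(1) v]
            free_act_scalar[OF act_closed[OF smult(1) v]]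
          using act_closed[OF smult(1) v] by (intro cancel M.smult_closed) auto
      next
        case bracket
        have xy: "bracket L x y \<in> carrier L" using bracket(1,2) L.bracket_closed by blast
        note g = gen[OF bracket(1)] gen[OF bracket(2)] gen[OF xy]
        note ac = act_closed[OF bracket(1) v] act_closed[OF bracket(2) v]
        have ac': "act M x (act M y v) \<in> carrier M" "act M y (act M x v) \<in> carrier M"
          using act_closed bracket(1,2) v by auto
        show ?thesis
          unfolding bracket(3) free_act_diff[OF d[OF m[OF g(1,2)] m[OF g(2,1)]] g(3) v]
            free_act_diff[OF m[OF g(1,2)] m[OF g(2,1)] v] free_act_mult[OF g(1,2) v] free_act_mult[OF g(2,1) v]
            free_act_gen[OF bracket(1) v] free_act_gen[OF bracket(2) v] free_act_gen[OF xy v]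
            free_act_gen[OF bracket(1) ac(2)] free_act_gen[OF bracket(2) ac(1)] act_bracket[OF bracket(1,2) v]
          using ac' by (intro cancel M.minus_closed)
      qed
    qed
    ultimately show "p \<in> ?K" by blast
  qed
  ultimately have "uea_ideal L \<subseteq> ?K"
    unfolding uea_ideal_def by (rule A.genideal_minimal)
  with assms show ?thesis by blast
qed

lemma uea_act_class:
  assumes "p \<in> free_carrier" "v \<in> carrier M"
  shows "uea_act M (uea_class L p) v = free_act M p v"
proof -
  interpret I: ideal "uea_ideal L" "free_algebra (carrier L)" by (rule ideal_uea_ideal[OF L.lie_algebra_axioms])
  have "free_act M q v = free_act M p v" if "q \<in> uea_class L p" for q
  proof -
    have q: "q - p \<in> uea_ideal L" "q \<in> free_carrier" using that mem_uea_class_iff[OF L.lie_algebra_axioms assms(1)] by auto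
    have "free_act M ((q - p) + p) v = free_act M (q - p) v \<oplus>\<^bsub>M\<^esub> free_act M p v"
      using I.a_Hcarr[OF q(1)] assms by (intro free_act_add) auto
    then show ?thesis using free_act_uea_ideal[OF q(1) assms(2)] free_act_closed[OF assms] by simp
  qed
  moreover have "p \<in> uea_class L p"
    using mem_uea_class_iff[OF L.lie_algebra_axioms assms(1)] assms uea_ideal_0[OF L.lie_algebra_axioms] by simp
  ultimately have "(\<lambda>p. free_act M p v) ` uea_class L p = {free_act M p v}" by blast
  then show ?thesis by (simp add: uea_act_def)
qed

end

section \<open>Modules presented by the free algebra\<close>

interpretation VS: vector_space "scale :: complex \<Rightarrow> ('b \<Rightarrow>\<^sub>0 complex) \<Rightarrow> ('b \<Rightarrow>\<^sub>0 complex)"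
  by unfold_locales simp_all

lemma scale_eq_mult: "scale c p = free_scalar c * p"
proof (induction p rule: basis_induct)
  case (add f g)
  then show ?case by (simp add: distrib_left)
qed (auto simp: free_scalar_def mult_single)

lemma free_scalar_commute: "p * free_scalar c = free_scalar c * p"
proof (induction p rule: basis_induct)
  case (add f g)
  then show ?case by (simp add: distrib_left distrib_right)
qed (auto simp: free_scalar_def mult_single mult.commute)

lemma mult_scale:
  fixes p :: "'a free_word \<Rightarrow>\<^sub>0 complex"
  shows "p * scale c q = scale c (p * q)"
  by (simp only: scale_eq_mult mult.assoc[symmetric] free_scalar_commute[of p c])

lemma (in lie_module) free_act_smult:
  assumes "p \<in> free_carrier" "v \<in> carrier M"
  shows "free_act M p (c \<odot>\<^bsub>M\<^esub> v) = c \<odot>\<^bsub>M\<^esub> free_act M p v"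
proof -
  have s: "free_scalar c \<in> free_carrier" by (auto simp: free_scalar_def)
  show ?thesis
    using free_act_mult[OF assms(1) s assms(2)] free_act_mult[OF s assms] assms
    by (simp add: free_scalar_commute free_act_closed del: free_algebra_simps(1))
qed

text \<open>\<open>T\<close> exhibits \<open>M\<close> as a quotient of the free algebra. This asks less than that \<open>M\<close> is a Lie module: the
module structures on sets of cosets below are only ever accessed through such a map, and isomorphisms
are obtained by comparing kernels.\<close>

locale presentation =
  fixes M :: "('g, 'v, 'n) lie_rep_scheme" and T :: "('g free_word \<Rightarrow>\<^sub>0 complex) \<Rightarrow> 'v"
  assumes carrier_eq: "carrier M = range T"
    and zero_eq: "\<zero>\<^bsub>M\<^esub> = T 0"
    and add_eq: "T p \<oplus>\<^bsub>M\<^esub> T q = T (p + q)"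
    and smult_eq: "c \<odot>\<^bsub>M\<^esub> T p = T (scale c p)"
    and act_eq: "act M x (T p) = T (free_gen x * p)"
begin

definition ker :: "('g free_word \<Rightarrow>\<^sub>0 complex) set" where
  "ker = {p. T p = T 0}"

lemma eq_iff: "T p = T q \<longleftrightarrow> p - q \<in> ker"
proof
  assume "T p = T q"
  then have "T (p - q) = T (q - q)"
    using add_eq[of p "- q"] add_eq[of q "- q"] by simp
  then show "p - q \<in> ker" by (simp add: ker_def)
next
  assume "p - q \<in> ker"
  then have "T (p - q) = T 0" by (simp add: ker_def)
  then show "T p = T q" using add_eq[of "p - q" q] add_eq[of 0 q] by simp
qed

lemma subspace_ker: "VS.subspace ker"
proof -
  have "p + q \<in> ker" if "p \<in> ker" "q \<in> ker" for p q
    using that add_eq[of p q] add_eq[of 0 0] by (simp add: ker_def)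
  moreover have "scale c p \<in> ker" if "p \<in> ker" for c p
    using that smult_eq[of c p] smult_eq[of c 0] by (simp add: ker_def)
  ultimately show ?thesis by (auto simp: VS.subspace_def ker_def)
qed

lemma gen_mult_ker: "p \<in> ker \<Longrightarrow> free_gen x * p \<in> ker"
  using act_eq[of x p] act_eq[of x 0] by (simp add: ker_def)

text \<open>A coset \<open>N +> T p\<close> is the image under \<open>T\<close> of the coset of \<open>p\<close> modulo the preimage of \<open>N\<close>. In this form
the unions over representatives in \<^const>\<open>quotient_rep\<close> are unions of one and the same set.\<close>

lemma presentation_quotient:
  assumes N: "N \<subseteq> carrier M" and J: "VS.subspace {p. T p \<in> N}"
    and stable: "\<And>x p. T p \<in> N \<Longrightarrow> T (free_gen x * p) \<in> N"
  defines "Q \<equiv> \<lambda>p. (\<lambda>j. T (j + p)) ` {j. T j \<in> N}"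
  shows "presentation (quotient_rep M N) Q"
    and "presentation.ker Q = {p. T p \<in> N}"
proof -
  let ?J = "{p. T p \<in> N}"
  note J_add = VS.subspace_add[OF J] and J_scale = VS.subspace_scale[OF J] and J_0 = VS.subspace_0[OF J]
  note J_diff = VS.subspace_diff[OF J]
  have N_eq: "N = T ` ?J" using N carrier_eq by auto
  have coset: "N +>\<^bsub>M\<^esub> T p = Q p" for p
    unfolding a_r_coset_def r_coset_def Q_def by (subst N_eq) (auto simp: add_eq)
  have Q_shift: "Q (j + p) = Q p" if "j \<in> ?J" for j p
  proof -
    have "(\<lambda>i. i + j) ` ?J = ?J"
    proof (intro equalityI subsetI)
      fix i assume "i \<in> ?J"
      then show "i \<in> (\<lambda>i. i + j) ` ?J" using J_diff[of i j] that by (intro image_eqI[of _ _ "i - j"]) auto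
    qed (use J_add that in auto)
    then have "Q p = (\<lambda>i. T (i + p)) ` (\<lambda>i. i + j) ` ?J" unfolding Q_def by simp
    then show ?thesis unfolding Q_def image_image by (simp add: add.assoc)
  qed
  have union: "(\<Union>v\<in>Q p. N +>\<^bsub>M\<^esub> g v) = Q (h p)"
    if gh: "\<And>p. g (T p) = T (h p)" "\<And>p q. h (p + q) = h p + h q" "\<And>j. j \<in> ?J \<Longrightarrow> h j \<in> ?J" for g h p
  proof -
    have *: "N +>\<^bsub>M\<^esub> g (T (j + p)) = Q (h p)" if "j \<in> ?J" for j
      using Q_shift[OF gh(3)[OF that]] by (simp add: gh coset)
    have "(\<Union>v\<in>Q p. N +>\<^bsub>M\<^esub> g v) = (\<Union>j\<in>?J. N +>\<^bsub>M\<^esub> g (T (j + p)))"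
      by (simp add: Q_def)
    then show ?thesis using * J_0 by auto
  qed
  show pres: "presentation (quotient_rep M N) Q"
  proof
    show "carrier (quotient_rep M N) = range Q"
      by (auto simp: quotient_rep_def A_RCOSETS_def' carrier_eq coset image_iff)
    show "\<zero>\<^bsub>quotient_rep M N\<^esub> = Q 0"
      by (simp add: quotient_rep_def Q_def) (rule N_eq)
    show "Q p \<oplus>\<^bsub>quotient_rep M N\<^esub> Q q = Q (p + q)" for p q
    proof -
      have "T (i + p) \<oplus>\<^bsub>M\<^esub> T (j + q) \<in> Q (p + q)" if "i \<in> ?J" "j \<in> ?J" for i j
        unfolding Q_def using J_add[OF that] by (intro image_eqI[of _ _ "i + j"]) (auto simp: add_eq algebra_simps)
      moreover have "T (j + (p + q)) = T (j + p) \<oplus>\<^bsub>M\<^esub> T (0 + q)" for j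
        by (simp add: add_eq algebra_simps)
      ultimately show ?thesis
        using J_0 unfolding quotient_rep_def set_add_def set_mult_def Q_def by fastforce
    qed
    show "c \<odot>\<^bsub>quotient_rep M N\<^esub> Q p = Q (scale c p)" for c p
      using union[of "\<lambda>v. c \<odot>\<^bsub>M\<^esub> v" "scale c" p] J_scale by (simp add: quotient_rep_def smult_eq)
    show "act (quotient_rep M N) x (Q p) = Q (free_gen x * p)" for x p
      using union[of "act M x" "\<lambda>p. free_gen x * p" p] stable by (simp add: quotient_rep_def act_eq distrib_left)
  qed
  have "T p \<in> Q p" for p unfolding Q_def using J_0 by (intro image_eqI[of _ _ 0]) auto
  moreover have "Q 0 = N" unfolding Q_def using N_eq by simp
  ultimately have "Q p = Q 0 \<longleftrightarrow> T p \<in> N" for p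
    using Q_shift[of p 0] by auto
  then show "presentation.ker Q = ?J"
    using presentation.ker_def[OF pres] by simp
qed

end

text \<open>Two quotients of the free algebra by the same kernel are isomorphic; the isomorphism sends the class of
\<open>p\<close> to the class of \<open>p\<close>.\<close>

lemma presentation_iso:
  assumes "presentation M T" "presentation M' T'" "presentation.ker T = presentation.ker T'"
  obtains f where "f \<in> lie_module_iso L M M'"
proof
  interpret M: presentation M T by fact
  interpret M': presentation M' T' by fact
  define f where "f v = T' (SOME p. T p = v)" for v
  have f: "f (T p) = T' p" for p
  proof -
    have "T (SOME q. T q = T p) = T p" by (rule someI[of _ p]) simp
    then show ?thesis using assms(3) by (simp add: f_def M.eq_iff M'.eq_iff)
  qed
  have "bij_betw f (carrier M) (carrier M')"
    using assms(3) by (auto simp: bij_betw_def inj_on_def M.carrier_eq M'.carrier_eq f M.eq_iff M'.eq_iff image_image)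
  then show "f \<in> lie_module_iso L M M'"
    by (auto simp: lie_module_iso_def M.carrier_eq f M.add_eq M'.add_eq M.smult_eq M'.smult_eq M.act_eq M'.act_eq)
qed

section \<open>Modules induced from a character of a subalgebra\<close>

text \<open>
The situation of $U(L) \otimes_{U(H)} \mathbb{C}_\chi$. As \<open>L\<close> fills its type, every element of the
free algebra of the type is an element of the free algebra on \<open>L\<close>, and no carrier conditions
are needed for it.
\<close>

locale induced_from_character =
  fixes L :: "'g lie" and H :: "'g set" and \<chi> :: "'g \<Rightarrow> complex"
  assumes lie_algebra_L: "lie_algebra L" and carrier_L: "carrier L = UNIV"
    and lie_module_H: "lie_module (L\<lparr>carrier := H\<rparr>) (one_dim_rep \<chi>)"
begin

interpretation N: lie_module "L\<lparr>carrier := H\<rparr>" "one_dim_rep \<chi>" by (rule lie_module_H)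

lemma lie_algebra_H: "lie_algebra (L\<lparr>carrier := H\<rparr>)"
  by (rule N.L.lie_algebra_axioms)

lemma F_L [simp]: "carrier (free_algebra (carrier L)) = UNIV"
  by (auto simp: free_algebra_def carrier_L)

lemmas UEA_L = UEA_simps[OF lie_algebra_L, unfolded F_L, simplified]

lemma uea_class_eq: "p - q \<in> uea_ideal L \<Longrightarrow> uea_class L p = uea_class L q"
  using uea_class_eq_iff[OF lie_algebra_L, of p q] by (simp only: F_L UNIV_I)

definition pure_tensor :: "('g free_word \<Rightarrow>\<^sub>0 complex) \<Rightarrow> complex \<Rightarrow>
    ('g free_word \<Rightarrow>\<^sub>0 complex) set \<times> complex \<Rightarrow>\<^sub>0 int" where
  "pure_tensor p c = frag_of (uea_class L p, c)"

abbreviation "N \<equiv> one_dim_rep \<chi>"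
abbreviation "free_H \<equiv> carrier (free_algebra H)"
abbreviation "free_tensors \<equiv> free_Abelian_group (carrier (UEA L) \<times> carrier N)"

text \<open>The relations of the tensor product, written with elements of the free algebra that represent
the classes in $U(L)$ and $U(H)$.\<close>

definition tensor_relators :: "(('g free_word \<Rightarrow>\<^sub>0 complex) set \<times> complex \<Rightarrow>\<^sub>0 int) set" where
  "tensor_relators = {pure_tensor (p + q) c - pure_tensor p c - pure_tensor q c | p q c. True}
     \<union> {pure_tensor p (c + d) - pure_tensor p c - pure_tensor p d | p c d. True}
     \<union> {pure_tensor (p * r) c - pure_tensor p (free_act N r c) | p r c. r \<in> free_H}"

abbreviation "relator_subgroup \<equiv> induced_subgroup L H N"

lemma N_simps [simp]: "carrier N = UNIV" "\<zero>\<^bsub>N\<^esub> = 0" "a \<oplus>\<^bsub>N\<^esub> b = a + b" "a \<odot>\<^bsub>N\<^esub> b = a * b"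
  "act N x a = \<chi> x * a"
  by (simp_all add: one_dim_rep_def)

lemma uea_act_N: "r \<in> free_H \<Longrightarrow> uea_act N (uea_class (L\<lparr>carrier := H\<rparr>) r) c = free_act N r c"
  using N.uea_act_class[of r c] by simp

lemma carrier_UEA_H: "carrier (UEA (L\<lparr>carrier := H\<rparr>)) = uea_class (L\<lparr>carrier := H\<rparr>) ` free_H"
  using UEA_simps(1)[OF lie_algebra_H] by simp

lemma mult_incl:
  "r \<in> free_H \<Longrightarrow> uea_class L p \<otimes>\<^bsub>UEA L\<^esub> uea_incl L (uea_class (L\<lparr>carrier := H\<rparr>) r) = uea_class L (p * r)"
  using uea_incl_class[OF lie_algebra_L lie_algebra_H, of r] by (simp add: carrier_L UEA_L)

lemma induced_subgroup_eq: "relator_subgroup = generate free_tensors tensor_relators"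
proof -
  have "tensor_rels (UEA (L\<lparr>carrier := H\<rparr>)) (UEA L) (\<lambda>a r. a \<otimes>\<^bsub>UEA L\<^esub> uea_incl L r) N (uea_act N) = tensor_relators"
    (is "?tensor_relators = tensor_relators")
  proof (intro equalityI subsetI)
    fix x assume "x \<in> ?tensor_relators"
    then consider
        (1) a a' b where "x = frag_of (a \<oplus>\<^bsub>UEA L\<^esub> a', b) - frag_of (a, b) - frag_of (a', b)" "a \<in> carrier (UEA L)" "a' \<in> carrier (UEA L)"
      | (2) a b b' where "x = frag_of (a, b \<oplus>\<^bsub>N\<^esub> b') - frag_of (a, b) - frag_of (a, b')" "a \<in> carrier (UEA L)"
      | (3) a r b where "x = frag_of (a \<otimes>\<^bsub>UEA L\<^esub> uea_incl L r, b) - frag_of (a, uea_act N r b)"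
          "a \<in> carrier (UEA L)" "r \<in> carrier (UEA (L\<lparr>carrier := H\<rparr>))"
      unfolding tensor_rels_def by blast
    then show "x \<in> tensor_relators"
    proof cases
      case 1
      from 1(2,3) obtain p q where "a = uea_class L p" "a' = uea_class L q"
        unfolding UEA_L(1) by (elim rangeE)
      then have "x = pure_tensor (p + q) b - pure_tensor p b - pure_tensor q b" using 1 by (simp add: pure_tensor_def UEA_L)
      then show ?thesis unfolding tensor_relators_def by blast
    next
      case 2
      from 2(2) obtain p where "a = uea_class L p"
        unfolding UEA_L(1) by (elim rangeE)
      then have "x = pure_tensor p (b + b') - pure_tensor p b - pure_tensor p b'" using 2 by (simp add: pure_tensor_def)
      then show ?thesis unfolding tensor_relators_def by blast
    next
      case 3
      from 3(2,3) obtain p s where "a = uea_class L p" and s: "r = uea_class (L\<lparr>carrier := H\<rparr>) s" "s \<in> free_H"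
        unfolding UEA_L(1) carrier_UEA_H by (elim rangeE imageE)
      then have "x = pure_tensor (p * s) b - pure_tensor p (free_act N s b)"
        using 3(1) unfolding pure_tensor_def by (simp only: mult_incl uea_act_N)
      then show ?thesis unfolding tensor_relators_def using s(2) by blast
    qed
  next
    fix x assume "x \<in> tensor_relators"
    then consider
        (1) p q c where "x = pure_tensor (p + q) c - pure_tensor p c - pure_tensor q c"
      | (2) p c d where "x = pure_tensor p (c + d) - pure_tensor p c - pure_tensor p d"
      | (3) p r c where "x = pure_tensor (p * r) c - pure_tensor p (free_act N r c)" "r \<in> free_H"
      unfolding tensor_relators_def by blast
    then show "x \<in> ?tensor_relators"
    proof cases
      case 1
      then have "x = frag_of (uea_class L p \<oplus>\<^bsub>UEA L\<^esub> uea_class L q, c) - frag_of (uea_class L p, c) - frag_of (uea_class L q, c)"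
        by (simp add: pure_tensor_def UEA_L)
      moreover have "uea_class L p \<in> carrier (UEA L)" "uea_class L q \<in> carrier (UEA L)" "c \<in> carrier N"
        by (auto simp: UEA_L)
      ultimately show ?thesis unfolding tensor_rels_def by blast
    next
      case 2
      then have "x = frag_of (uea_class L p, c \<oplus>\<^bsub>N\<^esub> d) - frag_of (uea_class L p, c) - frag_of (uea_class L p, d)"
        by (simp add: pure_tensor_def)
      moreover have "uea_class L p \<in> carrier (UEA L)" "c \<in> carrier N" "d \<in> carrier N"
        by (auto simp: UEA_L)
      ultimately show ?thesis unfolding tensor_rels_def by blast
    next
      case 3
      let ?r = "uea_class (L\<lparr>carrier := H\<rparr>) r"
      have "x = frag_of (uea_class L p \<otimes>\<^bsub>UEA L\<^esub> uea_incl L ?r, c) - frag_of (uea_class L p, uea_act N ?r c)"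
        using 3 unfolding pure_tensor_def by (simp only: mult_incl uea_act_N)
      moreover have "uea_class L p \<in> carrier (UEA L)" "c \<in> carrier N" "?r \<in> carrier (UEA (L\<lparr>carrier := H\<rparr>))"
        using 3(2) by (auto simp: UEA_L carrier_UEA_H simp del: free_algebra_simps(1))
      ultimately show ?thesis unfolding tensor_rels_def by blast
    qed
  qed
  then show ?thesis by (simp add: induced_subgroup_def tensor_subgroup_def)
qed

lemma pure_tensor_carrier: "pure_tensor p c \<in> carrier free_tensors"
  by (simp add: pure_tensor_def UEA_L)

lemma free_tensors_diff: "f \<in> carrier free_tensors \<Longrightarrow> g \<in> carrier free_tensors \<Longrightarrow> f - g \<in> carrier free_tensors"
  using keys_diff[of f g] by auto

lemma tensor_relators_carrier: "tensor_relators \<subseteq> carrier free_tensors"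
  unfolding tensor_relators_def by (auto intro!: free_tensors_diff pure_tensor_carrier simp del: carrier_free_Abelian_group_iff N_simps)

lemma relator_subgroup_subgroup: "subgroup relator_subgroup free_tensors"
  unfolding induced_subgroup_eq using tensor_relators_carrier by (intro group.generate_is_subgroup) auto

lemma relator_subgroup_0 [simp]: "0 \<in> relator_subgroup"
  using subgroup.one_closed[OF relator_subgroup_subgroup] by simp

lemma relator_subgroup_add: "f \<in> relator_subgroup \<Longrightarrow> g \<in> relator_subgroup \<Longrightarrow> f + g \<in> relator_subgroup"
  using subgroup.m_closed[OF relator_subgroup_subgroup, of f g] by simp

lemma relator_subgroup_carrier: "f \<in> relator_subgroup \<Longrightarrow> f \<in> carrier free_tensors"
  using subgroup.mem_carrier[OF relator_subgroup_subgroup] by blast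

lemma relator_subgroup_uminus: "f \<in> relator_subgroup \<Longrightarrow> - f \<in> relator_subgroup"
  using subgroup.m_inv_closed[OF relator_subgroup_subgroup, of f] relator_subgroup_carrier[of f] by simp

lemma relator_subgroup_diff: "f \<in> relator_subgroup \<Longrightarrow> g \<in> relator_subgroup \<Longrightarrow> f - g \<in> relator_subgroup"
  using relator_subgroup_add[of f "- g"] relator_subgroup_uminus[of g] by simp

lemma tensor_relators_subgroup: "f \<in> tensor_relators \<Longrightarrow> f \<in> relator_subgroup"
  unfolding induced_subgroup_eq by (rule generate.incl)

lemma tensor_relators_intros:
  "pure_tensor (p + q) c - pure_tensor p c - pure_tensor q c \<in> tensor_relators"
  "pure_tensor p (c + d) - pure_tensor p c - pure_tensor p d \<in> tensor_relators"
  "r \<in> free_H \<Longrightarrow> pure_tensor (p * r) c - pure_tensor p (free_act N r c) \<in> tensor_relators"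
  unfolding tensor_relators_def by blast+

lemma tensor_relators_cases:
  assumes "f \<in> tensor_relators"
  obtains p q c where "f = pure_tensor (p + q) c - pure_tensor p c - pure_tensor q c"
    | p c d where "f = pure_tensor p (c + d) - pure_tensor p c - pure_tensor p d"
    | p r c where "f = pure_tensor (p * r) c - pure_tensor p (free_act N r c)" "r \<in> free_H"
  using assms unfolding tensor_relators_def by blast

lemmas pure_tensor_add = tensor_relators_subgroup[OF tensor_relators_intros(1)]
  and pure_tensor_balanced = tensor_relators_subgroup[OF tensor_relators_intros(3)]

lemma pure_tensor_scalar: "pure_tensor (p * free_scalar c) 1 - pure_tensor p c \<in> relator_subgroup"
proof -
  have "free_scalar c \<in> free_H" by (auto simp: free_scalar_def)
  from pure_tensor_balanced[OF this, of p 1] show ?thesis by simp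
qed

definition tensor_coset :: "(('g free_word \<Rightarrow>\<^sub>0 complex) set \<times> complex \<Rightarrow>\<^sub>0 int) \<Rightarrow>
    (('g free_word \<Rightarrow>\<^sub>0 complex) set \<times> complex \<Rightarrow>\<^sub>0 int) set" where
  "tensor_coset f = relator_subgroup #>\<^bsub>free_tensors\<^esub> f"

lemma tensor_coset_eq: "tensor_coset f = {b + f | b. b \<in> relator_subgroup}"
  by (auto simp: tensor_coset_def r_coset_def)

lemma tensor_coset_eq_iff: "tensor_coset f = tensor_coset g \<longleftrightarrow> f - g \<in> relator_subgroup"
proof
  assume "tensor_coset f = tensor_coset g"
  moreover have "f \<in> tensor_coset f" unfolding tensor_coset_eq by (intro CollectI exI[of _ 0]) simp
  ultimately show "f - g \<in> relator_subgroup" by (auto simp: tensor_coset_eq)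
next
  have sub: "tensor_coset f \<subseteq> tensor_coset g" if "f - g \<in> relator_subgroup" for f g
    unfolding tensor_coset_eq
  proof clarify
    fix b assume "b \<in> relator_subgroup"
    then show "\<exists>b'. b + f = b' + g \<and> b' \<in> relator_subgroup"
      using relator_subgroup_add[of b "f - g"] that by (intro exI[of _ "b + (f - g)"]) auto
  qed
  assume "f - g \<in> relator_subgroup"
  then show "tensor_coset f = tensor_coset g" using sub[of f g] sub[of g f] relator_subgroup_uminus[of "f - g"] by auto
qed

definition one_tensor :: "('g free_word \<Rightarrow>\<^sub>0 complex) \<Rightarrow>
    (('g free_word \<Rightarrow>\<^sub>0 complex) set \<times> complex \<Rightarrow>\<^sub>0 int) set" where
  "one_tensor p = tensor_coset (pure_tensor p 1)"

lemma pure_tensor_diff: "pure_tensor (p - q) c - (pure_tensor p c - pure_tensor q c) \<in> relator_subgroup"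
  using relator_subgroup_uminus[OF pure_tensor_add[of "p - q" q c]] by (simp add: algebra_simps)

text \<open>The second factor is one-dimensional, so its scalar can be moved to the first factor, and then sums
are collected there: every tensor has the form $u \otimes 1$.\<close>

lemma pure_tensor_representative:
  assumes "f \<in> carrier free_tensors"
  shows "\<exists>p. f - pure_tensor p 1 \<in> relator_subgroup"
proof -
  have "Poly_Mapping.keys f \<subseteq> carrier (UEA L) \<times> carrier N" using assms by simp
  then show ?thesis
  proof (induction f rule: frag_induction)
    case zero
    have "0 - pure_tensor 0 1 \<in> relator_subgroup" using pure_tensor_add[of 0 0 1] by simp
    then show ?case by blast
  next
    case (one x)
    then obtain p c where "x = (uea_class L p, c)" by (auto simp: UEA_L)
    then have "frag_of x - pure_tensor (p * free_scalar c) 1 \<in> relator_subgroup"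
      using relator_subgroup_uminus[OF pure_tensor_scalar[of p c]] by (simp add: pure_tensor_def)
    then show ?case by blast
  next
    case (diff a b)
    then obtain p q where "a - pure_tensor p 1 \<in> relator_subgroup" "b - pure_tensor q 1 \<in> relator_subgroup" by blast
    then have "(a - pure_tensor p 1) - (b - pure_tensor q 1) - (pure_tensor (p - q) 1 - (pure_tensor p 1 - pure_tensor q 1)) \<in> relator_subgroup"
      by (intro relator_subgroup_diff[OF relator_subgroup_diff] pure_tensor_diff)
    then have "(a - b) - pure_tensor (p - q) 1 \<in> relator_subgroup" by (simp add: algebra_simps)
    then show ?case by blast
  qed
qed

lemma carrier_induced: "carrier (induced_group L H N) = range one_tensor"
proof (intro equalityI subsetI)
  fix X assume "X \<in> carrier (induced_group L H N)"
  then obtain f where f: "f \<in> carrier free_tensors" "X = tensor_coset f"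
    unfolding induced_group_def tensor_group_def FactGroup_def RCOSETS_def tensor_coset_def induced_subgroup_def by auto
  with pure_tensor_representative[OF f(1)] show "X \<in> range one_tensor" by (auto simp: one_tensor_def tensor_coset_eq_iff)
next
  fix X assume "X \<in> range one_tensor"
  then obtain p where "X = tensor_coset (pure_tensor p 1)" by (auto simp: one_tensor_def)
  then show "X \<in> carrier (induced_group L H N)"
    using pure_tensor_carrier[of p 1]
    unfolding induced_group_def tensor_group_def FactGroup_def RCOSETS_def tensor_coset_def induced_subgroup_def by auto
qed

text \<open>Left multiplication maps relations to relations, so it is well defined on cosets.\<close>

lemma induced_act_one_tensor: "induced_act L H N (uea_class L q) (one_tensor p) = one_tensor (q * p)"
proof -
  define \<Phi> where "\<Phi> = frag_extend (\<lambda>(a, n :: complex). frag_of (uea_class L q \<otimes>\<^bsub>UEA L\<^esub> a, n))"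
  have \<Phi>_pure_tensor: "\<Phi> (pure_tensor p c) = pure_tensor (q * p) c" for p c
    by (simp add: \<Phi>_def pure_tensor_def UEA_L)
  have \<Phi>_diff: "\<Phi> (f - g) = \<Phi> f - \<Phi> g" for f g
    by (simp add: \<Phi>_def frag_extend_diff)
  have \<Phi>_R: "\<Phi> f \<in> tensor_relators" if "f \<in> tensor_relators" for f
    using that
  proof (cases rule: tensor_relators_cases)
      case (1 p' q' c)
      then show ?thesis by (simp add: \<Phi>_diff \<Phi>_pure_tensor distrib_left tensor_relators_intros(1))
    next
      case (2 p' c d)
      then show ?thesis by (simp add: \<Phi>_diff \<Phi>_pure_tensor tensor_relators_intros(2))
    next
      case (3 p r c)
      then have "\<Phi> f = pure_tensor ((q * p) * r) c - pure_tensor (q * p) (free_act N r c)"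
        by (simp add: \<Phi>_diff \<Phi>_pure_tensor mult.assoc)
      then show ?thesis using tensor_relators_intros(3)[OF 3(2)] by simp
  qed
  have \<Phi>_B: "\<Phi> f \<in> relator_subgroup" if "f \<in> relator_subgroup" for f
    using that unfolding induced_subgroup_eq
  proof (induction f rule: generate.induct)
    case one
    then show ?case using relator_subgroup_0 by (simp add: \<Phi>_def induced_subgroup_eq)
  next
    case (incl f)
    show ?case by (rule generate.incl[OF \<Phi>_R[OF incl]])
  next
    case (inv f)
    have "f \<in> carrier free_tensors" using tensor_relators_carrier inv by blast
    then have "inv\<^bsub>free_tensors\<^esub> f = 0 - f" by simp
    then have "\<Phi> (inv\<^bsub>free_tensors\<^esub> f) = 0 - \<Phi> f" using \<Phi>_diff[of 0 f] by (simp add: \<Phi>_def)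
    moreover have "\<Phi> f \<in> relator_subgroup" by (rule tensor_relators_subgroup[OF \<Phi>_R[OF inv]])
    ultimately show ?case using relator_subgroup_uminus[of "\<Phi> f"] by (simp add: induced_subgroup_eq)
  next
    case (eng f g)
    then show ?case using relator_subgroup_add[of "\<Phi> f" "\<Phi> g"] by (simp add: \<Phi>_def frag_extend_add induced_subgroup_eq)
  qed
  have "tensor_coset (\<Phi> f) = one_tensor (q * p)" if "f \<in> one_tensor p" for f
  proof -
    from that obtain b where b: "b \<in> relator_subgroup" "f - pure_tensor p 1 = b" by (auto simp: one_tensor_def tensor_coset_eq)
    then have "\<Phi> f - pure_tensor (q * p) 1 = \<Phi> b" using \<Phi>_diff[of f "pure_tensor p 1"] \<Phi>_pure_tensor by simp
    then show ?thesis using \<Phi>_B[OF b(1)] by (simp add: one_tensor_def tensor_coset_eq_iff)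
  qed
  moreover have "pure_tensor p 1 \<in> one_tensor p" unfolding one_tensor_def tensor_coset_eq by (intro CollectI exI[of _ 0]) simp
  ultimately have "(\<Union>f\<in>one_tensor p. tensor_coset (\<Phi> f)) = one_tensor (q * p)" by blast
  then show ?thesis by (simp add: induced_act_def tensor_coset_def \<Phi>_def)
qed

sublocale induced: presentation "induced_module L H N" one_tensor
proof
  show "carrier (induced_module L H N) = range one_tensor"
    by (simp add: induced_module_def carrier_induced)
  have "tensor_coset (pure_tensor 0 1) = tensor_coset 0"
    unfolding tensor_coset_eq_iff using relator_subgroup_uminus[OF pure_tensor_add[of 0 0 1]] by simp
  also have "\<dots> = relator_subgroup" by (auto simp: tensor_coset_eq)
  finally show "\<zero>\<^bsub>induced_module L H N\<^esub> = one_tensor 0"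
    by (simp add: induced_module_def one_tensor_def induced_group_def tensor_group_def FactGroup_def induced_subgroup_def)
  show "one_tensor p \<oplus>\<^bsub>induced_module L H N\<^esub> one_tensor q = one_tensor (p + q)" for p q
  proof -
    have "one_tensor p \<oplus>\<^bsub>induced_module L H N\<^esub> one_tensor q = {f + g | f g. f \<in> one_tensor p \<and> g \<in> one_tensor q}"
      by (auto simp: induced_module_def induced_group_def tensor_group_def FactGroup_def set_mult_def)
    also have "\<dots> = tensor_coset (pure_tensor p 1 + pure_tensor q 1)"
    proof (intro equalityI subsetI)
      fix x assume "x \<in> {f + g | f g. f \<in> one_tensor p \<and> g \<in> one_tensor q}"
      then obtain b b' where "x = (b + pure_tensor p 1) + (b' + pure_tensor q 1)" "b \<in> relator_subgroup" "b' \<in> relator_subgroup"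
        by (auto simp: one_tensor_def tensor_coset_eq)
      then show "x \<in> tensor_coset (pure_tensor p 1 + pure_tensor q 1)"
        unfolding tensor_coset_eq by (intro CollectI exI[of _ "b + b'"]) (auto simp: relator_subgroup_add)
    next
      fix x assume "x \<in> tensor_coset (pure_tensor p 1 + pure_tensor q 1)"
      then obtain b where "x = (b + pure_tensor p 1) + (0 + pure_tensor q 1)" "b \<in> relator_subgroup" by (auto simp: tensor_coset_eq add.assoc)
      then show "x \<in> {f + g | f g. f \<in> one_tensor p \<and> g \<in> one_tensor q}"
        unfolding one_tensor_def tensor_coset_eq using relator_subgroup_0 by blast
    qed
    also have "\<dots> = one_tensor (p + q)"
      unfolding one_tensor_def tensor_coset_eq_iff using relator_subgroup_uminus[OF pure_tensor_add[of p q 1]] by (simp add: algebra_simps)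
    finally show ?thesis .
  qed
  show "c \<odot>\<^bsub>induced_module L H N\<^esub> one_tensor p = one_tensor (scale c p)" for c p
    by (simp add: induced_module_def induced_act_one_tensor scale_eq_mult)
  show "act (induced_module L H N) x (one_tensor p) = one_tensor (free_gen x * p)" for x p
    by (simp add: induced_module_def induced_act_one_tensor)
qed

lemma uea_ideal_ker: "uea_ideal L \<subseteq> induced.ker"
  using uea_class_eq[of _ 0] by (auto simp: induced.ker_def one_tensor_def pure_tensor_def)

lemma character_ker:
  assumes "x \<in> H"
  shows "free_gen x - free_scalar (\<chi> x) \<in> induced.ker"
proof -
  have "free_gen x \<in> free_H" using assms by (auto simp: free_gen_def)
  from pure_tensor_balanced[OF this, of 1 1] have "pure_tensor (free_gen x) 1 - pure_tensor 1 (\<chi> x) \<in> relator_subgroup"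
    using assms by simp
  from relator_subgroup_diff[OF this pure_tensor_scalar[of 1 "\<chi> x"]] have "pure_tensor (free_gen x) 1 - pure_tensor (free_scalar (\<chi> x)) 1 \<in> relator_subgroup"
    by simp
  then show ?thesis unfolding induced.eq_iff[symmetric] one_tensor_def tensor_coset_eq_iff .
qed

text \<open>Behind this is the homomorphism from the induced module to \<open>V\<close> that sends $u \otimes c$ to $c u w$. It
exists because $(u, c) \mapsto c u w$ respects the relations of the tensor product, the balancing relation by the
assumption that \<open>H\<close> acts on \<open>w\<close> through \<open>\<chi>\<close>.\<close>

lemma frobenius_reciprocity:
  assumes "lie_module L V" "w \<in> carrier V" "\<And>x. x \<in> H \<Longrightarrow> act V x w = \<chi> x \<odot>\<^bsub>V\<^esub> w"
    and "one_tensor p = one_tensor q"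
  shows "free_act V p w = free_act V q w"
proof -
  interpret V: lie_module L V by fact
  have closed: "free_act V p w \<in> carrier V" for p
    using V.free_act_closed[OF _ assms(2), of p] by (simp only: F_L UNIV_I)
  have uea_act: "uea_act V (uea_class L p) w = free_act V p w" for p
    using V.uea_act_class[OF _ assms(2), of p] by (simp only: F_L UNIV_I)
  have f_add: "free_act V (p + q) w = free_act V p w \<oplus>\<^bsub>V\<^esub> free_act V q w" for p q
    using V.free_act_add[OF _ _ assms(2), of p q] by (simp only: F_L UNIV_I)
  have f_mult: "free_act V (p * q) v = free_act V p (free_act V q v)" if "v \<in> carrier V" for p q v
    using V.free_act_mult[OF _ _ that, of p q] by (simp only: F_L UNIV_I)
  have foldr_H: "foldr (act V) xs w = foldr (act N) xs 1 \<odot>\<^bsub>V\<^esub> w" if "set xs \<subseteq> H" for xs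
    using that
  proof (induction xs)
    case (Cons x xs)
    define k where "k = foldr (act N) xs 1"
    have "set xs \<subseteq> H" using Cons.prems by simp
    from Cons.IH[OF this] have IH: "foldr (act V) xs w = k \<odot>\<^bsub>V\<^esub> w" unfolding k_def .
    have "act V x (k \<odot>\<^bsub>V\<^esub> w) = (\<chi> x * k) \<odot>\<^bsub>V\<^esub> w"
      using V.act_smult_right[of x w k] assms(2,3) Cons.prems
      by (simp add: carrier_L V.M.smult_assoc1[simplified, symmetric] mult.commute[of "\<chi> x"])
    then show ?case
      unfolding foldr_Cons o_apply IH k_def[symmetric] by (simp only: N_simps(5))
  qed (use assms(2) in \<open>simp add: V.M.smult_one[simplified]\<close>)
  have f_H: "free_act V r w = free_act N r 1 \<odot>\<^bsub>V\<^esub> w" if "r \<in> free_H" for r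
    using that
  proof (induction r rule: free_algebra_induct)
    case zero
    then show ?case using assms(2) by (simp add: V.M.smult_l_null[simplified])
  next
    case (single u c)
    then show ?case
      using V.free_act_single[of u w c] N.free_act_single[of u 1 c] assms(2) foldr_H[of "letters u"]
      by (simp add: carrier_L V.M.smult_assoc1[simplified])
  next
    case (add p q)
    then show ?case
      using f_add[of p q] N.free_act_add[of p q 1] assms(2)
      by (simp add: V.M.smult_l_distr[simplified] del: free_algebra_simps(1))
  qed
  have N_r: "free_act N r c = c * free_act N r 1" if "r \<in> free_H" for r c
    using N.free_act_smult[of r 1 c] that by (simp del: free_algebra_simps(1))
  define \<phi> where "\<phi> = (\<lambda>(X, c). c \<odot>\<^bsub>V\<^esub> uea_act V X w)"
  have \<phi>: "\<phi> (uea_class L p, c) = c \<odot>\<^bsub>V\<^esub> free_act V p w" for p c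
    by (simp add: \<phi>_def uea_act)
  have "\<phi> ` (carrier (UEA L) \<times> carrier N) \<subseteq> carrier (add_monoid V)"
    using closed by (auto simp: UEA_L \<phi> V.M.smult_closed[simplified])
  then obtain h where h: "h \<in> hom free_tensors (add_monoid V)"
    "\<And>x. x \<in> carrier (UEA L) \<times> carrier N \<Longrightarrow> h (frag_of x) = \<phi> x"
    by (rule comm_group.free_Abelian_group_universal[OF V.M.a_comm_group]) blast
  interpret h: group_hom free_tensors "add_monoid V" h
    by (intro group_hom.intro group_hom_axioms.intro group_free_Abelian_group V.M.a_group h(1))
  have h_add: "h (f + g) = h f \<oplus>\<^bsub>V\<^esub> h g" if "f \<in> carrier free_tensors" "g \<in> carrier free_tensors" for f g
    using h.hom_mult[OF that] by simp
  have h_closed: "h f \<in> carrier V" if "f \<in> carrier free_tensors" for f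
    using h.hom_closed[OF that] by simp
  have h_eq: "h f = h g" if "f \<in> carrier free_tensors" "g \<in> carrier free_tensors" "h (f - g) = \<zero>\<^bsub>V\<^esub>" for f g
    using h_add[OF free_tensors_diff[OF that(1,2)] that(2)] that h_closed[OF that(2)] by simp
  have h_diff: "h (f - g) = h f \<ominus>\<^bsub>V\<^esub> h g" if "f \<in> carrier free_tensors" "g \<in> carrier free_tensors" for f g
    using h_add[OF free_tensors_diff[OF that] that(2)] h_closed that free_tensors_diff[OF that]
    by (simp add: V.M.minus_eq V.M.a_assoc V.M.r_neg)
  have h_pure_tensor: "h (pure_tensor p c) = c \<odot>\<^bsub>V\<^esub> free_act V p w" for p c
    unfolding pure_tensor_def using h(2)[of "(uea_class L p, c)"] by (simp add: UEA_L \<phi>)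
  have h_pure_tensor_closed: "h (pure_tensor p c) \<in> carrier V" for p c
    using h_closed[OF pure_tensor_carrier] .
  have cancel_add: "(a \<oplus>\<^bsub>V\<^esub> b) \<ominus>\<^bsub>V\<^esub> a \<ominus>\<^bsub>V\<^esub> b = \<zero>\<^bsub>V\<^esub>"
    if "a \<in> carrier V" "b \<in> carrier V" for a b
  proof -
    have "(a \<oplus>\<^bsub>V\<^esub> b) \<ominus>\<^bsub>V\<^esub> a \<ominus>\<^bsub>V\<^esub> b = (a \<oplus>\<^bsub>V\<^esub> b) \<ominus>\<^bsub>V\<^esub> (a \<oplus>\<^bsub>V\<^esub> b)"
      using that by (simp add: V.M.minus_eq V.M.minus_add V.M.a_assoc)
    then show ?thesis
      using that by (simp add: V.M.minus_eq V.M.r_neg)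
  qed
  have "h f = \<zero>\<^bsub>V\<^esub>" if "f \<in> tensor_relators" for f
    using that
  proof (cases rule: tensor_relators_cases)
      case (1 p q c)
      have "h (pure_tensor (p + q) c) = h (pure_tensor p c) \<oplus>\<^bsub>V\<^esub> h (pure_tensor q c)"
        using closed by (simp add: h_pure_tensor f_add V.M.smult_r_distr[simplified])
      then show ?thesis
        unfolding 1 h_diff[OF free_tensors_diff[OF pure_tensor_carrier pure_tensor_carrier] pure_tensor_carrier] h_diff[OF pure_tensor_carrier pure_tensor_carrier]
        using cancel_add[OF h_pure_tensor_closed h_pure_tensor_closed] by simp
    next
      case (2 p c d)
      have "h (pure_tensor p (c + d)) = h (pure_tensor p c) \<oplus>\<^bsub>V\<^esub> h (pure_tensor p d)"
        using closed by (simp add: h_pure_tensor V.M.smult_l_distr[simplified])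
      then show ?thesis
        unfolding 2 h_diff[OF free_tensors_diff[OF pure_tensor_carrier pure_tensor_carrier] pure_tensor_carrier] h_diff[OF pure_tensor_carrier pure_tensor_carrier]
        using cancel_add[OF h_pure_tensor_closed h_pure_tensor_closed] by simp
    next
      case (3 p r c)
      have s: "free_act V p (c \<odot>\<^bsub>V\<^esub> w) = c \<odot>\<^bsub>V\<^esub> free_act V p w" for p c
        using V.free_act_smult[OF _ assms(2), of p c] by (simp only: F_L UNIV_I)
      have "h (pure_tensor (p * r) c) = h (pure_tensor p (free_act N r c))"
        using closed N_r[OF 3(2), of c] assms(2)
        by (simp add: h_pure_tensor f_mult f_H[OF 3(2)] s V.M.smult_assoc1[simplified, symmetric] mult.commute)
      then show ?thesis
        unfolding 3(1) h_diff[OF pure_tensor_carrier pure_tensor_carrier] using h_pure_tensor_closed by (simp add: V.M.minus_eq V.M.r_neg)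
  qed
  then have "tensor_relators \<subseteq> kernel free_tensors (add_monoid V) h"
    using tensor_relators_carrier by (intro subsetI) (simp add: kernel_def subset_iff del: carrier_free_Abelian_group_iff N_simps)
  then have "relator_subgroup \<subseteq> kernel free_tensors (add_monoid V) h"
    unfolding induced_subgroup_eq
    by (rule group.generate_subgroup_incl[OF group_free_Abelian_group _ h.subgroup_kernel])
  then have h_B: "h f = \<zero>\<^bsub>V\<^esub>" if "f \<in> relator_subgroup" for f
    using that by (auto simp: kernel_def)
  have "h (pure_tensor p 1) = h (pure_tensor q 1)"
    using assms(4) by (intro h_eq pure_tensor_carrier h_B) (simp add: one_tensor_def tensor_coset_eq_iff)
  then show ?thesis
    using closed by (simp add: h_pure_tensor V.M.smult_one[simplified])
qed

end

section \<open>The positive subalgebra and pulling back along \<open>rho\<close>\<close>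

lemma basis_lie_simps:
  "carrier (basis_lie br) = UNIV" "\<zero>\<^bsub>basis_lie br\<^esub> = 0" "f \<oplus>\<^bsub>basis_lie br\<^esub> g = f + g"
  "c \<odot>\<^bsub>basis_lie br\<^esub> f = scale c f"
  by (simp_all add: basis_lie_def)

lemma submodule_iff_subspace:
  assumes "lie_algebra (basis_lie br)"
  shows "submodule K complex_ring (basis_lie br) \<longleftrightarrow> VS.subspace K"
proof -
  interpret lie_algebra "basis_lie br" by fact
  have inv: "\<ominus>\<^bsub>basis_lie br\<^esub> f = - f" for f
    by (rule minus_equality) (simp_all add: basis_lie_simps)
  show ?thesis
  proof
    assume K: "submodule K complex_ring (basis_lie br)"
    show "VS.subspace K"
      using submoduleE[OF K] subgroup.one_closed[OF submodule.axioms(1)[OF K]]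
      by (simp add: VS.subspace_def basis_lie_simps)
  next
    assume K: "VS.subspace K"
    show "submodule K complex_ring (basis_lie br)"
      using VS.subspace_0[OF K] VS.subspace_add[OF K] VS.subspace_scale[OF K] VS.subspace_neg[OF K]
      by (intro submoduleI) (auto simp: basis_lie_simps inv)
  qed
qed

lemma lin_span_eq_span:
  assumes "lie_algebra (basis_lie br)"
  shows "lin_span (basis_lie br) S = VS.span S"
  unfolding lin_span_def submodule_iff_subspace[OF assms] VS.span_def hull_def by (simp add: Inter_eq)

lemma n_plus_eq: "n_plus = VS.span (vir_d ` {0<..})"
proof -
  have "{k::int. k > 0} = {0<..}" by auto
  then show ?thesis
    using lin_span_eq_span[OF lie_algebra_Virasoro[unfolded Virasoro_def]]
    by (simp add: n_plus_def Virasoro_def)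
qed

lemma n_plus_witt_eq: "n_plus_witt = VS.span (witt_d ` {0<..})"
proof -
  have "{k::int. k > 0} = {0<..}" by auto
  then show ?thesis
    using lin_span_eq_span[OF lie_algebra_Witt[unfolded Witt_def]]
    by (simp add: n_plus_witt_def Witt_def)
qed

lemma Virasoro_simps [simp]:
  "carrier Virasoro = UNIV" "\<zero>\<^bsub>Virasoro\<^esub> = 0" "f \<oplus>\<^bsub>Virasoro\<^esub> g = f + g" "c \<odot>\<^bsub>Virasoro\<^esub> f = scale c f"
  by (simp_all add: Virasoro_def basis_lie_simps)

lemma Witt_simps [simp]:
  "carrier Witt = UNIV" "\<zero>\<^bsub>Witt\<^esub> = 0" "f \<oplus>\<^bsub>Witt\<^esub> g = f + g" "c \<odot>\<^bsub>Witt\<^esub> f = scale c f"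
  by (simp_all add: Witt_def basis_lie_simps)

lemma bracket_Virasoro:
  "bracket Virasoro (vir_d k) (vir_d j) = scale (of_int (j - k)) (vir_d (k + j))
     + (if j = - k then scale ((of_int k ^ 3 - of_int k) / 12) vir_z else 0)"
  by (simp add: Virasoro_def basis_lie_def vir_d_def)

lemma bracket_Virasoro_z: "bracket Virasoro f vir_z = 0" "bracket Virasoro vir_z f = 0"
proof -
  have z: "vir_basis_bracket i VirZ = 0" for i by (cases i) auto
  have z': "vir_basis_bracket VirZ = (\<lambda>_. 0)" by auto
  show "bracket Virasoro f vir_z = 0" "bracket Virasoro vir_z f = 0"
    by (simp_all add: Virasoro_def basis_lie_def vir_z_def z z')
qed

lemma bracket_Witt: "bracket Witt (witt_d k) (witt_d j) = scale (of_int (j - k)) (witt_d (k + j))"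
  by (simp add: Witt_def basis_lie_def witt_d_def)

lemma rho_simps [simp]: "rho (vir_d k) = witt_d k" "rho vir_z = 0" "rho 0 = 0"
  "rho (f + g) = rho f + rho g" "rho (scale c f) = scale c (rho f)"
  by (simp_all add: rho_def vir_d_def vir_z_def)

lemma rho_n_plus: "f \<in> n_plus \<Longrightarrow> rho f \<in> n_plus_witt"
proof -
  have "VS.subspace {f. rho f \<in> n_plus_witt}"
    by (auto simp: VS.subspace_def n_plus_witt_eq VS.span_zero VS.span_add VS.span_scale)
  moreover have "vir_d ` {0<..} \<subseteq> {f. rho f \<in> n_plus_witt}"
    by (auto simp: n_plus_witt_eq intro: VS.span_base)
  ultimately show "f \<in> n_plus \<Longrightarrow> rho f \<in> n_plus_witt"
    unfolding n_plus_eq using VS.span_minimal by blast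
qed

lemma lie_algebra_subalgebra:
  assumes L: "lie_algebra L" and K: "submodule K complex_ring L"
    and br: "\<And>x y. x \<in> K \<Longrightarrow> y \<in> K \<Longrightarrow> bracket L x y \<in> K"
  shows "lie_algebra (L\<lparr>carrier := K\<rparr>)"
proof -
  interpret lie_algebra L by fact
  note sub = submoduleE[OF K]
  have zero: "\<zero>\<^bsub>L\<^esub> \<in> K" using subgroup.one_closed[OF submodule.axioms(1)[OF K]] by simp
  have "module complex_ring (L\<lparr>carrier := K\<rparr>)"
  proof (rule moduleI[OF cring_complex_ring])
    show "abelian_group (L\<lparr>carrier := K\<rparr>)"
    proof (rule abelian_groupI)
      fix x assume "x \<in> carrier (L\<lparr>carrier := K\<rparr>)"
      then show "\<exists>y\<in>carrier (L\<lparr>carrier := K\<rparr>). y \<oplus>\<^bsub>L\<lparr>carrier := K\<rparr>\<^esub> x = \<zero>\<^bsub>L\<lparr>carrier := K\<rparr>\<^esub>"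
        using sub(1,3) by (intro bexI[of _ "\<ominus>\<^bsub>L\<^esub> x"]) (auto simp: l_neg subset_iff)
    qed (use sub zero in \<open>auto simp: subset_iff a_ac\<close>)
  qed (use sub in \<open>auto simp: subset_iff smult_l_distr[simplified] smult_r_distr[simplified]
      smult_assoc1[simplified] smult_one[simplified]\<close>)
  then show ?thesis
    by (rule lie_algebra.intro, unfold_locales)
      (use sub br in \<open>auto simp: subset_iff bracket_add_left bracket_add_right bracket_smult_left
        bracket_smult_right bracket_self jacobi\<close>)
qed

text \<open>Both arguments are reduced to basis vectors, by linearity in one argument at a time.\<close>

lemma bracket_n_plus:
  assumes "x \<in> n_plus" "y \<in> n_plus"
  shows "bracket Virasoro x y \<in> n_plus"
proof -
  interpret lie_algebra Virasoro by (rule lie_algebra_Virasoro)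
  have zero: "bracket Virasoro x 0 = 0" "bracket Virasoro 0 x = 0" for x
    using bracket_smult_right[of x 0 0] bracket_smult_left[of 0 x 0] by simp_all
  have 1: "bracket Virasoro (vir_d k) y \<in> n_plus" if "k > 0" "y \<in> n_plus" for k y
  proof -
    have "VS.subspace {y. bracket Virasoro (vir_d k) y \<in> n_plus}"
      using bracket_add_right[of _ _ "vir_d k"] bracket_smult_right[of "vir_d k"]
      by (auto simp: VS.subspace_def n_plus_eq zero VS.span_zero VS.span_add VS.span_scale)
    moreover have "vir_d ` {0<..} \<subseteq> {y. bracket Virasoro (vir_d k) y \<in> n_plus}"
      using that(1) by (auto simp: bracket_Virasoro n_plus_eq intro!: VS.span_scale VS.span_base[OF imageI])
    ultimately show ?thesis
      using that(2) VS.span_minimal unfolding n_plus_eq by blast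
  qed
  have "VS.subspace {x. bracket Virasoro x y \<in> n_plus}"
    using bracket_add_left[of _ _ y] bracket_smult_left[of _ y]
    by (auto simp: VS.subspace_def n_plus_eq zero VS.span_zero VS.span_add VS.span_scale)
  moreover have "vir_d ` {0<..} \<subseteq> {x. bracket Virasoro x y \<in> n_plus}"
    using 1 assms(2) by auto
  ultimately show ?thesis
    using assms(1) VS.span_minimal unfolding n_plus_eq by blast
qed

lemma lie_algebra_n_plus: "lie_algebra (Virasoro\<lparr>carrier := n_plus\<rparr>)"
proof (rule lie_algebra_subalgebra[OF lie_algebra_Virasoro _ bracket_n_plus])
  show "submodule n_plus complex_ring Virasoro"
    using submodule_iff_subspace[OF lie_algebra_Virasoro[unfolded Virasoro_def]]
    by (simp add: Virasoro_def n_plus_eq)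
qed

lemma lie_module_one_dim_rep:
  assumes L: "lie_algebra L"
    and \<chi>: "\<And>x y. \<lbrakk>x \<in> carrier L; y \<in> carrier L\<rbrakk> \<Longrightarrow> \<chi> (x \<oplus>\<^bsub>L\<^esub> y) = \<chi> x + \<chi> y"
      "\<And>c x. x \<in> carrier L \<Longrightarrow> \<chi> (c \<odot>\<^bsub>L\<^esub> x) = c * \<chi> x"
      "\<And>x y. \<lbrakk>x \<in> carrier L; y \<in> carrier L\<rbrakk> \<Longrightarrow> \<chi> (bracket L x y) = 0"
  shows "lie_module L (one_dim_rep \<chi>)"
proof -
  interpret lie_algebra L by fact
  let ?N = "one_dim_rep \<chi>"
  have "module complex_ring ?N"
  proof (rule moduleI[OF cring_complex_ring])
    show "abelian_group ?N"
    proof (rule abelian_groupI)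
      fix x
      show "\<exists>y\<in>carrier ?N. y \<oplus>\<^bsub>?N\<^esub> x = \<zero>\<^bsub>?N\<^esub>"
        by (rule bexI[of _ "- x"]) (auto simp: one_dim_rep_def)
    qed (auto simp: one_dim_rep_def)
  qed (auto simp: one_dim_rep_def algebra_simps)
  then interpret N: module complex_ring ?N .
  have "\<ominus>\<^bsub>?N\<^esub> a = - a" for a
    by (rule N.minus_equality) (auto simp: one_dim_rep_def)
  then have minus: "a \<ominus>\<^bsub>?N\<^esub> b = a - b" for a b
    by (simp add: N.minus_eq) (simp add: one_dim_rep_def)
  show ?thesis
    by unfold_locales (auto simp: minus, auto simp: one_dim_rep_def \<chi> algebra_simps)
qed

definition pullback :: "('g \<Rightarrow> 'h) \<Rightarrow> ('h, 'v) lie_rep \<Rightarrow> ('g, 'v) lie_rep" where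
  "pullback f V = \<lparr>carrier = carrier V, monoid.mult = monoid.mult V, one = one V,
     ring.zero = \<zero>\<^bsub>V\<^esub>, add = add V, module.smult = module.smult V, act = (\<lambda>x. act V (f x))\<rparr>"

lemma pullback_simps [simp]:
  "carrier (pullback f V) = carrier V" "\<zero>\<^bsub>pullback f V\<^esub> = \<zero>\<^bsub>V\<^esub>" "add (pullback f V) = add V"
  "module.smult (pullback f V) = module.smult V" "act (pullback f V) x = act V (f x)"
  by (simp_all add: pullback_def)

lemma lie_module_pullback:
  assumes "lie_algebra L" "lie_module L' V" "f \<in> lie_hom L L'"
  shows "lie_module L (pullback f V)"
proof -
  interpret L: lie_algebra L by fact
  interpret V: lie_module L' V by fact
  have "module complex_ring (pullback f V)"
  proof (rule moduleI[OF cring_complex_ring])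
    show "abelian_group (pullback f V)"
    proof (rule abelian_groupI)
      fix x assume "x \<in> carrier (pullback f V)"
      then show "\<exists>y\<in>carrier (pullback f V). y \<oplus>\<^bsub>pullback f V\<^esub> x = \<zero>\<^bsub>pullback f V\<^esub>"
        by (intro bexI[of _ "\<ominus>\<^bsub>V\<^esub> x"]) (auto simp: V.M.l_neg)
    qed (auto simp: V.M.a_ac)
  qed (auto simp: V.M.smult_l_distr[simplified] V.M.smult_r_distr[simplified]
      V.M.smult_assoc1[simplified] V.M.smult_one[simplified] V.M.smult_closed[simplified])
  then interpret P: module complex_ring "pullback f V" .
  have "\<ominus>\<^bsub>pullback f V\<^esub> b = \<ominus>\<^bsub>V\<^esub> b" if "b \<in> carrier V" for b
    by (rule P.minus_equality) (use that in \<open>auto simp: V.M.l_neg\<close>)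
  then have minus: "a \<ominus>\<^bsub>pullback f V\<^esub> b = a \<ominus>\<^bsub>V\<^esub> b" if "b \<in> carrier V" for a b
    using that by (simp add: a_minus_def)
  have f: "f x \<in> carrier L'" if "x \<in> carrier L" for x
    using assms(3) that by (auto simp: lie_hom_def)
  show ?thesis
    by unfold_locales
      (use assms(3) in \<open>auto simp: lie_hom_def minus f V.act_closed V.act_add_left V.act_add_right
        V.act_smult_left V.act_smult_right V.act_bracket\<close>)
qed

section \<open>Whittaker modules\<close>

text \<open>The normal form argument applies to every left ideal of the free algebra on the Virasoro algebra
that contains the relations. The operators $d_k$ alone generate the free algebra modulo such an ideal:
a letter is a linear combination of the $d_k$ and $z$, the relations make letters depend linearly on
the element of the Lie algebra, and a word that starts with $z$ is zero.\<close>

lemma whittaker_presentation_ker: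
  fixes T :: "(vir free_word \<Rightarrow>\<^sub>0 complex) \<Rightarrow> 'v"
  assumes "presentation M T"
  defines "K \<equiv> presentation.ker T"
  assumes uea: "uea_ideal Virasoro \<subseteq> K" and z: "\<And>p. free_gen vir_z * p \<in> K"
    and d: "\<And>k. k > 0 \<Longrightarrow> free_gen (vir_d k) - free_scalar (\<phi> k) \<in> K"
    and \<phi>: "\<And>k. k \<ge> 3 \<Longrightarrow> \<phi> k = 0" "\<phi> 2 \<noteq> 0"
  shows "whittaker_presentation scale (\<lambda>k p. free_gen (vir_d k) * p) K 1 \<phi>"
proof -
  interpret presentation M T by fact
  interpret I: ideal "uea_ideal Virasoro" "free_algebra (carrier Virasoro)"
    by (rule ideal_uea_ideal[OF lie_algebra_Virasoro])
  note sub = subspace_ker[folded K_def]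
  have rel: "r * p \<in> K" if "r \<in> uea_rels Virasoro" for r p
  proof -
    have "r \<in> uea_ideal Virasoro" using that uea_ideal_rels[OF lie_algebra_Virasoro] by blast
    from I.I_r_closed[OF this, of p] show ?thesis using uea by auto
  qed
  have gen_add: "free_gen (x + y) * p - (free_gen x * p + free_gen y * p) \<in> K" for x y p
  proof -
    have "free_gen (x + y) - free_gen x - free_gen y \<in> uea_rels Virasoro"
      using Virasoro_simps unfolding uea_rels_def by (intro UnI1 CollectI exI[of _ x] exI[of _ y]) auto
    from rel[OF this, of p] show ?thesis by (simp add: algebra_simps)
  qed
  have gen_scale: "free_gen (scale c x) * p - scale c (free_gen x * p) \<in> K" for c x p
  proof -
    have "free_gen (scale c x) - free_scalar c * free_gen x \<in> uea_rels Virasoro"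
      unfolding uea_rels_def by (rule UnI1, rule UnI2, intro CollectI exI[of _ x] exI[of _ c]) auto
    from rel[OF this, of p] show ?thesis by (simp add: algebra_simps scale_eq_mult)
  qed
  have gen_bracket: "free_gen x * (free_gen y * p) - free_gen y * (free_gen x * p)
      - free_gen (bracket Virasoro x y) * p \<in> K" for x y p
  proof -
    have "free_gen x * free_gen y - free_gen y * free_gen x - free_gen (bracket Virasoro x y) \<in> uea_rels Virasoro"
      unfolding uea_rels_def by (rule UnI2, intro CollectI exI[of _ x] exI[of _ y]) auto
    from rel[OF this, of p] show ?thesis by (simp add: algebra_simps)
  qed
  have gen_z: "free_gen (scale c vir_z) * p \<in> K" for c p
    using VS.subspace_add[OF sub gen_scale[of c vir_z p] VS.subspace_scale[OF sub z[of p], of c]] by simp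
  note K_add = VS.subspace_add[OF sub]
  show ?thesis
  proof (intro whittaker_presentation.intro whittaker_presentation_axioms.intro)
    show "vector_space (scale :: complex \<Rightarrow> (vir free_word \<Rightarrow>\<^sub>0 complex) \<Rightarrow> _)"
      by (rule VS.vector_space_axioms)
    show "VS.subspace K" by (rule sub)
    show "free_gen (vir_d k) * x \<in> K" if "x \<in> K" for k x
      using gen_mult_ker that unfolding K_def by blast
    show "free_gen (vir_d k) * 1 - scale (\<phi> k) 1 \<in> K" if "k > 0" for k
      using d[OF that] by (simp add: scale_eq_mult)
    show "free_gen (vir_d k) * (free_gen (vir_d j) * x) - free_gen (vir_d j) * (free_gen (vir_d k) * x)
        - scale (of_int (j - k)) (free_gen (vir_d (k + j)) * x) \<in> K" for k j x
    proof -
      define c' :: complex where "c' = (if j = - k then (of_int k ^ 3 - of_int k) / 12 else 0)"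
      define c :: complex where "c = of_int (j - k)"
      have br: "bracket Virasoro (vir_d k) (vir_d j) = scale c (vir_d (k + j)) + scale c' vir_z"
        by (simp add: bracket_Virasoro c'_def c_def)
      \<comment> \<open>The bracket relation, then linearity of letters in the bracket \<open>c d\<^bsub>k+j\<^esub> + c' z\<close>, where the last term vanishes.\<close>
      have "(free_gen (vir_d k) * (free_gen (vir_d j) * x) - free_gen (vir_d j) * (free_gen (vir_d k) * x)
          - free_gen (scale c (vir_d (k + j)) + scale c' vir_z) * x)
        + (free_gen (scale c (vir_d (k + j)) + scale c' vir_z) * x
          - (free_gen (scale c (vir_d (k + j))) * x + free_gen (scale c' vir_z) * x))
        + free_gen (scale c' vir_z) * x
        + (free_gen (scale c (vir_d (k + j))) * x - scale c (free_gen (vir_d (k + j)) * x)) \<in> K"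
        using gen_bracket[of "vir_d k" "vir_d j" x] unfolding br
        by (rule K_add[OF K_add[OF K_add[OF _ gen_add] gen_z] gen_scale])
      then show ?thesis unfolding c_def[symmetric] by (simp add: algebra_simps)
    qed
    show "X = UNIV"
      if X: "VS.subspace X" "K \<subseteq> X" "1 \<in> X" "\<And>k x. x \<in> X \<Longrightarrow> free_gen (vir_d k) * x \<in> X" for X
    proof -
      note X_add = VS.subspace_add[OF X(1)] and X_scale = VS.subspace_scale[OF X(1)]
      have mod_K: "a \<in> X" if "a - b \<in> K" "b \<in> X" for a b
        using X_add[of "a - b" b] that X(2) by auto
      have gen: "free_gen x * p \<in> X" if "p \<in> X" for x p
      proof (induction x rule: basis_induct)
        case zero
        show ?case using gen_scale[of 0 0 p] X(2) by auto
      next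
        case (single i c)
        show ?case
        proof (cases i)
          case (VirD k)
          have "Poly_Mapping.single i c = scale c (vir_d k)" by (simp add: VirD vir_d_def)
          then show ?thesis using mod_K[OF gen_scale X_scale[OF X(4)[OF that]], of c] by simp
        next
          case VirZ
          have "Poly_Mapping.single i c = scale c vir_z" by (simp add: VirZ vir_z_def)
          then show ?thesis using gen_z X(2) by auto
        qed
      next
        case (add x y)
        then show ?case using mod_K[OF gen_add X_add] by blast
      qed
      have "Poly_Mapping.single (Word xs) c \<in> X" for xs and c :: complex
      proof (induction xs)
        case Nil
        have "Poly_Mapping.single (Word []) c = scale c (1 :: vir free_word \<Rightarrow>\<^sub>0 complex)"
          by (simp add: scale_eq_mult free_scalar_def zero_free_word_def)
        then show ?case using X_scale[OF X(3)] by simp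
      next
        case (Cons x xs)
        have "Poly_Mapping.single (Word (x # xs)) c = free_gen x * Poly_Mapping.single (Word xs) c"
          by (simp add: free_gen_def mult_single plus_free_word_def)
        then show ?case using gen[OF Cons.IH] by simp
      qed
      then have "Poly_Mapping.single u c \<in> X" for u c by (cases u) simp
      then have "p \<in> X" for p
        by (induction p rule: basis_induct) (use VS.subspace_0[OF X(1)] X_add in auto)
      then show ?thesis by blast
    qed
  qed (use \<phi> in \<open>simp_all add: distrib_left mult_scale\<close>)
qed

text \<open>The preimage in the free algebra of the submodule $z M_\psi$ consists of the elements that agree
with a multiple $z q$ modulo the kernel of the map to $M_\psi$. It is a left ideal since $z$ is central. The
last property is the universal property of $L_{\psi,0}$: a map out of $M_\psi$ to a module on which $z$
acts by zero kills $z M_\psi$.\<close>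

lemma presentation_L_psi_0:
  assumes "lie_module (Virasoro\<lparr>carrier := n_plus\<rparr>) (one_dim_rep \<chi>)"
  obtains Q where "presentation (L_psi_0 \<chi>) Q" "uea_ideal Virasoro \<subseteq> presentation.ker Q"
    "\<And>p. free_gen vir_z * p \<in> presentation.ker Q"
    "\<And>x. x \<in> n_plus \<Longrightarrow> free_gen x - free_scalar (\<chi> x) \<in> presentation.ker Q"
    "\<And>(V :: (vir, 'v) lie_rep) w p. \<lbrakk>lie_module Virasoro V; w \<in> carrier V; \<And>x. x \<in> n_plus \<Longrightarrow> act V x w = \<chi> x \<odot>\<^bsub>V\<^esub> w;
      \<And>v. v \<in> carrier V \<Longrightarrow> act V vir_z v = \<zero>\<^bsub>V\<^esub>; p \<in> presentation.ker Q\<rbrakk>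
      \<Longrightarrow> free_act V p w = \<zero>\<^bsub>V\<^esub>"
proof -
  interpret IC: induced_from_character Virasoro n_plus \<chi>
    by (rule induced_from_character.intro[OF lie_algebra_Virasoro Virasoro_simps(1) assms])
  define T where "T = IC.one_tensor"
  interpret M: presentation "M_psi \<chi>" T
    unfolding T_def M_psi_def by (rule IC.induced.presentation_axioms)
  have ker: "IC.induced.ker = M.ker" by (simp add: M.ker_def IC.induced.ker_def T_def)
  define N where "N = act (M_psi \<chi>) vir_z ` carrier (M_psi \<chi>)"
  have N_iff: "T p \<in> N \<longleftrightarrow> (\<exists>q. T p = T (free_gen vir_z * q))" for p
    by (auto simp: N_def M.carrier_eq M.act_eq image_iff)
  have subspace: "VS.subspace {p. T p \<in> N}"
    unfolding VS.subspace_def mem_Collect_eq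
  proof (intro conjI ballI allI)
    show "T 0 \<in> N" unfolding N_iff by (rule exI[of _ 0]) simp
    show "T (p + q) \<in> N" if pq: "p \<in> {p. T p \<in> N}" "q \<in> {p. T p \<in> N}" for p q
    proof -
      from pq obtain p' q' where "T p = T (free_gen vir_z * p')" "T q = T (free_gen vir_z * q')"
        by (auto simp: N_iff)
      then have "T (p + q) = T (free_gen vir_z * (p' + q'))"
        using M.add_eq[of p q] M.add_eq[of "free_gen vir_z * p'" "free_gen vir_z * q'"] by (simp add: distrib_left)
      then show ?thesis unfolding N_iff by blast
    qed
    show "T (scale c p) \<in> N" if p: "p \<in> {p. T p \<in> N}" for c p
    proof -
      from p obtain p' where "T p = T (free_gen vir_z * p')" by (auto simp: N_iff)
      then have "T (scale c p) = T (free_gen vir_z * scale c p')"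
        using M.smult_eq[of c p] M.smult_eq[of c "free_gen vir_z * p'"] by (simp add: mult_scale)
      then show ?thesis unfolding N_iff by blast
    qed
  qed
  interpret I: ideal "uea_ideal Virasoro" "free_algebra (carrier Virasoro)"
    by (rule ideal_uea_ideal[OF lie_algebra_Virasoro])
  have central: "T (free_gen x * (free_gen vir_z * q)) = T (free_gen vir_z * (free_gen x * q))" for x q
  proof -
    have rels: "free_gen x * free_gen vir_z - free_gen vir_z * free_gen x - free_gen 0 \<in> uea_rels Virasoro"
      "free_gen 0 \<in> uea_rels Virasoro"
    proof -
      show "free_gen x * free_gen vir_z - free_gen vir_z * free_gen x - free_gen 0 \<in> uea_rels Virasoro"
        unfolding uea_rels_def
        by (rule UnI2, intro CollectI exI[of _ x] exI[of _ vir_z]) (simp add: bracket_Virasoro_z)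
      show "free_gen 0 \<in> uea_rels Virasoro"
        unfolding uea_rels_def
        by (rule UnI1, rule UnI2, intro CollectI exI[of _ 0]) (simp add: free_scalar_def)
    qed
    have "r * q \<in> M.ker" if "r \<in> uea_rels Virasoro" for r
    proof -
      have "r \<in> uea_ideal Virasoro" using that uea_ideal_rels[OF lie_algebra_Virasoro] by blast
      from I.I_r_closed[OF this, of q] show ?thesis using IC.uea_ideal_ker ker by auto
    qed
    from VS.subspace_add[OF M.subspace_ker this[OF rels(1)] this[OF rels(2)]]
    show ?thesis unfolding M.eq_iff by (simp add: algebra_simps)
  qed
  have stable: "T (free_gen x * p) \<in> N" if "T p \<in> N" for x p
  proof -
    from that obtain q where "T p = T (free_gen vir_z * q)" by (auto simp: N_iff)
    then have "T (free_gen x * p) = T (free_gen x * (free_gen vir_z * q))"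
      by (simp flip: M.act_eq)
    then show ?thesis unfolding N_iff central by blast
  qed
  define Q where "Q p = (\<lambda>j. T (j + p)) ` {j. T j \<in> N}" for p
  have N_sub: "N \<subseteq> carrier (M_psi \<chi>)" by (auto simp: N_def M.carrier_eq M.act_eq)
  note quotient = M.presentation_quotient[OF N_sub subspace stable, folded Q_def]
  have L: "L_psi_0 \<chi> = quotient_rep (M_psi \<chi>) N" by (simp add: L_psi_0_def N_def)
  have Q_ker: "presentation.ker Q = {p. T p \<in> N}" by (rule quotient(2))
  have ker_N: "M.ker \<subseteq> {p. T p \<in> N}"
    using VS.subspace_0[OF subspace] by (auto simp: M.ker_def)
  show thesis
  proof (rule that)
    show "presentation (L_psi_0 \<chi>) Q" unfolding L by (rule quotient(1))
    show "uea_ideal Virasoro \<subseteq> presentation.ker Q"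
      using IC.uea_ideal_ker ker ker_N unfolding Q_ker by blast
    show "free_gen vir_z * p \<in> presentation.ker Q" for p
      unfolding Q_ker mem_Collect_eq N_iff by blast
    show "free_gen x - free_scalar (\<chi> x) \<in> presentation.ker Q" if "x \<in> n_plus" for x
      using IC.character_ker[OF that] ker ker_N unfolding Q_ker by blast
  next
    fix V :: "(vir, 'v) lie_rep" and w p
    assume V: "lie_module Virasoro V" and w: "w \<in> carrier V"
      and \<chi>: "\<And>x. x \<in> n_plus \<Longrightarrow> act V x w = \<chi> x \<odot>\<^bsub>V\<^esub> w"
      and z: "\<And>v. v \<in> carrier V \<Longrightarrow> act V vir_z v = \<zero>\<^bsub>V\<^esub>" and p: "p \<in> presentation.ker Q"
    interpret V: lie_module Virasoro V by (rule V)
    from p obtain q where "T p = T (free_gen vir_z * q)" by (auto simp: Q_ker N_iff)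
    then have "free_act V p w = free_act V (free_gen vir_z * q) w"
      unfolding T_def using \<chi> by (intro IC.frobenius_reciprocity[OF V w])
    also have "\<dots> = free_act V (free_gen vir_z) (free_act V q w)"
      using V.free_act_mult[OF _ _ w, of "free_gen vir_z" q] by (simp only: IC.F_L UNIV_I)
    also have "\<dots> = \<zero>\<^bsub>V\<^esub>"
    proof -
      have "free_act V q w \<in> carrier V"
        using V.free_act_closed[OF _ w, of q] by (simp only: IC.F_L UNIV_I)
      then show ?thesis using z by simp
    qed
    finally show "free_act V p w = \<zero>\<^bsub>V\<^esub>" .
  qed
qed

theorem proposition6p1:
  fixes \<psi> :: "witt \<Rightarrow> complex" and V :: "(witt, 'v) lie_rep"
  assumes "\<psi> \<in> lie_hom (Witt\<lparr>carrier := n_plus_witt\<rparr>) abelian_lie_complex"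
    and "\<psi> (witt_d 1) \<noteq> 0"
    and "\<psi> (witt_d 2) \<noteq> 0"
    and "whittaker_module \<psi> V"
    and "carrier V \<noteq> {\<zero>\<^bsub>V\<^esub>}"
  shows "simple_lie_module Witt V
    \<and> lie_modules_isomorphic Witt V (as_witt_module (L_psi_0 (\<psi> \<circ> rho)))"
proof -
  define \<chi> where "\<chi> = \<psi> \<circ> rho"
  define V' where "V' = pullback rho V"
  have \<psi>_add: "\<psi> (x + y) = \<psi> x + \<psi> y" if "x \<in> n_plus_witt" "y \<in> n_plus_witt" for x y
    using assms(1) that by (auto simp: lie_hom_def abelian_lie_complex_def)
  have \<psi>_scale: "\<psi> (scale c x) = c * \<psi> x" if "x \<in> n_plus_witt" for c x
    using assms(1) that by (auto simp: lie_hom_def abelian_lie_complex_def)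
  have \<psi>_bracket: "\<psi> (bracket Witt x y) = 0" if "x \<in> n_plus_witt" "y \<in> n_plus_witt" for x y
    using assms(1) that by (auto simp: lie_hom_def abelian_lie_complex_def)
  have witt_d: "witt_d k \<in> n_plus_witt" if "k > 0" for k
    using that by (auto simp: n_plus_witt_eq intro: VS.span_base)
  have vir_d: "vir_d k \<in> n_plus" if "k > 0" for k
    using that by (auto simp: n_plus_eq intro: VS.span_base)
  have \<psi>_ge3: "\<psi> (witt_d k) = 0" if "k \<ge> 3" for k
  proof -
    have "of_int (k - 2) * \<psi> (witt_d k) = \<psi> (bracket Witt (witt_d 1) (witt_d (k - 1)))"
      using that by (simp add: bracket_Witt \<psi>_scale[OF witt_d])
    also have "\<dots> = 0" using that by (intro \<psi>_bracket witt_d) auto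
    finally show ?thesis using that by auto
  qed
  have rho_bracket: "rho (bracket Virasoro x y) = bracket Witt (rho x) (rho y)" for x y
    using rho_lie_hom by (auto simp: lie_hom_def)
  have "lie_module (Virasoro\<lparr>carrier := n_plus\<rparr>) (one_dim_rep \<chi>)"
    by (rule lie_module_one_dim_rep[OF lie_algebra_n_plus])
      (auto simp: \<chi>_def \<psi>_add \<psi>_scale \<psi>_bracket rho_n_plus rho_bracket)
  then obtain Q where Q: "presentation (L_psi_0 \<chi>) Q" "uea_ideal Virasoro \<subseteq> presentation.ker Q"
    "\<And>p. free_gen vir_z * p \<in> presentation.ker Q"
    "\<And>x. x \<in> n_plus \<Longrightarrow> free_gen x - free_scalar (\<chi> x) \<in> presentation.ker Q"
    "\<And>(V :: (vir, 'v) lie_rep) w p. \<lbrakk>lie_module Virasoro V; w \<in> carrier V; \<And>x. x \<in> n_plus \<Longrightarrow> act V x w = \<chi> x \<odot>\<^bsub>V\<^esub> w;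
      \<And>v. v \<in> carrier V \<Longrightarrow> act V vir_z v = \<zero>\<^bsub>V\<^esub>; p \<in> presentation.ker Q\<rbrakk>
      \<Longrightarrow> free_act V p w = \<zero>\<^bsub>V\<^esub>"
    by (rule presentation_L_psi_0) blast
  interpret Q: presentation "L_psi_0 \<chi>" Q by (rule Q(1))
  interpret W: whittaker_presentation scale "\<lambda>k p. free_gen (vir_d k) * p" Q.ker 1 "\<lambda>k. \<psi> (witt_d k)"
    by (rule whittaker_presentation_ker[OF Q(1-3)])
      (use Q(4)[OF vir_d] assms(3) \<psi>_ge3 in \<open>auto simp: \<chi>_def\<close>)
  from assms(4) obtain w where V: "lie_module Witt V" and w: "w \<in> carrier V"
    "generated_submodule Witt V {w} = carrier V" "\<And>x. x \<in> n_plus_witt \<Longrightarrow> act V x w = \<psi> x \<odot>\<^bsub>V\<^esub> w"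
    unfolding whittaker_module_def by blast
  interpret V: lie_module Witt V by (rule V)
  interpret V': lie_module Virasoro V'
    unfolding V'_def by (rule lie_module_pullback[OF lie_algebra_Virasoro V rho_lie_hom])
  have V'_simps: "carrier V' = carrier V" "\<zero>\<^bsub>V'\<^esub> = \<zero>\<^bsub>V\<^esub>" "add V' = add V" "module.smult V' = module.smult V"
    "act V' x = act V (rho x)" for x
    by (simp_all add: V'_def)
  define ev where "ev p = free_act V' p w" for p
  have F: "carrier (free_algebra (carrier Virasoro)) = UNIV"
    by (auto simp: free_algebra_def)
  have w': "w \<in> carrier V'" using w(1) by (simp add: V'_simps)
  have ev_closed: "ev p \<in> carrier V" for p
    using V'.free_act_closed[OF _ w', of p] by (simp only: F UNIV_I ev_def V'_simps)
  have ev_add: "ev (p + q) = ev p \<oplus>\<^bsub>V\<^esub> ev q" for p q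
    using V'.free_act_add[OF _ _ w', of p q] by (simp only: F UNIV_I ev_def V'_simps)
  have ev_mult: "ev (p * q) = free_act V' p (ev q)" for p q
    using V'.free_act_mult[OF _ _ w', of p q] by (simp only: F UNIV_I ev_def)
  have ev_0: "ev 0 = \<zero>\<^bsub>V\<^esub>"
    by (simp add: ev_def V'_simps)
  have ev_1: "ev 1 = w"
    using V'.free_act_scalar[OF w', of 1] V.M.smult_one[simplified, OF w(1)]
    by (simp add: ev_def free_scalar_def V'_simps)
  have ev_scale: "ev (scale c p) = c \<odot>\<^bsub>V\<^esub> ev p" for c p
    using V'.free_act_scalar[of "ev p" c] ev_closed[of p] by (simp add: scale_eq_mult ev_mult V'_simps)
  have ev_gen: "ev (free_gen x * p) = act V (rho x) (ev p)" for x p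
    using V'.free_act_gen[of x "ev p"] ev_closed[of p] by (simp add: ev_mult V'_simps)
  have rho_inv: "rho (inv_into (carrier Virasoro) rho x) = x" for x
    using f_inv_into_f[of x rho "carrier Virasoro"] rho_surj by simp
  have "submodule (range ev) complex_ring V"
  proof (rule V.M.submoduleI)
    fix a assume "a \<in> range ev"
    then obtain p where p: "a = ev p" by blast
    have "ev (- p) = \<ominus>\<^bsub>V\<^esub> a"
      using ev_add[of "- p" p] ev_closed p ev_0 by (intro V.M.minus_equality[symmetric]) auto
    then show "\<ominus>\<^bsub>V\<^esub> a \<in> range ev" using rangeI[of ev "- p"] by simp
  next
    show "\<zero>\<^bsub>V\<^esub> \<in> range ev" using rangeI[of ev 0] unfolding ev_0 .
  qed (use ev_closed in \<open>auto simp flip: ev_add ev_scale\<close>)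
  moreover have "act V x v \<in> range ev" if "v \<in> range ev" for x v
  proof -
    from that obtain p where p: "v = ev p" by blast
    show ?thesis
      using rangeI[of ev "free_gen (inv_into (carrier Virasoro) rho x) * p"] unfolding ev_gen rho_inv p .
  qed
  moreover have "w \<in> range ev" using rangeI[of ev 1] unfolding ev_1 .
  ultimately have "generated_submodule Witt V {w} \<subseteq> range ev"
    unfolding generated_submodule_def lie_submodule_def by blast
  then have range_ev: "carrier V = range ev" using w(2) ev_closed by auto
  have pres: "presentation V' ev"
    by unfold_locales (simp_all add: V'_simps range_ev ev_0 ev_add ev_scale ev_gen)
  interpret ev: presentation V' ev by (rule pres)
  have ker_le: "Q.ker \<subseteq> ev.ker"
  proof
    fix p assume "p \<in> Q.ker"
    \<comment> \<open>\<open>z\<close> acts on the pulled back module as \<open>rho z = 0\<close>.\<close>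
    have "act V \<zero>\<^bsub>Witt\<^esub> v = \<zero>\<^bsub>V\<^esub>" if "v \<in> carrier V" for v
      using V.act_smult_left[of 0 v 0] V.act_closed[of 0 v] that V.M.smult_l_null[simplified] by simp
    then have "free_act V' p w = \<zero>\<^bsub>V'\<^esub>"
      using \<open>p \<in> Q.ker\<close> V'.lie_module_axioms w' w(3) rho_n_plus
      by (intro Q(5)) (auto simp: V'_simps \<chi>_def)
    then show "p \<in> ev.ker" by (simp add: ev.ker_def ev_0 V'_simps flip: ev_def)
  qed
  have maximal: "J \<subseteq> Q.ker"
    if "VS.subspace J" "ev.ker \<subseteq> J" "\<And>k x. x \<in> J \<Longrightarrow> free_gen (vir_d k) * x \<in> J" "1 \<notin> J" for J
    using that ker_le by (intro W.maximal) auto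
  have w_0: "w \<noteq> \<zero>\<^bsub>V\<^esub>"
  proof
    assume "w = \<zero>\<^bsub>V\<^esub>"
    then have "ev p = \<zero>\<^bsub>V\<^esub>" for p
      using ev_mult[of p 1] ev_mult[of p 0] ev_1 ev_0 by simp
    then have "range ev = {\<zero>\<^bsub>V\<^esub>}" by auto
    then show False using assms(5) range_ev by simp
  qed
  have "simple_lie_module Witt V"
    unfolding simple_lie_module_def
  proof (intro conjI allI impI V assms(5))
    fix N assume N: "lie_submodule N Witt V"
    then have sub: "submodule N complex_ring V" and act: "\<And>x v. v \<in> N \<Longrightarrow> act V x v \<in> N"
      by (auto simp: lie_submodule_def)
    note N_sub = V.M.submoduleE[OF sub]
    have N_0: "\<zero>\<^bsub>V\<^esub> \<in> N" using subgroup.one_closed[OF submodule.axioms(1)[OF sub]] by simp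
    show "N = {\<zero>\<^bsub>V\<^esub>} \<or> N = carrier V"
    proof (cases "w \<in> N")
      case True
      then have "carrier V \<subseteq> N"
        using N unfolding w(2)[symmetric] generated_submodule_def by blast
      then show ?thesis using N_sub(1) by auto
    next
      case False
      have "{p. ev p \<in> N} \<subseteq> Q.ker"
      proof (rule maximal)
        show "VS.subspace {p. ev p \<in> N}"
          using N_0 N_sub(4,5) by (auto simp: VS.subspace_def ev_0 ev_add ev_scale)
        show "ev.ker \<subseteq> {p. ev p \<in> N}"
          using N_0 by (auto simp: ev.ker_def ev_0)
        show "free_gen (vir_d k) * p \<in> {p. ev p \<in> N}" if "p \<in> {p. ev p \<in> N}" for k p
          using that act by (simp add: ev_gen)
      qed (use False ev_1 in simp)
      then have "ev p = \<zero>\<^bsub>V\<^esub>" if "ev p \<in> N" for p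
        using that ker_le by (auto simp: ev.ker_def ev_0)
      then have "v = \<zero>\<^bsub>V\<^esub>" if "v \<in> N" for v
        using that N_sub(1) range_ev by auto
      then show ?thesis using N_0 by blast
    qed
  qed
  moreover have "ev.ker \<subseteq> Q.ker"
    using w_0 by (intro maximal ev.subspace_ker ev.gen_mult_ker order_refl) (auto simp: ev.ker_def ev_0 ev_1)
  then have "ev.ker = Q.ker" using ker_le by blast
  then obtain f where f: "f \<in> lie_module_iso Virasoro V' (L_psi_0 \<chi>)"
    using presentation_iso[OF pres Q(1)] by blast
  have "f (act V x v) = act (L_psi_0 \<chi>) (inv_into (carrier Virasoro) rho x) (f v)" if "v \<in> carrier V" for x v
  proof -
    have "f (act V' y v) = act (L_psi_0 \<chi>) y (f v)" for y
      using f that by (auto simp: lie_module_iso_def V'_simps)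
    from this[of "inv_into (carrier Virasoro) rho x"] show ?thesis
      by (simp only: V'_simps rho_inv)
  qed
  then have "f \<in> lie_module_iso Witt V (as_witt_module (L_psi_0 \<chi>))"
    using f by (auto simp: lie_module_iso_def as_witt_module_def V'_simps)
  then have "lie_modules_isomorphic Witt V (as_witt_module (L_psi_0 (\<psi> \<circ> rho)))"
    unfolding lie_modules_isomorphic_def \<chi>_def by blast
  ultimately show ?thesis by blast
qed

end
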